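(* Let $n\ge 2$ be an integer. The restricted outer Weyl group $\lambda(\mathcal P_n)^{-1}/\operatorname{Inn}\lambda(\mathcal P_n)^{-1}$ of $\mathcal O_n$ is naturally isomorphic (via the map induced by restriction of automorphisms to $\mathcal D_n$) to the quotient group $\mathfrak G_n/\mathfrak{IG}_n$.
   Context: Let $n\ge 2$. $\mathcal O_n$ is the Cuntz algebra, the $C^*$-algebra generated by isometries $S_1,\dots,S_n$ with $\sum_{i=1}^n S_iS_i^*=1$. For $k\ge 0$, $W_n^k$ is the set of words $\mu=(\mu_1,\dots,\mu_k)$ with letters in $\{1,\dots,n\}$, $S_\mu=S_{\mu_1}\cdots S_{\mu_k}$ (and $S_\emptyset=1$), $P_\mu=S_\mu S_\mu^*$. $\mathcal D_n$ (the diagonal) is the $C^*$-subalgebra generated by all $P_\mu$, and $\mathcal D_n^k=\mathrm{span}\{P_\mu:\mu\in W_n^k\}$. $\mathcal P_n=\bigcup_k\mathcal P_n^k$, where $\mathcal P_n^k$ is the set of unitaries $\sum_{\mu\in W_n^k}S_{\sigma(\mu)}S_\mu^*$ with $\sigma$ a permutation of $W_n^k$. For a unitary $u\in\mathcal O_n$, $\lambda_u$ is the unital $*$-endomorphism of $\mathcal O_n$ with $\lambda_u(S_i)=uS_i$ for all $i$, and $\mathrm{Ad}(u)(x)=uxu^*$. $\lambda(\mathcal P_n)^{-1}$ denotes the group (under composition) $\{\lambda_u: u\in\mathcal P_n,\ \lambda_u\in\mathrm{Aut}(\mathcal O_n)\}$, and $\operatorname{Inn}\lambda(\mathcal P_n)^{-1}=\{\mathrm{Ad}(u):u\in\mathcal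 P_n\}$ is its normal subgroup of inner permutative automorphisms. The canonical shift is $\varphi(x)=\sum_{i=1}^n S_ixS_i^*$; it restricts to an endomorphism of $\mathcal D_n$ (with $\varphi^0=\mathrm{id}$). An automorphism $\alpha$ of $\mathcal D_n$ has property (P) if there is an integer $m\ge 0$ such that $\alpha\varphi^k(x)=\varphi^{k-m}\alpha\varphi^m(x)$ for all $k\ge m$ and all $x\in\mathcal D_n^1$. $\mathfrak G_n$ is the group of all $\alpha\in\mathrm{Aut}(\mathcal D_n)$ such that both $\alpha$ and $\alpha^{-1}$ have property (P), and $\mathfrak{IG}_n=\{\mathrm{Ad}(u)|_{\mathcal D_n}:u\in\mathcal P_n\}$, a normal subgroup of $\mathfrak G_n$. *)

theory Defs
  imports Complex_Main "HOL-Library.FuncSet" "HOL-Algebra.Coset"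
begin

section \<open>Unital C*-algebras and their C*-subalgebras\<close>

text \<open>
  The axiom \<open>norm 1 = 1\<close> of \<open>real_normed_algebra_1\<close> excludes only the zero algebra.
\<close>

class cstar_algebra = banach + real_normed_algebra_1 +
  fixes scaleC :: "complex \<Rightarrow> 'a \<Rightarrow> 'a" (infixr "*\<^sub>C" 75)
    and adj :: "'a \<Rightarrow> 'a"
  assumes scaleC_add_right: "c *\<^sub>C (x + y) = c *\<^sub>C x + c *\<^sub>C y"
    and scaleC_add_left: "(c + d) *\<^sub>C x = c *\<^sub>C x + d *\<^sub>C x"
    and scaleC_scaleC: "c *\<^sub>C (d *\<^sub>C x) = (c * d) *\<^sub>C x"
    and scaleC_of_real: "complex_of_real r *\<^sub>C x = r *\<^sub>R x"
    and scaleC_mult_left: "(c *\<^sub>C x) * y = c *\<^sub>C (x * y)"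
    and scaleC_mult_right: "x * (c *\<^sub>C y) = c *\<^sub>C (x * y)"
    and norm_scaleC: "norm (c *\<^sub>C x) = cmod c * norm x"
    and adj_add: "adj (x + y) = adj x + adj y"
    and adj_scaleC: "adj (c *\<^sub>C x) = cnj c *\<^sub>C adj x"
    and adj_mult: "adj (x * y) = adj y * adj x"
    and adj_adj: "adj (adj x) = x"
    and cstar_identity: "norm (adj x * x) = (norm x)\<^sup>2"

definition cstar_subalgebra :: "'a::cstar_algebra set \<Rightarrow> bool" where
  "cstar_subalgebra A \<longleftrightarrow>
     closed A \<and> 0 \<in> A \<and>
     (\<forall>x\<in>A. \<forall>y\<in>A. x + y \<in> A \<and> x * y \<in> A) \<and>
     (\<forall>c. \<forall>x\<in>A. c *\<^sub>C x \<in> A) \<and>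
     (\<forall>x\<in>A. adj x \<in> A)"

definition cstar_generated :: "'a::cstar_algebra set \<Rightarrow> 'a set" where
  "cstar_generated X = \<Inter>{A. cstar_subalgebra A \<and> X \<subseteq> A}"

text \<open>
  Maps on a subalgebra \<open>A\<close> are total functions with the value \<open>undefined\<close> outside \<open>A\<close>,
  so that two of them are equal as soon as they agree on \<open>A\<close>.
\<close>

definition unital_star_endos :: "'a::cstar_algebra set \<Rightarrow> ('a \<Rightarrow> 'a) set" where
  "unital_star_endos A = {f \<in> A \<rightarrow>\<^sub>E A.
     (\<forall>x\<in>A. \<forall>y\<in>A. f (x + y) = f x + f y \<and> f (x * y) = f x * f y) \<and>
     (\<forall>c. \<forall>x\<in>A. f (c *\<^sub>C x) = c *\<^sub>C f x) \<and>
     (\<forall>x\<in>A. f (adj x) = adj (f x)) \<and>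
     f 1 = 1}"

definition star_auts :: "'a::cstar_algebra set \<Rightarrow> ('a \<Rightarrow> 'a) set" where
  "star_auts A = {f \<in> unital_star_endos A. bij_betw f A A}"

definition Ad_on :: "'a::cstar_algebra set \<Rightarrow> 'a \<Rightarrow> 'a \<Rightarrow> 'a" where
  "Ad_on A u = (\<lambda>x\<in>A. u * x * adj u)"

definition comp_group :: "'a set \<Rightarrow> ('a \<Rightarrow> 'a) set \<Rightarrow> ('a \<Rightarrow> 'a) monoid" where
  "comp_group A H = \<lparr>carrier = H, mult = compose A, one = (\<lambda>x\<in>A. x)\<rparr>"


section \<open>The Cuntz algebra and its diagonal\<close>

definition cuntz_family :: "nat \<Rightarrow> (nat \<Rightarrow> 'a::cstar_algebra) \<Rightarrow> bool" where
  "cuntz_family n S \<longleftrightarrow>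
     (\<forall>i\<in>{1..n}. adj (S i) * S i = 1) \<and> (\<Sum>i=1..n. S i * adj (S i)) = 1"

text \<open>
  By Cuntz's uniqueness theorem, for \<open>n \<ge> 2\<close> the algebras generated by any two families
  with these relations are canonically isomorphic, so no universal property is imposed.
\<close>

definition cuntz_algebra :: "nat \<Rightarrow> (nat \<Rightarrow> 'a::cstar_algebra) \<Rightarrow> 'a set" where
  "cuntz_algebra n S = cstar_generated (S ` {1..n})"

definition cuntz_words :: "nat \<Rightarrow> nat \<Rightarrow> nat list set" where
  "cuntz_words n k = {\<mu>. length \<mu> = k \<and> set \<mu> \<subseteq> {1..n}}"

definition word_isometry :: "(nat \<Rightarrow> 'a::cstar_algebra) \<Rightarrow> nat list \<Rightarrow> 'a" where
  "word_isometry S \<mu> = prod_list (map S \<mu>)"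

definition word_proj :: "(nat \<Rightarrow> 'a::cstar_algebra) \<Rightarrow> nat list \<Rightarrow> 'a" where
  "word_proj S \<mu> = word_isometry S \<mu> * adj (word_isometry S \<mu>)"

definition diagonal :: "nat \<Rightarrow> (nat \<Rightarrow> 'a::cstar_algebra) \<Rightarrow> 'a set" where
  "diagonal n S = cstar_generated (word_proj S ` (\<Union>k. cuntz_words n k))"

definition diagonal_level :: "nat \<Rightarrow> (nat \<Rightarrow> 'a::cstar_algebra) \<Rightarrow> nat \<Rightarrow> 'a set" where
  "diagonal_level n S k = {\<Sum>\<mu>\<in>cuntz_words n k. c \<mu> *\<^sub>C word_proj S \<mu> | c. True}"

definition canonical_shift :: "nat \<Rightarrow> (nat \<Rightarrow> 'a::cstar_algebra) \<Rightarrow> 'a \<Rightarrow> 'a" where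
  "canonical_shift n S x = (\<Sum>i=1..n. S i * x * adj (S i))"


section \<open>Permutative automorphisms and the restricted outer Weyl group\<close>

definition perm_unitaries :: "nat \<Rightarrow> (nat \<Rightarrow> 'a::cstar_algebra) \<Rightarrow> 'a set" where
  "perm_unitaries n S = (\<Union>k.
     {\<Sum>\<mu>\<in>cuntz_words n k. word_isometry S (\<sigma> \<mu>) * adj (word_isometry S \<mu>) | \<sigma>.
        bij_betw \<sigma> (cuntz_words n k) (cuntz_words n k)})"

text \<open>
  For unitary \<open>u\<close> in the Cuntz algebra, with \<open>n \<ge> 2\<close>, there is exactly one such endomorphism.
\<close>

definition cuntz_endo :: "nat \<Rightarrow> (nat \<Rightarrow> 'a::cstar_algebra) \<Rightarrow> 'a \<Rightarrow> 'a \<Rightarrow> 'a" where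
  "cuntz_endo n S u =
     (THE f. f \<in> unital_star_endos (cuntz_algebra n S) \<and> (\<forall>i\<in>{1..n}. f (S i) = u * S i))"

definition perm_auts :: "nat \<Rightarrow> (nat \<Rightarrow> 'a::cstar_algebra) \<Rightarrow> ('a \<Rightarrow> 'a) set" where
  "perm_auts n S = {cuntz_endo n S u | u.
     u \<in> perm_unitaries n S \<and> cuntz_endo n S u \<in> star_auts (cuntz_algebra n S)}"

definition perm_aut_group :: "nat \<Rightarrow> (nat \<Rightarrow> 'a::cstar_algebra) \<Rightarrow> ('a \<Rightarrow> 'a) monoid" where
  "perm_aut_group n S = comp_group (cuntz_algebra n S) (perm_auts n S)"

definition inner_perm_auts :: "nat \<Rightarrow> (nat \<Rightarrow> 'a::cstar_algebra) \<Rightarrow> ('a \<Rightarrow> 'a) set" where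
  "inner_perm_auts n S = Ad_on (cuntz_algebra n S) ` perm_unitaries n S"


section \<open>Automorphisms of the diagonal with property (P)\<close>

definition property_P :: "nat \<Rightarrow> (nat \<Rightarrow> 'a::cstar_algebra) \<Rightarrow> ('a \<Rightarrow> 'a) \<Rightarrow> bool" where
  "property_P n S \<alpha> \<longleftrightarrow> (\<exists>m. \<forall>k\<ge>m. \<forall>x\<in>diagonal_level n S 1.
     \<alpha> ((canonical_shift n S ^^ k) x) =
     (canonical_shift n S ^^ (k - m)) (\<alpha> ((canonical_shift n S ^^ m) x)))"

definition diag_auts_P :: "nat \<Rightarrow> (nat \<Rightarrow> 'a::cstar_algebra) \<Rightarrow> ('a \<Rightarrow> 'a) set" where
  "diag_auts_P n S = {\<alpha> \<in> star_auts (diagonal n S).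
     property_P n S \<alpha> \<and>
     property_P n S (restrict (inv_into (diagonal n S) \<alpha>) (diagonal n S))}"

definition diag_aut_group :: "nat \<Rightarrow> (nat \<Rightarrow> 'a::cstar_algebra) \<Rightarrow> ('a \<Rightarrow> 'a) monoid" where
  "diag_aut_group n S = comp_group (diagonal n S) (diag_auts_P n S)"

definition inner_diag_auts :: "nat \<Rightarrow> (nat \<Rightarrow> 'a::cstar_algebra) \<Rightarrow> ('a \<Rightarrow> 'a) set" where
  "inner_diag_auts n S = Ad_on (diagonal n S) ` perm_unitaries n S"

end

theory Submission
  imports Defs "HOL-Analysis.Elementary_Normed_Spaces"
begin

text \<open>
  Everything rests on three facts. First, a Cuntz endomorphism \<open>\<lambda>\<^sub>u\<close> is a limit of compressions
  \<open>x \<mapsto> X\<^sub>N\<^sup>* x X\<^sub>N\<close> by isometries: with \<open>u\<^sub>k = u \<phi>(u) \<dots> \<phi>\<^sup>k\<^sup>-\<^sup>1(u)\<close> and a word \<open>w\<close> that does not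
  overlap itself, \<open>X\<^sub>N\<close> is the normalised sum over \<open>i < N\<close> of the isometries
  \<open>\<phi>\<^sup>N\<^sup>+\<^sup>i(S\<^sub>w) u\<^sub>N\<^sub>+\<^sub>i\<^sup>*\<close>, whose ranges are orthogonal. So \<open>\<lambda>\<^sub>u\<close> is contractive on the span of the
  \<open>S\<^sub>\<mu> S\<^sub>\<nu>\<^sup>*\<close>, hence exists, without Cuntz's uniqueness theorem.

  Second, an endomorphism of the diagonal that fixes the range of some \<open>\<phi>\<^sup>k\<close> pointwise and kills
  no \<open>P\<^sub>\<mu>\<close> is \<open>Ad v\<close> for a permutative \<open>v\<close>: for large \<open>L\<close> it sends the projections of words of
  length \<open>L\<close> to nonzero orthogonal sums of such projections, so by counting it permutes them.

  Third, if \<open>\<lambda>\<^sub>u\<close> is an automorphism with \<open>u\<close> permutative, then \<open>w = \<lambda>\<^sub>u\<^sup>-\<^sup>1(u\<^sup>*)\<close> is gauge invariant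
  and normalises the diagonal, and by the second fact it is permutative up to a unitary of the
  diagonal, which must be trivial. Hence \<open>\<lambda>\<^sub>u\<^sup>-\<^sup>1 = \<lambda>\<^sub>w\<close>, and property (P) holds from the level of \<open>w\<close>
  on. Conversely, for \<open>\<alpha>\<close> in \<open>\<GG>\<^sub>n\<close>, the second fact applied to
  \<open>S\<^sub>i y S\<^sub>i\<^sup>* \<mapsto> \<alpha>(S\<^sub>i \<alpha>\<^sup>-\<^sup>1(y) S\<^sub>i\<^sup>*)\<close> yields a \<open>u\<close> with \<open>\<alpha> = \<lambda>\<^sub>u\<close> on the diagonal. So restriction to
  the diagonal is an isomorphism \<open>\<lambda>(\<P>\<^sub>n)\<^sup>-\<^sup>1 \<cong> \<GG>\<^sub>n\<close>, which matches the inner automorphisms.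
\<close>

section \<open>C*-algebras\<close>

text \<open>\<open>cuntz_endo\<close> is a definite description, so \<open>lam u\<close> has to be
  constructed. One isometry \<open>(\<phi> ^^ a) (s w) * adj (cocycle u a)\<close> compresses
  \<open>s \<alpha> * adj (s \<beta>)\<close> to the right element when the two words have equal
  length, but to 0 when the lengths differ and \<open>w\<close> does not overlap itself. Summing
  over a range of \<open>a\<close> lets summands with different \<open>a\<close> pair up and absorb
  the difference in length; only pairs at the boundary are lost, and their share tends to 0. Norms
  and positivity are handled by identities instead of spectra: \<open>a * a + d * d = 1\<close> for
  commuting self-adjoint \<open>a\<close> and \<open>d\<close> bounds \<open>norm a\<close> by 1,
  and it survives unital star-homomorphisms and sums over blocks. This is the use of the square
  roots. In the third fact \<open>w\<close> is known only as a preimage. Gauge invariance makes it a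
  limit of combinations \<open>q\<close> of matrix units, and \<open>q\<close> commutes exactly with
  high shifts. So conjugation by \<open>w\<close> moves the idempotents
  \<open>(\<phi> ^^ k) (P \<rho>)\<close> by less than 1, and commuting idempotents so close are
  equal: the approximation becomes the exact fixing that the second fact asks for.\<close>

lemma adj_0 [simp]: "adj (0::'a::cstar_algebra) = 0"
  using adj_add[of "0::'a" 0] by simp

lemma adj_1 [simp]: "adj (1::'a::cstar_algebra) = 1"
  using adj_mult[of "adj (1::'a)" 1] by (simp add: adj_adj)

lemma scaleC_1 [simp]: "1 *\<^sub>C x = (x::'a::cstar_algebra)"
  using scaleC_of_real[of 1 x] by simp

lemma scaleC_0_left [simp]: "0 *\<^sub>C x = (0::'a::cstar_algebra)"
  using scaleC_of_real[of 0 x] by simp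

lemma scaleC_0_right [simp]: "c *\<^sub>C (0::'a::cstar_algebra) = 0"
  using scaleC_add_right[of c "0::'a" 0] by simp

lemma scaleC_neg1: "(-1) *\<^sub>C x = - (x::'a::cstar_algebra)"
  using scaleC_of_real[of "-1" x] by simp

lemma scaleC_minus_right: "c *\<^sub>C (- x) = - (c *\<^sub>C (x::'a::cstar_algebra))"
  by (metis add_eq_0_iff scaleC_add_right scaleC_0_right)

lemma scaleC_minus_left: "(- c) *\<^sub>C x = - (c *\<^sub>C (x::'a::cstar_algebra))"
  by (metis add_eq_0_iff scaleC_add_left scaleC_0_left)

lemma scaleC_diff_right: "c *\<^sub>C (x - y) = c *\<^sub>C x - c *\<^sub>C (y::'a::cstar_algebra)"
  using scaleC_add_right[of c x "- y"] by (simp add: scaleC_minus_right)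

lemma scaleC_diff_left: "(c - d) *\<^sub>C x = c *\<^sub>C x - d *\<^sub>C (x::'a::cstar_algebra)"
  using scaleC_add_left[of c "- d" x] by (simp add: scaleC_minus_left)

lemma scaleC_sum_right: "c *\<^sub>C sum f A = (\<Sum>x\<in>A. c *\<^sub>C (f x :: 'a::cstar_algebra))"
  by (induction A rule: infinite_finite_induct) (auto simp: scaleC_add_right)

lemma scaleC_sum_left: "sum f A *\<^sub>C (x :: 'a::cstar_algebra) = (\<Sum>i\<in>A. f i *\<^sub>C x)"
  by (induction A rule: infinite_finite_induct) (auto simp: scaleC_add_left)

lemma adj_minus: "adj (- x) = - adj (x::'a::cstar_algebra)"
  by (metis add_eq_0_iff adj_add adj_0)

lemma adj_diff: "adj (x - y) = adj x - adj (y::'a::cstar_algebra)"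
  using adj_add[of x "- y"] by (simp add: adj_minus)

lemma adj_sum: "adj (sum f A) = (\<Sum>x\<in>A. adj (f x :: 'a::cstar_algebra))"
  by (induction A rule: infinite_finite_induct) (auto simp: adj_add)

lemma adj_scaleR: "adj (r *\<^sub>R x) = r *\<^sub>R adj (x::'a::cstar_algebra)"
  by (metis adj_scaleC complex_cnj_complex_of_real scaleC_of_real)

lemma norm_adj [simp]: "norm (adj x) = norm (x::'a::cstar_algebra)"
proof -
  have le: "norm y \<le> norm (adj y)" for y :: 'a
  proof (cases "y = 0")
    case False
    have "(norm y)\<^sup>2 \<le> norm (adj y) * norm y"
      by (metis cstar_identity norm_mult_ineq)
    then show ?thesis using False by (simp add: power2_eq_square)
  qed auto
  show ?thesis using le[of x] le[of "adj x"] by (simp add: adj_adj)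
qed

lemma bounded_linear_adj: "bounded_linear (adj :: 'a::cstar_algebra \<Rightarrow> 'a)"
  by (rule bounded_linear_intro[where K=1]) (auto simp: adj_add adj_scaleR)

lemma bounded_linear_scaleC: "bounded_linear (\<lambda>x::'a::cstar_algebra. c *\<^sub>C x)"
  by (rule bounded_linear_intro[where K="cmod c"])
    (auto simp: scaleC_add_right norm_scaleC scaleC_scaleC mult.commute simp flip: scaleC_of_real)

lemmas tendsto_adj = bounded_linear.tendsto[OF bounded_linear_adj]
lemmas tendsto_scaleC = bounded_linear.tendsto[OF bounded_linear_scaleC]
lemmas continuous_on_adj [continuous_intros] = bounded_linear.continuous_on[OF bounded_linear_adj]
lemmas continuous_on_scaleC [continuous_intros] =
  bounded_linear.continuous_on[OF bounded_linear_scaleC]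

lemma norm_isometry:
  fixes u :: "'a::cstar_algebra"
  assumes "adj u * u = 1"
  shows "norm u = 1"
  using cstar_identity[of u] assms norm_ge_zero[of u] by (simp add: power2_eq_1_iff)

lemma norm_compress_le:
  fixes X :: "'a::cstar_algebra"
  assumes "norm X \<le> 1"
  shows "norm (adj X * z * X) \<le> norm z"
proof -
  have "norm (adj X * z * X) \<le> norm (adj X) * norm z * norm X"
    by (rule order_trans[OF norm_mult_ineq mult_right_mono[OF norm_mult_ineq]]) simp
  also have "\<dots> \<le> 1 * norm z * 1" using assms by (intro mult_mono) auto
  finally show ?thesis by simp
qed

lemma cstar_zero: "adj x * x = 0 \<Longrightarrow> x = (0::'a::cstar_algebra)"
  using cstar_identity[of x] by simp

lemma continuous_on_contraction:
  fixes f :: "'a::metric_space \<Rightarrow> 'b::metric_space"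
  assumes "\<And>x y. x \<in> A \<Longrightarrow> y \<in> A \<Longrightarrow> dist (f x) (f y) \<le> dist x y"
  shows "continuous_on A f"
  unfolding continuous_on_iff using assms by (metis order.strict_trans1)

lemma equalizer_closed:
  fixes f g :: "'a::real_normed_vector \<Rightarrow> 'b::real_normed_vector"
  assumes "closed A" "continuous_on A f" "continuous_on A g"
  shows "closed {x \<in> A. f x = g x}"
  using continuous_closed_preimage_constant[of A "\<lambda>x. f x - g x" 0] assms
  by (simp add: continuous_on_diff)

subsection \<open>Closed spans and generated subalgebras\<close>

definition csubspace :: "'a::cstar_algebra set \<Rightarrow> bool" where
  "csubspace V \<longleftrightarrow> 0 \<in> V \<and> (\<forall>x\<in>V. \<forall>y\<in>V. x + y \<in> V) \<and> (\<forall>c. \<forall>x\<in>V. c *\<^sub>C x \<in> V)"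

text \<open>The complex linear span, generated one scaled element at a time, so that an induction
  over it handles a single generator per step and can merge thresholds by
  \<open>max\<close>.\<close>

inductive_set cspan :: "'a::cstar_algebra set \<Rightarrow> 'a set" for X where
  cspan_0: "0 \<in> cspan X"
| cspan_step: "x \<in> X \<Longrightarrow> y \<in> cspan X \<Longrightarrow> c *\<^sub>C x + y \<in> cspan X"

lemma cspan_base: "x \<in> X \<Longrightarrow> x \<in> cspan X"
  using cspan_step[OF _ cspan_0, of x X 1] by simp

lemma csubspaceD:
  assumes "csubspace V"
  shows "0 \<in> V" "x \<in> V \<Longrightarrow> y \<in> V \<Longrightarrow> x + y \<in> V" "x \<in> V \<Longrightarrow> c *\<^sub>C x \<in> V"
    "x \<in> V \<Longrightarrow> y \<in> V \<Longrightarrow> x - y \<in> V"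
proof -
  show "0 \<in> V" "x \<in> V \<Longrightarrow> y \<in> V \<Longrightarrow> x + y \<in> V" "x \<in> V \<Longrightarrow> c *\<^sub>C x \<in> V"
    using assms by (auto simp: csubspace_def)
  assume "x \<in> V" "y \<in> V"
  then have "x + (-1) *\<^sub>C y \<in> V" using assms unfolding csubspace_def by blast
  then show "x - y \<in> V" by (simp add: scaleC_neg1)
qed

lemma csubspace_sum: "csubspace V \<Longrightarrow> (\<And>i. i \<in> A \<Longrightarrow> f i \<in> V) \<Longrightarrow> sum f A \<in> V"
  by (induction A rule: infinite_finite_induct) (auto simp: csubspaceD)

lemma csubspace_cspan: "csubspace (cspan X)"
proof -
  have "x + y \<in> cspan X" if "x \<in> cspan X" "y \<in> cspan X" for x y
    using that by (induction x) (auto simp: add.assoc intro: cspan_step)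
  moreover have "c *\<^sub>C x \<in> cspan X" if "x \<in> cspan X" for c x
    using that by (induction x)
      (auto simp: scaleC_add_right scaleC_scaleC intro: cspan_0 cspan_step)
  ultimately show ?thesis by (auto simp: csubspace_def cspan_0)
qed

lemma cspan_subset: "X \<subseteq> V \<Longrightarrow> csubspace V \<Longrightarrow> cspan X \<subseteq> V"
proof
  fix x assume "X \<subseteq> V" "csubspace V" "x \<in> cspan X"
  show "x \<in> V" using \<open>x \<in> cspan X\<close>
    by (induction x) (use \<open>X \<subseteq> V\<close> \<open>csubspace V\<close> in \<open>auto simp: csubspaceD\<close>)
qed

lemma closure_cspan_subset: "X \<subseteq> V \<Longrightarrow> csubspace V \<Longrightarrow> closed V \<Longrightarrow> closure (cspan X) \<subseteq> V"
  using closure_minimal cspan_subset by metis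

lemma cstar_subalgebraD:
  assumes "cstar_subalgebra A"
  shows "closed A" "0 \<in> A" "x \<in> A \<Longrightarrow> y \<in> A \<Longrightarrow> x + y \<in> A" "x \<in> A \<Longrightarrow> y \<in> A \<Longrightarrow> x * y \<in> A"
    "x \<in> A \<Longrightarrow> c *\<^sub>C x \<in> A" "x \<in> A \<Longrightarrow> adj x \<in> A" "csubspace A"
    "x \<in> A \<Longrightarrow> y \<in> A \<Longrightarrow> x - y \<in> A"
proof -
  show sub: "csubspace A" using assms by (simp add: cstar_subalgebra_def csubspace_def)
  show "x \<in> A \<Longrightarrow> y \<in> A \<Longrightarrow> x - y \<in> A" using csubspaceD(4)[OF sub] .
qed (use assms in \<open>auto simp: cstar_subalgebra_def\<close>)

lemma cstar_subalgebra_UNIV: "cstar_subalgebra UNIV"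
  by (simp add: cstar_subalgebra_def)

lemma cstar_generated_subalgebra: "cstar_subalgebra (cstar_generated X)"
proof -
  have "closed (cstar_generated X)"
    unfolding cstar_generated_def by (rule closed_Inter) (auto simp: cstar_subalgebraD(1))
  then show ?thesis
    unfolding cstar_subalgebra_def cstar_generated_def by (simp add: cstar_subalgebraD(2-6))
qed

lemma cstar_generated_base: "x \<in> X \<Longrightarrow> x \<in> cstar_generated X"
  by (auto simp: cstar_generated_def)

lemma cstar_generated_minimal: "cstar_subalgebra A \<Longrightarrow> X \<subseteq> A \<Longrightarrow> cstar_generated X \<subseteq> A"
  by (auto simp: cstar_generated_def)

text \<open>The span of \<open>X\<close> is already a star-algebra: products are pushed into it one
  factor at a time by bilinearity. The algebra operations are continuous, so its closure is a
  C*-subalgebra.\<close>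

lemma cstar_generated_eq_closure:
  fixes X G :: "'a::cstar_algebra set"
  assumes gen: "G \<subseteq> X" and X: "X \<subseteq> cstar_generated G"
    and mult: "\<And>x y. x \<in> X \<Longrightarrow> y \<in> X \<Longrightarrow> x * y \<in> cspan X" and adj: "\<And>x. x \<in> X \<Longrightarrow> adj x \<in> X"
  shows "cstar_generated G = closure (cspan X)"
proof
  let ?B = "cspan X"
  note sub = csubspaceD[OF csubspace_cspan[of X]]
  have mulB: "x * y \<in> ?B" if "x \<in> ?B" "y \<in> ?B" for x y
  proof -
    have "X \<subseteq> {x. \<forall>y\<in>X. x * y \<in> ?B}" using mult by auto
    then have "?B \<subseteq> {x. \<forall>y\<in>X. x * y \<in> ?B}"
      by (rule cspan_subset) (auto simp: csubspace_def sub distrib_right scaleC_mult_left)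
    then have "X \<subseteq> {y. \<forall>x\<in>?B. x * y \<in> ?B}" by auto
    then have "?B \<subseteq> {y. \<forall>x\<in>?B. x * y \<in> ?B}"
      by (rule cspan_subset) (auto simp: csubspace_def sub distrib_left scaleC_mult_right)
    then show ?thesis using that by auto
  qed
  have "?B \<subseteq> {x. adj x \<in> ?B}"
    by (rule cspan_subset) (auto simp: csubspace_def sub adj_add adj_scaleC adj cspan_base)
  then have adjB: "adj x \<in> ?B" if "x \<in> ?B" for x using that by auto
  have "cstar_subalgebra (closure ?B)"
    unfolding cstar_subalgebra_def
  proof (intro conjI ballI allI)
    show "0 \<in> closure ?B" using closure_subset sub(1) by blast
    fix x y assume "x \<in> closure ?B" "y \<in> closure ?B"
    then obtain f g where f: "\<And>n. f n \<in> ?B" "f \<longlonglongrightarrow> x" and g: "\<And>n. g n \<in> ?B" "g \<longlonglongrightarrow> y"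
      by (auto simp: closure_sequential)
    show "x + y \<in> closure ?B" using tendsto_add[OF f(2) g(2)] f(1) g(1) sub(2)
      by (auto simp: closure_sequential intro!: exI[of _ "\<lambda>n. f n + g n"])
    show "x * y \<in> closure ?B" using tendsto_mult[OF f(2) g(2)] f(1) g(1) mulB
      by (auto simp: closure_sequential intro!: exI[of _ "\<lambda>n. f n * g n"])
  next
    fix c x assume "x \<in> closure ?B"
    then obtain f where f: "\<And>n. f n \<in> ?B" "f \<longlonglongrightarrow> x" by (auto simp: closure_sequential)
    show "c *\<^sub>C x \<in> closure ?B" using tendsto_scaleC[OF f(2)] f(1) sub(3)
      by (auto simp: closure_sequential intro!: exI[of _ "\<lambda>n. c *\<^sub>C f n"])
  next
    fix x assume "x \<in> closure ?B"
    then obtain f where f: "\<And>n. f n \<in> ?B" "f \<longlonglongrightarrow> x" by (auto simp: closure_sequential)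
    show "adj x \<in> closure ?B" using tendsto_adj[OF f(2)] f(1) adjB
      by (auto simp: closure_sequential intro!: exI[of _ "\<lambda>n. adj (f n)"])
  qed auto
  moreover have "G \<subseteq> closure ?B" using gen cspan_base closure_subset by blast
  ultimately show "cstar_generated G \<subseteq> closure ?B" by (rule cstar_generated_minimal)
  show "closure ?B \<subseteq> cstar_generated G"
    using cstar_generated_subalgebra[of G] cstar_subalgebraD(1,7) closure_cspan_subset[OF X] by blast
qed

subsection \<open>Square roots, contractivity and positivity\<close>

text \<open>
  Writing \<open>d = 1 - z\<close>, the equation \<open>d\<^sup>2 = 1 - k\<close> becomes \<open>z = (k + z\<^sup>2) / 2\<close>, whose right-hand
  side is a contraction of the ball of radius \<open>norm k\<close>.
\<close>

lemma cstar_sqrt: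
  fixes k :: "'a::cstar_algebra"
  assumes A: "cstar_subalgebra A" "1 \<in> A" and k: "k \<in> A" "adj k = k" "norm k < 1"
  obtains d where "d \<in> A" "adj d = d" "d * d = 1 - k" "\<And>y. y * k = k * y \<Longrightarrow> y * d = d * y"
proof -
  \<comment> \<open>Every property wanted of the root is a closed condition preserved by
    \<open>f\<close>, so it is built into the complete set on which the fixed point is sought. The
    commutation clause lets two roots commute later.\<close>
  define C where "C = A \<inter> {z. adj z = z} \<inter> {z. \<forall>y. y * k = k * y \<longrightarrow> y * z = z * y} \<inter> cball 0 (norm k)"
  define f where "f z = (1/2) *\<^sub>R (k + z * z)" for z
  have CD: "z \<in> A" "adj z = z" "norm z \<le> norm k" "y * k = k * y \<Longrightarrow> y * z = z * y"
    if "z \<in> C" for y z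
    using that unfolding C_def by simp_all
  have CI: "z \<in> C" if "z \<in> A" "adj z = z" "norm z \<le> norm k" "\<And>y. y * k = k * y \<Longrightarrow> y * z = z * y"
    for z
    using that unfolding C_def by (intro IntI CollectI allI impI) simp_all
  have "closed C"
    unfolding C_def using cstar_subalgebraD(1)[OF A(1)]
    by (intro closed_Int closed_cball)
      (auto intro!: closed_Collect_eq closed_Collect_all closed_Collect_imp continuous_intros)
  then have "complete C" by (simp add: complete_eq_closed)
  moreover have "0 \<in> C" using cstar_subalgebraD(2)[OF A(1)] by (intro CI) simp_all
  then have "C \<noteq> {}" by blast
  moreover have "f ` C \<subseteq> C"
  proof
    fix w assume "w \<in> f ` C"
    then obtain z where w: "w = f z" and z: "z \<in> C" by auto
    have "norm (z * z) \<le> norm k * norm k"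
      by (rule order_trans[OF norm_mult_ineq mult_mono]) (use CD[OF z] in simp_all)
    also have "\<dots> \<le> norm k" using k(3) mult_left_le[of "norm k" "norm k"] by simp
    finally have "norm (k + z * z) \<le> 2 * norm k"
      using norm_triangle_ineq[of k "z * z"] by simp
    moreover have "f z \<in> A"
      unfolding f_def scaleC_of_real[symmetric]
      by (intro cstar_subalgebraD(3,4,5)[OF A(1)] k) (use CD[OF z] in simp_all)
    moreover have "y * f z = f z * y" if "y * k = k * y" for y
    proof -
      have "y * z = z * y" using CD(4)[OF z] that .
      then have "y * (z * z) = z * z * y" by (metis mult.assoc)
      then show ?thesis using that by (simp add: f_def distrib_left distrib_right)
    qed
    moreover have "adj (f z) = f z"
      by (simp add: CD(2)[OF z] k f_def adj_scaleR adj_add adj_mult)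
    ultimately show "w \<in> C" unfolding w by (intro CI) (auto simp: f_def)
  qed
  moreover have "dist (f x) (f y) \<le> norm k * dist x y" if "x \<in> C" "y \<in> C" for x y
  proof -
    have "f x - f y = (1/2) *\<^sub>R (x * (x - y) + (x - y) * y)"
      by (simp add: f_def algebra_simps)
    also have "norm \<dots> \<le> (1/2) * (norm x * norm (x - y) + norm (x - y) * norm y)"
      using norm_triangle_ineq[of "x * (x - y)" "(x - y) * y"] norm_mult_ineq[of x "x - y"]
        norm_mult_ineq[of "x - y" y] by simp
    also have "\<dots> \<le> (1/2) * (norm k * norm (x - y) + norm (x - y) * norm k)"
      by (intro mult_left_mono add_mono mult_right_mono) (use CD(3) that in simp_all)
    finally show ?thesis by (simp add: dist_norm)
  qed
  ultimately have "\<exists>!z\<in>C. f z = z"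
    using Banach_fix[of C "norm k" f] k(3) norm_ge_zero by blast
  then obtain z where z: "z \<in> C" "f z = z" by blast
  have "z + z = 2 *\<^sub>R f z" using z by (simp add: scaleR_2)
  then have zz: "z + z = k + z * z" by (simp add: f_def)
  show ?thesis
  proof
    show "1 - z \<in> A" using A z cstar_subalgebraD(8)[OF A(1)] CD(1) by blast
    show "adj (1 - z) = 1 - z" using CD(2)[OF z(1)] by (simp add: adj_diff)
    show "(1 - z) * (1 - z) = 1 - k" using zz by (simp add: algebra_simps)
    show "y * (1 - z) = (1 - z) * y" if "y * k = k * y" for y
      using CD(4)[OF z(1) that] by (simp add: algebra_simps)
  qed
qed

text \<open>\<open>d\<close> is the root of \<open>1 - a * a\<close>; it commutes with
  \<open>a\<close> because \<open>a\<close> commutes with \<open>a * a\<close>. Then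
  \<open>a + i d\<close> is unitary, and the identity is a certificate for
  \<open>norm a \<le> 1\<close> that any unital star-homomorphism carries over.\<close>

lemma square_complement:
  fixes a :: "'a::cstar_algebra"
  assumes A: "cstar_subalgebra A" "1 \<in> A" and a: "a \<in> A" "adj a = a" "norm a < 1"
  obtains d where "d \<in> A" "adj d = d" "a * a + d * d = 1" "a * d = d * a"
proof -
  have "norm (a * a) < 1"
    using norm_mult_ineq[of a a] mult_left_le[of "norm a" "norm a"] a(3) by simp
  moreover have "a * a \<in> A" "adj (a * a) = a * a" using cstar_subalgebraD(4)[OF A(1)] a by (auto simp: adj_mult)
  ultimately obtain d where d: "d \<in> A" "adj d = d" "d * d = 1 - a * a"
      and c: "\<And>y. y * (a * a) = (a * a) * y \<Longrightarrow> y * d = d * y"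
    using cstar_sqrt[OF A, of "a * a"] by metis
  have "a * d = d * a" by (rule c) (simp add: mult.assoc)
  then show ?thesis using that[OF d(1,2)] d(3) by simp
qed

text \<open>\<open>d + \<i>e\<close> is a multiple of a unitary.\<close>

lemma norm_le_of_sum_squares:
  fixes d e :: "'a::cstar_algebra"
  assumes "adj d = d" "adj e = e" "d * e = e * d" "d * d + e * e = c *\<^sub>R 1" and c: "0 \<le> c"
  shows "(norm d)\<^sup>2 \<le> c"
proof -
  define y where "y = d + \<i> *\<^sub>C e"
  have ay: "adj y = d - \<i> *\<^sub>C e"
    by (simp add: y_def adj_add adj_scaleC assms scaleC_minus_left)
  have "adj y * y = c *\<^sub>R 1"
    unfolding ay using assms(3,4)
    by (simp add: y_def algebra_simps scaleC_mult_left scaleC_mult_right scaleC_scaleC scaleC_neg1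
        scaleC_minus_left scaleC_add_right scaleC_diff_right)
  then have ny: "(norm y)\<^sup>2 = c" using cstar_identity[of y] c by simp
  have "y + adj y = 2 *\<^sub>R d" unfolding ay by (simp add: y_def scaleR_2)
  then have "2 * norm d \<le> norm y + norm (adj y)" by (metis norm_scaleR norm_triangle_ineq abs_numeral)
  then have "norm d \<le> norm y" by simp
  then show ?thesis using ny by (metis norm_ge_zero power_mono)
qed

text \<open>The bounds \<open>norm (s - a) \<le> s\<close> and \<open>norm (t + a) \<le> t\<close>
  say that \<open>a\<close> and \<open>- a\<close> are positive, without spectra. For each
  \<open>e > 0\<close> they yield commuting roots \<open>d\<close> of \<open>e + a\<close> and
  \<open>f\<close> of \<open>e - a\<close>; as \<open>d * d + f * f\<close> is the scalar
  \<open>2 * e\<close>, \<open>norm (e + a) \<le> 2 * e\<close> follows, and \<open>e\<close> is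
  arbitrary.\<close>

lemma selfadjoint_eq_0:
  fixes a :: "'a::cstar_algebra"
  assumes a: "adj a = a" and p: "norm (s *\<^sub>R 1 - a) \<le> s" and q: "norm (t *\<^sub>R 1 + a) \<le> t"
  shows "a = 0"
proof -
  \<comment> \<open>Enlarging the centre keeps such a bound by the triangle inequality, so one
    radius serves both signs.\<close>
  define r where "r = max s t"
  have s: "s \<ge> 0" "t \<ge> 0" using p q norm_ge_zero order_trans by blast+
  have "norm ((r - s) *\<^sub>R 1 + (s *\<^sub>R 1 - a)) \<le> (r - s) + s"
    by (rule norm_triangle_le) (use p in \<open>auto simp: r_def\<close>)
  then have P: "norm (r *\<^sub>R 1 - a) \<le> r" by (simp add: algebra_simps)
  have "norm ((r - t) *\<^sub>R 1 + (t *\<^sub>R 1 + a)) \<le> (r - t) + t"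
    by (rule norm_triangle_le) (use q in \<open>auto simp: r_def\<close>)
  then have Q: "norm (r *\<^sub>R 1 + a) \<le> r" by (simp add: algebra_simps)
  have r: "r \<ge> 0" using s by (simp add: r_def)
  have "norm a \<le> 3 * e" if e: "e > 0" for e
  proof -
    have sqrt: "\<exists>d. adj d = d \<and> d * d = e *\<^sub>R 1 + b \<and> (\<forall>y. y * b = b * y \<longrightarrow> y * d = d * y)"
      if b: "adj b = b" "norm (r *\<^sub>R 1 - b) \<le> r" for b :: 'a
    proof -
      \<comment> \<open>Dividing by \<open>r + e\<close> instead of \<open>r\<close> makes the norm
        strictly less than 1, while \<open>(r + e) *\<^sub>R (1 - k)\<close> is
        \<open>e + b\<close>.\<close>
      define k where "k = (1 / (r + e)) *\<^sub>R (r *\<^sub>R 1 - b)"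
      have k1: "norm k < 1" using b(2) r e by (simp add: k_def divide_less_eq)
      have k2: "adj k = k" by (simp add: k_def adj_scaleR adj_diff b)
      obtain d where d: "adj d = d" "d * d = 1 - k" "\<And>y. y * k = k * y \<Longrightarrow> y * d = d * y"
        by (rule cstar_sqrt[OF cstar_subalgebra_UNIV UNIV_I UNIV_I k2 k1]) blast
      have "(r + e) *\<^sub>R k = r *\<^sub>R 1 - b" using r e by (simp add: k_def)
      then have "(r + e) *\<^sub>R (1 - k) = e *\<^sub>R 1 + b"
        by (simp add: scaleR_diff_right scaleR_add_left)
      moreover have "(sqrt (r + e) *\<^sub>R d) * (sqrt (r + e) *\<^sub>R d) = (r + e) *\<^sub>R (1 - k)"
        using r e d(2) by simp
      moreover have "y * (sqrt (r + e) *\<^sub>R d) = (sqrt (r + e) *\<^sub>R d) * y" if "y * b = b * y" for y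
      proof -
        have "y * k = k * y" using that by (simp add: k_def right_diff_distrib left_diff_distrib)
        then show ?thesis using d(3)[of y] by simp
      qed
      moreover have "adj (sqrt (r + e) *\<^sub>R d) = sqrt (r + e) *\<^sub>R d" using d(1) by (simp add: adj_scaleR)
      ultimately show ?thesis by metis
    qed
    obtain d where d: "adj d = d" "d * d = e *\<^sub>R 1 + a" "\<And>y. y * a = a * y \<Longrightarrow> y * d = d * y"
      using sqrt[OF a P] by blast
    have a': "adj (- a) = - a" "norm (r *\<^sub>R 1 - - a) \<le> r" using a Q by (simp_all add: adj_minus)
    obtain f where f: "adj f = f" "f * f = e *\<^sub>R 1 + - a" "\<And>y. y * - a = - a * y \<Longrightarrow> y * f = f * y"
      using sqrt[OF a'] by blast
    have "a * d = d * a" by (rule d(3)) simp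
    then have "d * f = f * d" by (intro f(3)) simp
    moreover have "d * d + f * f = (2 * e) *\<^sub>R 1"
      unfolding d(2) f(2) by (simp add: scaleR_2[symmetric])
    ultimately have "(norm d)\<^sup>2 \<le> 2 * e"
      using e by (intro norm_le_of_sum_squares[OF d(1) f(1)]) auto
    then have "norm (e *\<^sub>R 1 + a) \<le> 2 * e" using cstar_identity[of d] d(1,2) by simp
    then show ?thesis using norm_triangle_ineq4[of "e *\<^sub>R 1 + a" "e *\<^sub>R 1"] e by simp
  qed
  then have "norm a \<le> 0 + e" if "e > 0" for e using that \<open>\<And>e. e > 0 \<Longrightarrow> norm a \<le> 3 * e\<close>[of "e / 3"] by simp
  then have "norm a \<le> 0" by (rule field_le_epsilon)
  then show ?thesis by simp
qed

lemma unital_star_endosD: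
  assumes "f \<in> unital_star_endos A"
  shows "x \<in> A \<Longrightarrow> f x \<in> A" "x \<in> A \<Longrightarrow> y \<in> A \<Longrightarrow> f (x + y) = f x + f y"
    "x \<in> A \<Longrightarrow> y \<in> A \<Longrightarrow> f (x * y) = f x * f y" "x \<in> A \<Longrightarrow> f (c *\<^sub>C x) = c *\<^sub>C f x"
    "x \<in> A \<Longrightarrow> f (adj x) = adj (f x)" "f 1 = 1" "x \<notin> A \<Longrightarrow> f x = undefined"
    "f \<in> extensional A"
  using assms by (auto simp: unital_star_endos_def PiE_def extensional_def)

locale star_endo =
  fixes A :: "'a::cstar_algebra set" and f
  assumes A: "cstar_subalgebra A" "1 \<in> A" and f: "f \<in> unital_star_endos A"
begin

lemmas fD = unital_star_endosD[OF f]
lemmas AD = cstar_subalgebraD[OF A(1)]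

lemma f_0: "f 0 = 0"
  using fD(4)[OF A(2), of 0] by simp

lemma f_diff: "x \<in> A \<Longrightarrow> y \<in> A \<Longrightarrow> f (x - y) = f x - f y"
  using fD(2)[of x "(-1) *\<^sub>C y"] fD(4)[of y "-1"] AD(5)[of y "-1"] by (simp add: scaleC_neg1)

lemma f_sum: "(\<And>i. i \<in> I \<Longrightarrow> g i \<in> A) \<Longrightarrow> f (sum g I) = (\<Sum>i\<in>I. f (g i))"
  by (induction I rule: infinite_finite_induct) (auto simp: f_0 fD(2) csubspace_sum[OF AD(7)])

text \<open>For self-adjoint \<open>a\<close> of norm below 1 the relation
  \<open>a * a + d * d = 1\<close> is preserved by \<open>f\<close>, which bounds
  \<open>f a\<close>. Scaling removes the restriction on the norm, with slack \<open>e\<close> for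
  the strict inequality, and the C*-identity reduces general \<open>x\<close> to
  \<open>adj x * x\<close>.\<close>

lemma f_norm_le:
  assumes x: "x \<in> A"
  shows "norm (f x) \<le> norm x"
proof -
  have *: "norm (f a) \<le> 1" if a: "a \<in> A" "adj a = a" "norm a < 1" for a
  proof -
    obtain d where d: "d \<in> A" "adj d = d" "a * a + d * d = 1" "a * d = d * a"
      using square_complement[OF A a] by blast
    have "f a * f d = f d * f a" using d a fD(3) by metis
    moreover have "f a * f a + f d * f d = 1"
      using fD(2)[of "a * a" "d * d"] fD(3,6) AD(4) a d(1,3) by simp
    ultimately have "(norm (f a))\<^sup>2 \<le> 1"
      using fD(5)[OF a(1)] fD(5)[OF d(1)] a(2) d(2) by (intro norm_le_of_sum_squares[of _ "f d"]) auto
    then show ?thesis by (simp add: power_le_one_iff)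
  qed
  have sa: "norm (f a) \<le> norm a" if a: "a \<in> A" "adj a = a" for a
  proof (rule field_le_epsilon)
    fix e :: real assume e: "e > 0"
    define r where "r = norm a + e"
    have r: "r > 0" using e by (simp add: r_def add_nonneg_pos)
    define b where "b = complex_of_real (1 / r) *\<^sub>C a"
    have "norm ((1 / r) *\<^sub>R a) < 1" using e r by (simp add: divide_less_eq) (simp add: r_def)
    then have "norm b < 1" by (simp only: b_def scaleC_of_real)
    moreover have "b \<in> A" "adj b = b" using a AD(5) by (auto simp: b_def adj_scaleC)
    ultimately have "norm (f b) \<le> 1" using * by blast
    then have "norm ((1 / r) *\<^sub>R f a) \<le> 1"
      using fD(4)[OF a(1), of "complex_of_real (1 / r)"] by (simp only: b_def scaleC_of_real)
    then show "norm (f a) \<le> norm a + e" using r by (simp add: divide_le_eq) (simp add: r_def)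
  qed
  have "(norm (f x))\<^sup>2 = norm (f (adj x * x))"
    using x fD(3,5) AD(6) by (simp add: cstar_identity)
  also have "\<dots> \<le> norm (adj x * x)"
    using x AD by (intro sa) (auto simp: adj_mult adj_adj)
  finally show ?thesis by (simp add: cstar_identity power_mono_iff)
qed

lemma f_continuous: "continuous_on A f"
  using f_norm_le AD(8) by (intro continuous_on_contraction) (simp add: dist_norm flip: f_diff)

end

text \<open>Continuity is automatic by \<open>f_norm_le\<close>, so the equalizer is a closed
  star-subalgebra containing \<open>G\<close>.\<close>

lemma unital_star_endos_eqI:
  assumes one: "1 \<in> cstar_generated G"
    and f: "f \<in> unital_star_endos (cstar_generated G)" and g: "g \<in> unital_star_endos (cstar_generated G)"
    and eq: "\<And>x. x \<in> G \<Longrightarrow> f x = g x"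
  shows "f = g"
proof (rule extensionalityI[of _ "cstar_generated G"])
  let ?A = "cstar_generated G"
  interpret f: star_endo ?A f using one f cstar_generated_subalgebra by unfold_locales
  interpret g: star_endo ?A g using one g cstar_generated_subalgebra by unfold_locales
  show "f \<in> extensional ?A" "g \<in> extensional ?A" using f.fD(8) g.fD(8) .
  have "closed {x \<in> ?A. f x = g x}"
    by (intro equalizer_closed f.f_continuous g.f_continuous f.AD)
  then have "cstar_subalgebra {x \<in> ?A. f x = g x}"
    using f.AD f.fD g.fD f.f_0 g.f_0 by (auto simp: cstar_subalgebra_def)
  moreover have "G \<subseteq> {x \<in> ?A. f x = g x}" using eq cstar_generated_base by blast
  ultimately have "?A \<subseteq> {x \<in> ?A. f x = g x}" by (rule cstar_generated_minimal)
  then show "\<And>x. x \<in> ?A \<Longrightarrow> f x = g x" by blast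
qed

subsection \<open>Unitaries\<close>

definition unitary :: "'a::cstar_algebra \<Rightarrow> bool" where
  "unitary u \<longleftrightarrow> adj u * u = 1 \<and> u * adj u = 1"

lemma unitary_simps:
  assumes "unitary u"
  shows "adj u * u = 1" "u * adj u = 1" "adj u * (u * x) = x" "u * (adj u * x) = x"
  using assms by (auto simp: unitary_def simp flip: mult.assoc)

lemma unitary_mult: "unitary u \<Longrightarrow> unitary v \<Longrightarrow> unitary (u * v)"
  unfolding unitary_def[of "u * v"] adj_mult
  using unitary_simps[of u] unitary_simps[of v] by (simp add: mult.assoc)

lemma unitary_adj: "unitary u \<Longrightarrow> unitary (adj u)"
  by (auto simp: unitary_def adj_adj)

lemma unitary_1: "unitary 1"
  by (simp add: unitary_def)

lemma Ad_endo:
  assumes A: "cstar_subalgebra A" "1 \<in> A" and w: "unitary w" and inv: "\<And>x. x \<in> A \<Longrightarrow> w * x * adj w \<in> A"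
  shows "Ad_on A w \<in> unital_star_endos A"
proof -
  note D = cstar_subalgebraD[OF A(1)]
  have "w * (x * y) * adj w = w * x * adj w * (w * y * adj w)" for x y
    by (simp add: mult.assoc unitary_simps[OF w])
  then show ?thesis
    using unitary_simps[OF w] inv A(2) D(3-6)
    by (auto simp: unital_star_endos_def Ad_on_def distrib_left distrib_right scaleC_mult_left
        scaleC_mult_right adj_mult adj_adj mult.assoc)
qed

section \<open>Words in a Cuntz family\<close>

locale cuntz =
  fixes n :: nat and S :: "nat \<Rightarrow> 'a::cstar_algebra"
  assumes n2: "n \<ge> 2" and fam: "cuntz_family n S"
begin

abbreviation W where "W \<equiv> cuntz_words n"
abbreviation words where "words \<equiv> lists {1..n}"
abbreviation s where "s \<equiv> word_isometry S"
abbreviation P where "P \<equiv> word_proj S"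
abbreviation \<phi> where "\<phi> \<equiv> canonical_shift n S"
abbreviation \<O> where "\<O> \<equiv> cuntz_algebra n S"
abbreviation \<D> where "\<D> \<equiv> diagonal n S"

lemma S_isometry: "i \<in> {1..n} \<Longrightarrow> adj (S i) * S i = 1"
  and sum_S: "(\<Sum>i=1..n. S i * adj (S i)) = 1"
  using fam by (auto simp: cuntz_family_def)

text \<open>
  Compressing \<open>\<Sum>\<^sub>j S\<^sub>j S\<^sub>j\<^sup>* = 1\<close> by \<open>S\<^sub>i\<close> leaves \<open>\<Sum>\<^sub>j\<^sub>\<noteq>\<^sub>i S\<^sub>i\<^sup>* S\<^sub>j S\<^sub>j\<^sup>* S\<^sub>i = 0\<close>. The summands are
  positive in the sense \<open>norm (1/2 - a) \<le> 1/2\<close>, because \<open>2 S\<^sub>j S\<^sub>j\<^sup>* - 1\<close> is unitary.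
\<close>

lemma S_orthogonal:
  assumes i: "i \<in> {1..n}" and j: "j \<in> {1..n}" and "i \<noteq> j"
  shows "adj (S i) * S j = 0"
proof -
  define a where "a j = adj (S i) * (S j * adj (S j)) * S i" for j
  have pos: "norm ((1/2) *\<^sub>R 1 - a j) \<le> 1/2" if j: "j \<in> {1..n}" for j
  proof -
    define v where "v = 1 - 2 *\<^sub>R (S j * adj (S j))"
    have "S j * adj (S j) * (S j * adj (S j)) = S j * (adj (S j) * S j) * adj (S j)"
      by (simp only: mult.assoc)
    then have pp: "S j * adj (S j) * (S j * adj (S j)) = S j * adj (S j)"
      using S_isometry[OF j] by simp
    have "adj v = v" by (simp add: v_def adj_diff adj_scaleR adj_mult adj_adj)
    moreover have "v * v = 1" using pp by (simp add: v_def algebra_simps)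
        (simp flip: scaleR_add_left)
    ultimately have "norm v = 1" by (intro norm_isometry) simp
    moreover have "norm (adj (S i)) = 1" "norm (S i) = 1"
      using norm_isometry[OF S_isometry[OF i]] by auto
    ultimately have "norm (adj (S i) * v * S i) \<le> 1"
      using norm_mult_ineq[of "adj (S i) * v" "S i"] norm_mult_ineq[of "adj (S i)" v] by simp
    moreover have "adj (S i) * v * S i = 2 *\<^sub>R ((1/2) *\<^sub>R 1 - a j)"
      using S_isometry[OF i] by (simp add: v_def a_def algebra_simps)
    ultimately show ?thesis by simp
  qed
  have sum_pos: "norm ((card A / 2) *\<^sub>R 1 - sum a A) \<le> card A / 2" if "A \<subseteq> {1..n}" for A
  proof -
    have "finite A" using that finite_subset by blast
    then have "(card A / 2) *\<^sub>R 1 - sum a A = (\<Sum>j\<in>A. (1/2) *\<^sub>R 1 - a j)"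
      unfolding sum_subtractf scaleR_sum_left[symmetric] by simp
    moreover have "norm (\<Sum>j\<in>A. (1/2) *\<^sub>R 1 - a j) \<le> (\<Sum>j\<in>A. 1/2)"
      using pos that by (intro sum_norm_le) blast
    ultimately show ?thesis by simp
  qed
  have "(\<Sum>j=1..n. a j) = adj (S i) * (\<Sum>j=1..n. S j * adj (S j)) * S i"
    by (simp add: a_def sum_distrib_left sum_distrib_right)
  then have "(\<Sum>j=1..n. a j) = 1" unfolding sum_S using S_isometry[OF i] by simp
  moreover have "a i = 1" using S_isometry[OF i] by (simp add: a_def flip: mult.assoc)
  moreover have "(\<Sum>j=1..n. a j) = a i + (a j + sum a ({1..n} - {i, j}))"
  proof -
    have "sum a {1..n} = a i + sum a ({1..n} - {i})" using i by (intro sum.remove) auto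
    also have "sum a ({1..n} - {i}) = a j + sum a ({1..n} - {i} - {j})"
      using j \<open>i \<noteq> j\<close> by (intro sum.remove) auto
    also have "{1..n} - {i} - {j} = {1..n} - {i, j}" by auto
    finally show ?thesis .
  qed
  \<comment> \<open>As \<open>a i\<close> is already the whole sum, the remaining summands together
    are \<open>- a j\<close>; hence both \<open>a j\<close> and \<open>- a j\<close> meet the
    positivity bound.\<close>
  ultimately have eq: "sum a ({1..n} - {i, j}) = - a j" by (simp add: add_eq_0_iff)
  have "a j = 0"
  proof (rule selfadjoint_eq_0)
    show "adj (a j) = a j" by (simp add: a_def adj_mult adj_adj mult.assoc)
    show "norm ((1/2) *\<^sub>R 1 - a j) \<le> 1/2" using pos j .
    show "norm ((card ({1..n} - {i, j}) / 2) *\<^sub>R 1 + a j) \<le> card ({1..n} - {i, j}) / 2"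
      using sum_pos[of "{1..n} - {i, j}"] unfolding eq diff_minus_eq_add by blast
  qed
  then have "adj (S j) * S i = 0"
    by - (rule cstar_zero, simp add: a_def adj_mult adj_adj mult.assoc)
  then show ?thesis by (metis adj_0 adj_adj adj_mult)
qed

lemma S_adj_S: "i \<in> {1..n} \<Longrightarrow> j \<in> {1..n} \<Longrightarrow> adj (S i) * S j = (if i = j then 1 else 0)"
  using S_isometry S_orthogonal by auto

lemma word_Nil [simp]: "s [] = 1"
  and word_Cons: "s (i # \<mu>) = S i * s \<mu>"
  and word_append: "s (\<mu> @ \<nu>) = s \<mu> * s \<nu>"
  by (simp_all add: word_isometry_def)

lemma W_iff: "\<mu> \<in> W k \<longleftrightarrow> length \<mu> = k \<and> \<mu> \<in> words"
  by (auto simp: cuntz_words_def)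

lemma W_words: "\<mu> \<in> W k \<Longrightarrow> \<mu> \<in> words"
  by (simp add: W_iff)

lemma W_0 [simp]: "W 0 = {[]}"
  by (auto simp: W_iff)

lemma finite_W [simp]: "finite (W k)"
  using finite_lists_length_eq[of "{1..n}" k] by (simp add: cuntz_words_def conj_commute)

lemma W_append: "W (k + l) = (\<lambda>(\<mu>, \<nu>). \<mu> @ \<nu>) ` (W k \<times> W l)"
proof
  show "W (k + l) \<subseteq> (\<lambda>(\<mu>, \<nu>). \<mu> @ \<nu>) ` (W k \<times> W l)"
  proof
    fix \<mu> assume \<mu>: "\<mu> \<in> W (k + l)"
    then have "set (take k \<mu>) \<subseteq> {1..n}" "set (drop k \<mu>) \<subseteq> {1..n}"
      using set_take_subset set_drop_subset by (fastforce simp: cuntz_words_def)+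
    then have "take k \<mu> \<in> W k" "drop k \<mu> \<in> W l" using \<mu> by (auto simp: cuntz_words_def)
    then show "\<mu> \<in> (\<lambda>(\<mu>, \<nu>). \<mu> @ \<nu>) ` (W k \<times> W l)"
      by (intro image_eqI[of _ _ "(take k \<mu>, drop k \<mu>)"]) auto
  qed
qed (auto simp: W_iff)

lemma W_appendE:
  assumes "\<mu> \<in> W (k + l)"
  obtains \<mu>1 \<mu>2 where "\<mu> = \<mu>1 @ \<mu>2" "\<mu>1 \<in> W k" "\<mu>2 \<in> W l"
  using assms by (auto simp: W_append)

lemma W_appendI: "\<mu> \<in> W k \<Longrightarrow> \<nu> \<in> W l \<Longrightarrow> \<mu> @ \<nu> \<in> W (k + l)"
  by (auto simp: W_append)

lemma sum_W_append: "(\<Sum>\<mu>\<in>W (k + l). f \<mu>) = (\<Sum>\<mu>\<in>W k. \<Sum>\<nu>\<in>W l. f (\<mu> @ \<nu>))"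
proof -
  have "inj_on (\<lambda>(\<mu>, \<nu>). \<mu> @ \<nu>) (W k \<times> W l)" by (auto simp: inj_on_def W_iff)
  then have "(\<Sum>\<mu>\<in>W (k + l). f \<mu>) = (\<Sum>(\<mu>, \<nu>)\<in>W k \<times> W l. f (\<mu> @ \<nu>))"
    by (simp add: W_append sum.reindex case_prod_beta')
  then show ?thesis by (simp add: sum.cartesian_product)
qed

lemma W_1: "W (Suc 0) = (\<lambda>i. [i]) ` {1..n}"
  by (auto simp: W_iff length_Suc_conv)

lemma sum_W_1: "(\<Sum>\<mu>\<in>W (Suc 0). f \<mu>) = (\<Sum>i=1..n. f [i])"
  by (simp add: W_1 sum.reindex inj_on_def)

lemma W_SucE:
  assumes "\<mu> \<in> W (Suc k)"
  obtains i \<nu> where "\<mu> = i # \<nu>" "i \<in> {1..n}" "\<nu> \<in> W k"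
  using assms by (auto simp: cuntz_words_def length_Suc_conv)

lemma W_nonempty: "W k \<noteq> {}"
  using n2 by (auto simp: cuntz_words_def intro!: exI[of _ "replicate k 1"])

lemma word_orth: "\<mu> \<in> W k \<Longrightarrow> \<nu> \<in> W k \<Longrightarrow> adj (s \<mu>) * s \<nu> = (if \<mu> = \<nu> then 1 else 0)"
proof (induction k arbitrary: \<mu> \<nu>)
  case (Suc k)
  obtain i \<mu>' where \<mu>: "\<mu> = i # \<mu>'" "i \<in> {1..n}" "\<mu>' \<in> W k" using Suc.prems(1) by (rule W_SucE)
  obtain j \<nu>' where \<nu>: "\<nu> = j # \<nu>'" "j \<in> {1..n}" "\<nu>' \<in> W k" using Suc.prems(2) by (rule W_SucE)
  have "adj (s \<mu>) * s \<nu> = adj (s \<mu>') * (adj (S i) * S j) * s \<nu>'"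
    by (simp add: \<mu>(1) \<nu>(1) word_Cons adj_mult mult.assoc)
  moreover have "adj (s \<mu>') * s \<nu>' = (if \<mu>' = \<nu>' then 1 else 0)" by (rule Suc.IH[OF \<mu>(3) \<nu>(3)])
  ultimately show ?case using \<mu> \<nu> by (cases "i = j") (auto simp: S_adj_S)
qed auto

lemma word_isom: "\<mu> \<in> words \<Longrightarrow> adj (s \<mu>) * s \<mu> = 1"
  using word_orth[of \<mu> "length \<mu>" \<mu>] by (simp add: W_iff)

lemma word_isom2: "\<mu> \<in> words \<Longrightarrow> adj (s \<mu>) * (s \<mu> * x) = x"
  using word_isom by (simp flip: mult.assoc)

lemma sum_P: "(\<Sum>\<mu>\<in>W k. s \<mu> * adj (s \<mu>)) = 1"
proof (induction k)
  case (Suc k)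
  have "(\<Sum>\<mu>\<in>W (1 + k). s \<mu> * adj (s \<mu>))
      = (\<Sum>i=1..n. S i * (\<Sum>\<nu>\<in>W k. s \<nu> * adj (s \<nu>)) * adj (S i))"
    unfolding sum_W_append
    by (simp add: sum_W_1 word_Cons adj_mult sum_distrib_left sum_distrib_right mult.assoc)
  then show ?case using Suc sum_S by simp
qed auto

lemma eq_by_words: "(\<And>\<mu>. \<mu> \<in> W k \<Longrightarrow> x * s \<mu> = y * s \<mu>) \<Longrightarrow> x = y"
proof -
  assume *: "\<And>\<mu>. \<mu> \<in> W k \<Longrightarrow> x * s \<mu> = y * s \<mu>"
  have "x * (\<Sum>\<mu>\<in>W k. s \<mu> * adj (s \<mu>)) = y * (\<Sum>\<mu>\<in>W k. s \<mu> * adj (s \<mu>))"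
    using * by (simp add: sum_distrib_left flip: mult.assoc)
  then show ?thesis by (simp add: sum_P)
qed

lemma shift_pow: "(\<phi> ^^ k) x = (\<Sum>\<mu>\<in>W k. s \<mu> * x * adj (s \<mu>))"
proof (induction k)
  case (Suc k)
  have "(\<Sum>\<mu>\<in>W (1 + k). s \<mu> * x * adj (s \<mu>))
      = (\<Sum>i=1..n. S i * (\<Sum>\<nu>\<in>W k. s \<nu> * x * adj (s \<nu>)) * adj (S i))"
    unfolding sum_W_append
    by (simp add: sum_W_1 word_Cons adj_mult sum_distrib_left sum_distrib_right mult.assoc)
  then show ?case using Suc by (simp add: canonical_shift_def)
qed auto

text \<open>Orthogonality of words of equal length collapses the sum in \<open>shift_pow\<close>.
  This relation and its adjoint are what moves words past shifts later.\<close>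

lemma shift_pow_word: "\<mu> \<in> W k \<Longrightarrow> (\<phi> ^^ k) x * s \<mu> = s \<mu> * x"
proof -
  assume \<mu>: "\<mu> \<in> W k"
  have "(\<phi> ^^ k) x * s \<mu> = (\<Sum>\<nu>\<in>W k. s \<nu> * x * (adj (s \<nu>) * s \<mu>))"
    by (simp add: shift_pow sum_distrib_right mult.assoc)
  also have "\<dots> = (\<Sum>\<nu>\<in>W k. if \<nu> = \<mu> then s \<nu> * x else 0)"
    using \<mu> by (intro sum.cong) (auto simp: word_orth)
  finally show ?thesis using \<mu> by simp
qed

lemma shift_pow_adj: "adj ((\<phi> ^^ k) x) = (\<phi> ^^ k) (adj x)"
  by (simp add: shift_pow adj_sum adj_mult adj_adj mult.assoc)

lemma word_adj_shift_pow: "\<mu> \<in> W k \<Longrightarrow> adj (s \<mu>) * (\<phi> ^^ k) x = x * adj (s \<mu>)"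
  using arg_cong[OF shift_pow_word[of \<mu> k "adj x"], of adj]
  by (simp add: adj_mult adj_adj shift_pow_adj)

lemma shift_pow_mult: "(\<phi> ^^ k) (x * y) = (\<phi> ^^ k) x * (\<phi> ^^ k) y"
proof (rule eq_by_words)
  fix \<mu> assume \<mu>: "\<mu> \<in> W k"
  have "(\<phi> ^^ k) x * (\<phi> ^^ k) y * s \<mu> = (\<phi> ^^ k) x * s \<mu> * y"
    using shift_pow_word[OF \<mu>, of y] by (simp add: mult.assoc)
  then show "(\<phi> ^^ k) (x * y) * s \<mu> = (\<phi> ^^ k) x * (\<phi> ^^ k) y * s \<mu>"
    using shift_pow_word[OF \<mu>, of x] shift_pow_word[OF \<mu>, of "x * y"] by (simp add: mult.assoc)
qed

lemma shift_pow_add: "(\<phi> ^^ k) (x + y) = (\<phi> ^^ k) x + (\<phi> ^^ k) y"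
  by (simp add: shift_pow distrib_left distrib_right sum.distrib)

lemma shift_pow_scaleC: "(\<phi> ^^ k) (c *\<^sub>C x) = c *\<^sub>C (\<phi> ^^ k) x"
  by (simp add: shift_pow scaleC_mult_left scaleC_mult_right scaleC_sum_right)

lemma shift_pow_sum: "(\<phi> ^^ k) (sum f A) = (\<Sum>i\<in>A. (\<phi> ^^ k) (f i))"
  by (simp add: shift_pow sum_distrib_left sum_distrib_right sum.swap[of _ A])

lemma shift_pow_1 [simp]: "(\<phi> ^^ k) 1 = 1"
  by (simp add: shift_pow sum_P)

lemma shift_pow_0 [simp]: "(\<phi> ^^ k) 0 = 0"
  by (simp add: shift_pow)

lemmas shift_mult = shift_pow_mult[of 1, simplified]
  and shift_scaleC = shift_pow_scaleC[of 1, simplified]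
  and shift_1 [simp] = shift_pow_1[of 1, simplified]

lemma shift_S: "i \<in> {1..n} \<Longrightarrow> \<phi> x * S i = S i * x"
  using shift_pow_word[of "[i]" 1 x] by (simp add: W_iff word_Cons)

lemma continuous_on_shift_pow [continuous_intros]:
  "continuous_on A f \<Longrightarrow> continuous_on A (\<lambda>x. (\<phi> ^^ k) (f x))"
  unfolding shift_pow by (intro continuous_intros)

lemma word_cancel:
  assumes "\<beta> \<in> words" "\<gamma> \<in> words" "length \<beta> \<le> length \<gamma>"
  shows "adj (s \<beta>) * s \<gamma> = (if take (length \<beta>) \<gamma> = \<beta> then s (drop (length \<beta>) \<gamma>) else 0)"
proof -
  have "\<gamma> \<in> W (length \<beta> + (length \<gamma> - length \<beta>))" using assms by (simp add: W_iff)
  then obtain \<gamma>1 \<gamma>2 where *: "\<gamma> = \<gamma>1 @ \<gamma>2" "\<gamma>1 \<in> W (length \<beta>)" by (rule W_appendE)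
  have "adj (s \<beta>) * s \<gamma> = adj (s \<beta>) * s \<gamma>1 * s \<gamma>2" by (simp add: * word_append mult.assoc)
  moreover have "length \<gamma>1 = length \<beta>" using * by (simp add: W_iff)
  ultimately show ?thesis using word_orth[of \<beta> "length \<beta>" \<gamma>1] * assms(1) by (auto simp: W_iff)
qed

subsection \<open>Norms of block diagonal elements\<close>

lemma block_mult:
  "(\<Sum>\<mu>\<in>W k. s \<mu> * x \<mu> * adj (s \<mu>)) * (\<Sum>\<mu>\<in>W k. s \<mu> * y \<mu> * adj (s \<mu>))
    = (\<Sum>\<mu>\<in>W k. s \<mu> * (x \<mu> * y \<mu>) * adj (s \<mu>))"
proof (rule eq_by_words)
  have *: "(\<Sum>\<mu>\<in>W k. s \<mu> * x \<mu> * adj (s \<mu>)) * s \<nu> = s \<nu> * x \<nu>" if "\<nu> \<in> W k" for x \<nu>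
  proof -
    have "(\<Sum>\<mu>\<in>W k. s \<mu> * x \<mu> * adj (s \<mu>)) * s \<nu> = (\<Sum>\<mu>\<in>W k. s \<mu> * x \<mu> * (adj (s \<mu>) * s \<nu>))"
      by (simp add: sum_distrib_right mult.assoc)
    also have "\<dots> = (\<Sum>\<mu>\<in>W k. if \<mu> = \<nu> then s \<mu> * x \<mu> else 0)"
      using that by (intro sum.cong) (auto simp: word_orth)
    finally show ?thesis using that by simp
  qed
  fix \<mu> assume \<mu>: "\<mu> \<in> W k"
  let ?B = "\<lambda>x. \<Sum>\<mu>\<in>W k. s \<mu> * x \<mu> * adj (s \<mu>)"
  have "?B x * ?B y * s \<mu> = ?B x * (?B y * s \<mu>)" by (rule mult.assoc)
  also have "\<dots> = ?B x * (s \<mu> * y \<mu>)" by (simp only: *[OF \<mu>])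
  also have "\<dots> = ?B x * s \<mu> * y \<mu>" by (rule mult.assoc[symmetric])
  also have "\<dots> = s \<mu> * x \<mu> * y \<mu>" by (simp only: *[OF \<mu>])
  also have "\<dots> = s \<mu> * (x \<mu> * y \<mu>)" by (rule mult.assoc)
  also have "\<dots> = (\<Sum>\<mu>\<in>W k. s \<mu> * (x \<mu> * y \<mu>) * adj (s \<mu>)) * s \<mu>"
    by (rule *[OF \<mu>, symmetric])
  finally show "?B x * ?B y * s \<mu> = (\<Sum>\<mu>\<in>W k. s \<mu> * (x \<mu> * y \<mu>) * adj (s \<mu>)) * s \<mu>" .
qed

text \<open>Block sums of this shape multiply blockwise, so the complements \<open>d \<mu>\<close>
  of self-adjoint contractive blocks assemble to a complement of the whole sum. Scaling and the
  C*-identity do the rest, as for \<open>f_norm_le\<close>.\<close>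

lemma block_norm_le:
  assumes y: "\<And>\<mu>. \<mu> \<in> W k \<Longrightarrow> norm (y \<mu>) \<le> C"
  shows "norm (\<Sum>\<mu>\<in>W k. s \<mu> * y \<mu> * adj (s \<mu>)) \<le> C"
proof -
  define B where "B x = (\<Sum>\<mu>\<in>W k. s \<mu> * x \<mu> * adj (s \<mu>))" for x
  have C: "C \<ge> 0" using W_nonempty[of k] y norm_ge_zero order_trans by blast
  have Badj: "adj (B x) = B (\<lambda>\<mu>. adj (x \<mu>))" for x
    by (simp add: B_def adj_sum adj_mult adj_adj mult.assoc)
  have Bmult: "B x * B z = B (\<lambda>\<mu>. x \<mu> * z \<mu>)" for x z unfolding B_def by (rule block_mult)
  have B1: "B (\<lambda>_. 1) = 1" by (simp add: B_def sum_P)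
  have sa1: "norm (B x) \<le> 1" if x: "\<And>\<mu>. \<mu> \<in> W k \<Longrightarrow> adj (x \<mu>) = x \<mu> \<and> norm (x \<mu>) < 1" for x
  proof -
    have "\<exists>d. adj d = d \<and> x \<mu> * x \<mu> + d * d = 1 \<and> x \<mu> * d = d * x \<mu>" if \<mu>: "\<mu> \<in> W k" for \<mu>
      using square_complement[OF cstar_subalgebra_UNIV UNIV_I UNIV_I, of "x \<mu>"] x[OF \<mu>] by metis
    then obtain d where d: "\<And>\<mu>. \<mu> \<in> W k \<Longrightarrow>
        adj (d \<mu>) = d \<mu> \<and> x \<mu> * x \<mu> + d \<mu> * d \<mu> = 1 \<and> x \<mu> * d \<mu> = d \<mu> * x \<mu>"
      by metis
    have "(norm (B x))\<^sup>2 \<le> 1"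
    proof (rule norm_le_of_sum_squares)
      show "adj (B x) = B x" "adj (B d) = B d" using x d by (auto simp: Badj) (auto simp: B_def)
      show "B x * B d = B d * B x" unfolding Bmult using d by (auto simp: B_def)
      have "B x * B x + B d * B d = B (\<lambda>\<mu>. x \<mu> * x \<mu> + d \<mu> * d \<mu>)"
        unfolding Bmult by (simp add: B_def distrib_left distrib_right sum.distrib)
      also have "\<dots> = B (\<lambda>_. 1)" unfolding B_def using d by (intro sum.cong) auto
      finally show "B x * B x + B d * B d = 1 *\<^sub>R 1" by (simp add: B1)
    qed auto
    then show ?thesis by (simp add: power_le_one_iff)
  qed
  have sa: "norm (B x) \<le> c" if x: "\<And>\<mu>. \<mu> \<in> W k \<Longrightarrow> adj (x \<mu>) = x \<mu> \<and> norm (x \<mu>) \<le> c" "c \<ge> 0" for x c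
  proof (rule field_le_epsilon)
    fix e :: real assume e: "e > 0"
    define r where "r = c + e"
    have r: "r > 0" using e x(2) by (simp add: r_def)
    have "norm (B (\<lambda>\<mu>. (1 / r) *\<^sub>R x \<mu>)) \<le> 1"
    proof (rule sa1)
      fix \<mu> assume "\<mu> \<in> W k"
      then have "norm (x \<mu>) < r" using x(1)[of \<mu>] e by (simp add: r_def)
      then show "adj ((1 / r) *\<^sub>R x \<mu>) = (1 / r) *\<^sub>R x \<mu> \<and> norm ((1 / r) *\<^sub>R x \<mu>) < 1"
        using x(1)[OF \<open>\<mu> \<in> W k\<close>] r by (simp add: adj_scaleR divide_less_eq)
    qed
    moreover have "B (\<lambda>\<mu>. (1 / r) *\<^sub>R x \<mu>) = (1 / r) *\<^sub>R B x"
      by (simp add: B_def scaleR_sum_right)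
    ultimately show "norm (B x) \<le> c + e" using r by (simp add: divide_le_eq) (simp add: r_def)
  qed
  have "(norm (B y))\<^sup>2 = norm (B (\<lambda>\<mu>. adj (y \<mu>) * y \<mu>))"
    by (simp add: Badj Bmult flip: cstar_identity)
  also have "\<dots> \<le> C\<^sup>2"
  proof (rule sa)
    fix \<mu> assume "\<mu> \<in> W k"
    then show "adj (adj (y \<mu>) * y \<mu>) = adj (y \<mu>) * y \<mu> \<and> norm (adj (y \<mu>) * y \<mu>) \<le> C\<^sup>2"
      using y[of \<mu>] by (simp add: adj_mult adj_adj cstar_identity power_mono)
  qed simp
  finally show ?thesis using C unfolding B_def by (rule power2_le_imp_le)
qed

end

text \<open>Compression by contractions does not increase norms, uniformly in \<open>N\<close>, so
  convergence passes from a dense span to its closure by an \<open>e / 3\<close> argument;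
  completeness turns the Cauchy property into a limit, which need not be known in advance.\<close>

lemma convergent_compressions:
  fixes X :: "nat \<Rightarrow> 'a::cstar_algebra"
  assumes X: "\<And>N. norm (X N) \<le> 1" and M: "\<And>x. x \<in> M \<Longrightarrow> convergent (\<lambda>N. adj (X N) * x * X N)"
    and x: "x \<in> closure (cspan M)"
  shows "convergent (\<lambda>N. adj (X N) * x * X N)"
proof -
  define V where "V = {x. convergent (\<lambda>N. adj (X N) * x * X N)}"
  have "x + y \<in> V" if "x \<in> V" "y \<in> V" for x y
    using that convergent_add[of "\<lambda>N. adj (X N) * x * X N" "\<lambda>N. adj (X N) * y * X N"]
    by (simp add: V_def distrib_left distrib_right)
  moreover have "c *\<^sub>C x \<in> V" if "x \<in> V" for c x
    using that tendsto_scaleC unfolding convergent_def V_def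
    by (simp add: scaleC_mult_left scaleC_mult_right) blast
  moreover have "0 \<in> V" by (simp add: V_def convergent_const)
  ultimately have "csubspace V" by (auto simp: csubspace_def)
  moreover have "closed V"
    unfolding closed_sequential_limits
  proof (intro allI impI)
    fix y x assume *: "(\<forall>k. y k \<in> V) \<and> y \<longlonglongrightarrow> x"
    have "Cauchy (\<lambda>N. adj (X N) * x * X N)"
    proof (rule metric_CauchyI)
      fix e :: real assume e: "e > 0"
      obtain k where k: "norm (y k - x) < e / 3"
        using * e by (metis LIMSEQ_D divide_pos_pos order_refl zero_less_numeral)
      have "Cauchy (\<lambda>N. adj (X N) * y k * X N)"
        using * by (simp add: V_def convergent_Cauchy)
      then obtain M where M: "\<And>m p. m \<ge> M \<Longrightarrow> p \<ge> M \<Longrightarrow>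
          dist (adj (X m) * y k * X m) (adj (X p) * y k * X p) < e / 3"
        using metric_CauchyD[of "\<lambda>N. adj (X N) * y k * X N" "e / 3"] e by auto
      have near: "dist (adj (X N) * x * X N) (adj (X N) * y k * X N) < e / 3" for N
        using norm_compress_le[OF X, of N "y k - x"] k
        by (simp add: dist_norm norm_minus_commute right_diff_distrib left_diff_distrib)
      show "\<exists>M. \<forall>m\<ge>M. \<forall>p\<ge>M. dist (adj (X m) * x * X m) (adj (X p) * x * X p) < e"
      proof (intro exI allI impI)
        fix m p assume "m \<ge> M" "p \<ge> M"
        then show "dist (adj (X m) * x * X m) (adj (X p) * x * X p) < e"
          using M[of m p] near[of m] near[of p]
            dist_triangle[of "adj (X m) * x * X m" "adj (X p) * x * X p" "adj (X m) * y k * X m"]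
            dist_triangle2[of "adj (X m) * y k * X m" "adj (X p) * x * X p" "adj (X p) * y k * X p"]
          by linarith
      qed
    qed
    then show "x \<in> V" by (simp add: V_def Cauchy_convergent_iff)
  qed
  moreover have "M \<subseteq> V" using M by (auto simp: V_def)
  ultimately have "closure (cspan M) \<subseteq> V" by (intro closure_cspan_subset)
  then show ?thesis using x by (auto simp: V_def)
qed

context cuntz
begin

subsection \<open>Dense spans of words\<close>

definition Mon :: "'a set" where
  "Mon = {s \<alpha> * adj (s \<beta>) | \<alpha> \<beta>. \<alpha> \<in> words \<and> \<beta> \<in> words}"

lemma MonI: "\<alpha> \<in> words \<Longrightarrow> \<beta> \<in> words \<Longrightarrow> s \<alpha> * adj (s \<beta>) \<in> Mon"
  by (auto simp: Mon_def)

lemma Mon_mult_le: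
  assumes "\<beta> \<in> words" "\<gamma> \<in> words" "length \<beta> \<le> length \<gamma>"
  shows "s \<alpha> * adj (s \<beta>) * (s \<gamma> * adj (s \<delta>)) =
    (if take (length \<beta>) \<gamma> = \<beta> then s (\<alpha> @ drop (length \<beta>) \<gamma>) * adj (s \<delta>) else 0)"
proof -
  have "s \<alpha> * adj (s \<beta>) * (s \<gamma> * adj (s \<delta>)) = s \<alpha> * (adj (s \<beta>) * s \<gamma>) * adj (s \<delta>)"
    by (simp add: mult.assoc)
  then show ?thesis using word_cancel[OF assms] by (simp add: word_append)
qed

lemma Mon_mult_ge:
  assumes "\<beta> \<in> words" "\<gamma> \<in> words" "length \<gamma> \<le> length \<beta>"
  shows "s \<alpha> * adj (s \<beta>) * (s \<gamma> * adj (s \<delta>)) =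
    (if take (length \<gamma>) \<beta> = \<gamma> then s \<alpha> * adj (s (\<delta> @ drop (length \<gamma>) \<beta>)) else 0)"
proof -
  have "s \<alpha> * adj (s \<beta>) * (s \<gamma> * adj (s \<delta>)) = adj (s \<delta> * adj (s \<gamma>) * (s \<beta> * adj (s \<alpha>)))"
    by (simp add: adj_mult adj_adj mult.assoc)
  then show ?thesis by (simp only: Mon_mult_le[OF assms(2,1,3)]) (simp add: adj_mult adj_adj)
qed

lemma \<O>_subalgebra: "cstar_subalgebra \<O>"
  by (simp add: cuntz_algebra_def cstar_generated_subalgebra)

lemmas \<O>D = cstar_subalgebraD[OF \<O>_subalgebra]

lemma S_in_\<O>: "i \<in> {1..n} \<Longrightarrow> S i \<in> \<O>"
  by (simp add: cuntz_algebra_def cstar_generated_base)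

lemma one_in_\<O>: "1 \<in> \<O>"
proof -
  have "(\<Sum>i=1..n. S i * adj (S i)) \<in> \<O>"
    by (intro csubspace_sum \<O>D S_in_\<O>)
  then show ?thesis by (simp only: sum_S)
qed

lemma word_in_\<O>: "\<mu> \<in> words \<Longrightarrow> s \<mu> \<in> \<O>"
  by (induction \<mu>) (auto simp: word_Cons one_in_\<O> intro!: \<O>D S_in_\<O>)

lemma \<O>_eq: "\<O> = closure (cspan Mon)"
  unfolding cuntz_algebra_def
proof (rule cstar_generated_eq_closure)
  show "S ` {1..n} \<subseteq> Mon"
  proof
    fix x assume "x \<in> S ` {1..n}"
    then obtain i where "i \<in> {1..n}" "x = s [i] * adj (s [])" by (auto simp: word_Cons)
    then show "x \<in> Mon" using MonI[of "[i]" "[]"] by simp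
  qed
  show "Mon \<subseteq> cstar_generated (S ` {1..n})"
  proof
    fix x assume "x \<in> Mon"
    then obtain \<alpha> \<beta> where "x = s \<alpha> * adj (s \<beta>)" "\<alpha> \<in> words" "\<beta> \<in> words"
      unfolding Mon_def by blast
    then have "x \<in> \<O>" by (simp only: word_in_\<O> \<O>D(4,6))
    then show "x \<in> cstar_generated (S ` {1..n})" by (simp only: cuntz_algebra_def)
  qed
  fix x y assume x: "x \<in> Mon"
  then obtain \<alpha> \<beta> where x: "x = s \<alpha> * adj (s \<beta>)" "\<alpha> \<in> words" "\<beta> \<in> words"
    unfolding Mon_def by blast
  then show "adj x \<in> Mon" using MonI[of \<beta> \<alpha>] by (simp only: adj_mult adj_adj)
  assume "y \<in> Mon"
  then obtain \<gamma> \<delta> where y: "y = s \<gamma> * adj (s \<delta>)" "\<gamma> \<in> words" "\<delta> \<in> words"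
    unfolding Mon_def by blast
  show "x * y \<in> cspan Mon"
  proof (cases "length \<beta> \<le> length \<gamma>")
    case True
    have "\<alpha> @ drop (length \<beta>) \<gamma> \<in> words" using x y by (auto dest: in_set_dropD)
    then show ?thesis unfolding x(1) y(1) Mon_mult_le[OF x(3) y(2) True]
      using y(3) by (simp add: MonI cspan_base cspan_0 del: append_in_lists_conv)
  next
    case False
    then have ge: "length \<gamma> \<le> length \<beta>" by simp
    have "\<delta> @ drop (length \<gamma>) \<beta> \<in> words" using x y by (auto dest: in_set_dropD)
    then show ?thesis unfolding x(1) y(1) Mon_mult_ge[OF x(3) y(2) ge]
      using x(2) by (simp add: MonI cspan_base cspan_0 del: append_in_lists_conv)
  qed
qed

lemma \<O>_induct:
  assumes "x \<in> \<O>" "csubspace V" "closed V"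
    and "\<And>\<alpha> \<beta>. \<alpha> \<in> words \<Longrightarrow> \<beta> \<in> words \<Longrightarrow> s \<alpha> * adj (s \<beta>) \<in> V"
  shows "x \<in> V"
  using closure_cspan_subset[of Mon V] assms by (auto simp: \<O>_eq Mon_def)

lemma shift_pow_\<O>: "x \<in> \<O> \<Longrightarrow> (\<phi> ^^ k) x \<in> \<O>"
  unfolding shift_pow by (intro csubspace_sum \<O>D word_in_\<O>) (auto simp: W_iff)

lemma shift_\<O>: "x \<in> \<O> \<Longrightarrow> \<phi> x \<in> \<O>"
  using shift_pow_\<O>[of x 1] by simp

subsection \<open>Existence of the endomorphisms\<close>

text \<open>The \<open>u_k\<close> of the overview. Applying \<open>\<phi>\<close> to the whole
  previous product fits inductions that strip the first letter of a word.\<close>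

primrec cocycle :: "'a \<Rightarrow> nat \<Rightarrow> 'a" where
  "cocycle u 0 = 1"
| "cocycle u (Suc k) = u * \<phi> (cocycle u k)"

lemma cocycle_add: "cocycle u (k + l) = cocycle u k * (\<phi> ^^ k) (cocycle u l)"
  by (induction k) (auto simp: shift_mult mult.assoc)

lemma unitary_shift_pow: "unitary u \<Longrightarrow> unitary ((\<phi> ^^ k) u)"
  unfolding unitary_def shift_pow_adj by (simp flip: shift_pow_mult)

lemma unitary_shift: "unitary u \<Longrightarrow> unitary (\<phi> u)"
  using unitary_shift_pow[of u 1] by simp

lemma unitary_cocycle: "unitary u \<Longrightarrow> unitary (cocycle u k)"
  by (induction k) (auto intro: unitary_1 unitary_mult unitary_shift)

lemma cocycle_in_\<O>: "u \<in> \<O> \<Longrightarrow> cocycle u k \<in> \<O>"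
  by (induction k) (auto intro: one_in_\<O> \<O>D shift_\<O>)

text \<open>Each \<open>u\<close> is moved to the left by \<open>\<phi> x * S i = S i * x\<close>,
  collecting one shift per letter passed.\<close>

lemma cocycle_word:
  assumes "\<mu> \<in> words"
  shows "word_isometry (\<lambda>i. u * S i) \<mu> = cocycle u (length \<mu>) * s \<mu>"
  using assms
proof (induction \<mu>)
  case (Cons i \<mu>)
  have "\<phi> (cocycle u (length \<mu>)) * S i = S i * cocycle u (length \<mu>)" using Cons by (intro shift_S)
  then have "u * S i * (cocycle u (length \<mu>) * s \<mu>) = u * \<phi> (cocycle u (length \<mu>)) * S i * s \<mu>"
    by (simp add: mult.assoc)
  then show ?case using Cons.IH by (simp add: word_isometry_def mult.assoc)
qed (simp add: word_isometry_def)

lemma cuntz_unitary_mult: "unitary u \<Longrightarrow> cuntz n (\<lambda>i. u * S i)"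
proof
  assume u: "unitary u"
  have "(\<Sum>i=1..n. u * S i * adj (u * S i)) = u * (\<Sum>i=1..n. S i * adj (S i)) * adj u"
    by (simp add: adj_mult sum_distrib_left sum_distrib_right mult.assoc)
  then have "(\<Sum>i=1..n. u * S i * adj (u * S i)) = 1" unfolding sum_S by (simp add: unitary_simps[OF u])
  then show "cuntz_family n (\<lambda>i. u * S i)"
    using S_isometry by (simp add: cuntz_family_def adj_mult mult.assoc unitary_simps[OF u])
qed (rule n2)

text \<open>
  The word \<open>1\<^sup>m 2\<close> does not overlap itself, so the isometries \<open>(\<phi> ^^ a) (s (probe m))\<close> with
  \<open>a\<close> in an interval of length \<open>m\<close> have orthogonal ranges.
\<close>

definition probe :: "nat \<Rightarrow> nat list" where
  "probe m = replicate m 1 @ [2]"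

lemma probe_words: "probe m \<in> words"
  using n2 by (auto simp: probe_def)

text \<open>Split \<open>probe m\<close> as \<open>c\<close> ones followed by \<open>v\<close>. The
  shift moves past the ones, leaving \<open>adj (s v) * s (probe m)\<close>. Since
  \<open>c \<ge> 1\<close>, the prefix of \<open>probe m\<close> of the length of \<open>v\<close>
  consists of ones only, whereas \<open>v\<close> ends in 2.\<close>

lemma probe_shift_0:
  assumes "0 < c" "c \<le> m"
  shows "adj (s (probe m)) * (\<phi> ^^ c) (s (probe m)) = 0"
proof -
  define v where "v = replicate (m - c) 1 @ [2::nat]"
  have w: "probe m = replicate c 1 @ v"
    using assms by (simp add: probe_def v_def replicate_add[symmetric] flip: append_assoc)
  have v: "v \<in> words" using n2 by (auto simp: v_def)
  have c: "replicate c 1 \<in> W c" using n2 by (auto simp: W_iff)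
  have "take (length v) (probe m) = replicate (Suc (m - c)) 1"
    using assms by (simp add: probe_def v_def take_replicate)
  moreover have "v \<noteq> replicate (Suc (m - c)) 1"
  proof
    assume "v = replicate (Suc (m - c)) 1"
    then have "2 \<in> set (replicate (Suc (m - c)) (1::nat))" by (metis in_set_conv_decomp v_def)
    then show False by auto
  qed
  ultimately have "adj (s v) * s (probe m) = 0"
    using word_cancel[OF v probe_words, of m] assms by (simp add: v_def probe_def)
  moreover have "adj (s (probe m)) * (\<phi> ^^ c) (s (probe m))
      = adj (s v) * (adj (s (replicate c 1)) * (\<phi> ^^ c) (s (probe m)))"
    by (subst (1) w) (simp add: word_append adj_mult mult.assoc)
  moreover have "\<dots> = adj (s v) * s (probe m) * adj (s (replicate c 1))"
    by (simp only: word_adj_shift_pow[OF c] mult.assoc)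
  ultimately show ?thesis by simp
qed

lemma probe_orth:
  assumes "a \<le> b + m" "b \<le> a + m"
  shows "adj ((\<phi> ^^ a) (s (probe m))) * (\<phi> ^^ b) (s (probe m)) = (if a = b then 1 else 0)"
proof -
  have lt: "adj ((\<phi> ^^ a) (s (probe m))) * (\<phi> ^^ b) (s (probe m)) = 0" if "a < b" "b \<le> a + m" for a b
  proof -
    have "(\<phi> ^^ b) (s (probe m)) = (\<phi> ^^ a) ((\<phi> ^^ (b - a)) (s (probe m)))"
      using that by (metis comp_apply funpow_add le_add_diff_inverse less_imp_le)
    then have "adj ((\<phi> ^^ a) (s (probe m))) * (\<phi> ^^ b) (s (probe m))
        = (\<phi> ^^ a) (adj (s (probe m)) * (\<phi> ^^ (b - a)) (s (probe m)))"
      by (simp add: shift_pow_adj shift_pow_mult)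
    then show ?thesis using probe_shift_0[of "b - a" m] that by simp
  qed
  show ?thesis
  proof (cases a b rule: linorder_cases)
    case less
    then show ?thesis using lt assms by simp
  next
    case equal
    then show ?thesis
      using word_isom[OF probe_words, of m] by (simp add: shift_pow_adj flip: shift_pow_mult)
  next
    case greater
    then have "adj (adj ((\<phi> ^^ b) (s (probe m))) * (\<phi> ^^ a) (s (probe m))) = 0" using lt assms by simp
    then show ?thesis using greater by (simp add: adj_mult adj_adj)
  qed
qed

text \<open>Shifts start at \<open>N\<close> so that words of length at most \<open>N\<close> can be
  pulled through every summand. After that the exponents lie in \<open>{0..<2 * N}\<close>, which is
  why the probe has parameter \<open>2 * N\<close>. The factor \<open>1 / sqrt N\<close> normalises
  a sum of \<open>N\<close> isometries with orthogonal ranges.\<close>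

definition averager :: "'a \<Rightarrow> nat \<Rightarrow> 'a" where
  "averager u N = complex_of_real (1 / sqrt N) *\<^sub>C
     (\<Sum>i<N. (\<phi> ^^ (N + i)) (s (probe (2 * N))) * adj (cocycle u (N + i)))"

text \<open>Pulling \<open>s \<alpha>\<close> and \<open>s \<beta>\<close> through lowers the two
  exponents by their lengths, so by \<open>probe_orth\<close> only pairs with equal remaining
  exponent \<open>k\<close> survive. For these, \<open>cocycle u (length \<alpha> + k) * s \<alpha>
  = t \<alpha> * cocycle u k\<close>, and the common unitary \<open>cocycle u k\<close> cancels:
  every surviving pair contributes the same element.\<close>

lemma averager_compress:
  assumes u: "unitary u" and ab: "\<alpha> \<in> words" "\<beta> \<in> words" "length \<alpha> \<le> N" "length \<beta> \<le> N"
  shows "adj (averager u N) * (s \<alpha> * adj (s \<beta>)) * averager u N =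
    complex_of_real (card {(i, j). i < N \<and> j < N \<and> i + length \<beta> = j + length \<alpha>} / N) *\<^sub>C
      (cocycle u (length \<alpha>) * s \<alpha> * adj (cocycle u (length \<beta>) * s \<beta>))"
proof -
  define Z where "Z a = (\<phi> ^^ a) (s (probe (2 * N)))" for a
  define t where "t \<mu> = cocycle u (length \<mu>) * s \<mu>" for \<mu>
  have Zs: "adj (Z (N + i)) * s \<gamma> = s \<gamma> * adj (Z (N + i - length \<gamma>))"
    if "\<gamma> \<in> words" "length \<gamma> \<le> N" for i \<gamma>
  proof -
    have "Z (N + i) = (\<phi> ^^ length \<gamma>) (Z (N + i - length \<gamma>))"
      unfolding Z_def using that
      by (metis comp_apply funpow_add le_add_diff_inverse trans_le_add1)
    moreover have "\<gamma> \<in> W (length \<gamma>)" using that by (simp add: W_iff)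
    ultimately show ?thesis using shift_pow_word by (simp add: shift_pow_adj)
  qed
  have cs: "cocycle u (length \<gamma> + k) * s \<gamma> = t \<gamma> * cocycle u k" if "\<gamma> \<in> words" for k \<gamma>
    using that shift_pow_word[of \<gamma> "length \<gamma>"] by (simp add: t_def cocycle_add mult.assoc W_iff)
  have summand: "cocycle u (N + i) * adj (Z (N + i)) * (s \<alpha> * adj (s \<beta>)) * (Z (N + j) * adj (cocycle u (N + j)))
      = (if i + length \<beta> = j + length \<alpha> then t \<alpha> * adj (t \<beta>) else 0)" if "i < N" "j < N" for i j
  proof -
    have "cocycle u (N + i) * adj (Z (N + i)) * (s \<alpha> * adj (s \<beta>)) * (Z (N + j) * adj (cocycle u (N + j)))
        = cocycle u (N + i) * (adj (Z (N + i)) * s \<alpha>) * adj (adj (Z (N + j)) * s \<beta>) * adj (cocycle u (N + j))"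
      by (simp add: adj_mult adj_adj mult.assoc)
    also have "\<dots> = cocycle u (N + i) * s \<alpha> *
        (adj (Z (N + i - length \<alpha>)) * Z (N + j - length \<beta>)) * (adj (s \<beta>) * adj (cocycle u (N + j)))"
      using ab by (simp add: Zs adj_mult adj_adj mult.assoc)
    also have "adj (Z (N + i - length \<alpha>)) * Z (N + j - length \<beta>)
        = (if N + i - length \<alpha> = N + j - length \<beta> then 1 else 0)"
      unfolding Z_def using ab that by (intro probe_orth) auto
    also have "(N + i - length \<alpha> = N + j - length \<beta>) \<longleftrightarrow> i + length \<beta> = j + length \<alpha>"
      using ab by auto
    finally have eq: "cocycle u (N + i) * adj (Z (N + i)) * (s \<alpha> * adj (s \<beta>)) * (Z (N + j) * adj (cocycle u (N + j)))
      = (if i + length \<beta> = j + length \<alpha> then cocycle u (N + i) * s \<alpha> * (adj (s \<beta>) * adj (cocycle u (N + j))) else 0)"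
      by simp
    show ?thesis
    proof (cases "i + length \<beta> = j + length \<alpha>")
      case True
      define k where "k = N + i - length \<alpha>"
      have k: "N + i = length \<alpha> + k" "N + j = length \<beta> + k" using ab True by (auto simp: k_def)
      have "cocycle u (N + i) * s \<alpha> * (adj (s \<beta>) * adj (cocycle u (N + j)))
          = (t \<alpha> * cocycle u k) * adj (t \<beta> * cocycle u k)"
        unfolding k cs[OF ab(1)] cs[OF ab(2), symmetric] by (simp add: adj_mult)
      also have "\<dots> = t \<alpha> * adj (t \<beta>)"
        by (simp add: adj_mult mult.assoc unitary_simps[OF unitary_cocycle[OF u]])
      finally show ?thesis using True eq by simp
    qed (use eq in simp)
  qed
  have "(\<Sum>i<N. \<Sum>j<N. if i + length \<beta> = j + length \<alpha> then t \<alpha> * adj (t \<beta>) else 0)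
      = (\<Sum>(i, j)\<in>{..<N} \<times> {..<N}. if i + length \<beta> = j + length \<alpha> then t \<alpha> * adj (t \<beta>) else 0)"
    by (simp add: sum.cartesian_product)
  also have "\<dots> = (\<Sum>(i, j)\<in>{(i, j). i < N \<and> j < N \<and> i + length \<beta> = j + length \<alpha>}. t \<alpha> * adj (t \<beta>))"
    by (rule sum.mono_neutral_cong_right) (auto split: if_splits)
  also have "\<dots> = complex_of_real (card {(i, j). i < N \<and> j < N \<and> i + length \<beta> = j + length \<alpha>}) *\<^sub>C (t \<alpha> * adj (t \<beta>))"
    unfolding scaleC_of_real by (simp add: case_prod_unfold scaleR_conv_of_real)
  finally have sums: "(\<Sum>i<N. \<Sum>j<N. cocycle u (N + i) * adj (Z (N + i)) * (s \<alpha> * adj (s \<beta>)) *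
        (Z (N + j) * adj (cocycle u (N + j))))
      = complex_of_real (card {(i, j). i < N \<and> j < N \<and> i + length \<beta> = j + length \<alpha>}) *\<^sub>C (t \<alpha> * adj (t \<beta>))"
    using summand by simp
  have "adj (averager u N) * (s \<alpha> * adj (s \<beta>)) * averager u N =
     complex_of_real (1 / N) *\<^sub>C (\<Sum>i<N. \<Sum>j<N. cocycle u (N + i) * adj (Z (N + i)) * (s \<alpha> * adj (s \<beta>)) *
        (Z (N + j) * adj (cocycle u (N + j))))"
  proof -
    define A where "A = (\<Sum>i<N. Z (N + i) * adj (cocycle u (N + i)))"
    have "adj A * (s \<alpha> * adj (s \<beta>)) = (\<Sum>i<N. cocycle u (N + i) * adj (Z (N + i)) * (s \<alpha> * adj (s \<beta>)))"
      by (simp add: A_def adj_sum adj_mult adj_adj sum_distrib_right)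
    then have "adj A * (s \<alpha> * adj (s \<beta>)) * A = (\<Sum>i<N. \<Sum>j<N. cocycle u (N + i) * adj (Z (N + i)) *
        (s \<alpha> * adj (s \<beta>)) * (Z (N + j) * adj (cocycle u (N + j))))"
      by (simp only: A_def sum_product)
    moreover have "complex_of_real (1 / sqrt N) * complex_of_real (1 / sqrt N) = complex_of_real (1 / N)"
      by (simp flip: of_real_mult)
    ultimately show ?thesis unfolding averager_def Z_def[symmetric] A_def[symmetric]
      by (simp add: adj_scaleC scaleC_mult_left scaleC_mult_right scaleC_scaleC del: of_real_divide)
  qed
  also have "\<dots> = complex_of_real (card {(i, j). i < N \<and> j < N \<and> i + length \<beta> = j + length \<alpha>} / N) *\<^sub>C (t \<alpha> * adj (t \<beta>))"
    unfolding sums by (simp add: scaleC_scaleC)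
  finally show ?thesis by (simp add: t_def)
qed

lemma averager_norm_le: "unitary u \<Longrightarrow> norm (averager u N) \<le> 1"
proof (cases "N = 0")
  case False
  assume u: "unitary u"
  \<comment> \<open>Empty words: compressing \<open>1\<close> counts exactly the \<open>N\<close>
    diagonal pairs, so \<open>averager u N\<close> is an isometry.\<close>
  have "{(i, j). i < N \<and> j < N \<and> i + length ([]::nat list) = j + length ([]::nat list)} = (\<lambda>i. (i, i)) ` {..<N}"
    by auto
  then have "card {(i, j). i < N \<and> j < N \<and> i + length ([]::nat list) = j + length ([]::nat list)} = N"
    by (simp add: card_image inj_on_def)
  then have "adj (averager u N) * averager u N = 1"
    using averager_compress[OF u, of "[]" "[]" N] False by (simp del: list.size(3)) simp
  then show ?thesis using norm_isometry by fastforce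
qed (simp add: averager_def)

lemma averager_tendsto:
  assumes u: "unitary u" and ab: "\<alpha> \<in> words" "\<beta> \<in> words"
  shows "(\<lambda>N. adj (averager u N) * (s \<alpha> * adj (s \<beta>)) * averager u N) \<longlonglongrightarrow>
    cocycle u (length \<alpha>) * s \<alpha> * adj (cocycle u (length \<beta>) * s \<beta>)"
proof -
  define c where "c N = card {(i, j). i < N \<and> j < N \<and> i + length \<beta> = j + length \<alpha>}" for N
  \<comment> \<open>The distance of the two lengths: with truncated subtraction one of the summands
    is 0. At most \<open>d\<close> pairs are lost at the boundary.\<close>
  define d where "d = (length \<alpha> - length \<beta>) + (length \<beta> - length \<alpha>)"
  have "c N = N - d" for N
  proof (cases "length \<alpha> \<le> length \<beta>")
    case True
    then have "{(i, j). i < N \<and> j < N \<and> i + length \<beta> = j + length \<alpha>} = (\<lambda>i. (i, i + d)) ` {..<N - d}"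
      by (auto simp: d_def image_iff)
    then show ?thesis by (simp add: c_def card_image inj_on_def)
  next
    case False
    then have "{(i, j). i < N \<and> j < N \<and> i + length \<beta> = j + length \<alpha>} = (\<lambda>j. (j + d, j)) ` {..<N - d}"
      by (auto simp: d_def image_iff)
    then show ?thesis by (simp add: c_def card_image inj_on_def)
  qed
  then have "eventually (\<lambda>N. 1 - real d * inverse (real N) = c N / N) sequentially"
    by (intro eventually_sequentiallyI[of "Suc d"]) (auto simp: field_simps of_nat_diff)
  moreover have "(\<lambda>N. 1 - real d * inverse (real N)) \<longlonglongrightarrow> 1 - real d * 0"
    by (intro tendsto_intros LIMSEQ_inverse_real_of_nat lim_inverse_n)
  ultimately have "(\<lambda>N. c N / N) \<longlonglongrightarrow> 1" by (simp add: tendsto_cong)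
  then have "(\<lambda>N. (c N / N) *\<^sub>R (cocycle u (length \<alpha>) * s \<alpha> * adj (cocycle u (length \<beta>) * s \<beta>)))
      \<longlonglongrightarrow> 1 *\<^sub>R (cocycle u (length \<alpha>) * s \<alpha> * adj (cocycle u (length \<beta>) * s \<beta>))"
    by (intro tendsto_intros)
  moreover have "eventually (\<lambda>N. (c N / N) *\<^sub>R (cocycle u (length \<alpha>) * s \<alpha> * adj (cocycle u (length \<beta>) * s \<beta>))
      = adj (averager u N) * (s \<alpha> * adj (s \<beta>)) * averager u N) sequentially"
  proof (rule eventually_sequentiallyI)
    fix N assume "max (length \<alpha>) (length \<beta>) \<le> N"
    then show "(c N / N) *\<^sub>R (cocycle u (length \<alpha>) * s \<alpha> * adj (cocycle u (length \<beta>) * s \<beta>))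
      = adj (averager u N) * (s \<alpha> * adj (s \<beta>)) * averager u N"
      unfolding c_def using averager_compress[OF u ab, of N] by (simp only: scaleC_of_real max.bounded_iff)
  qed
  ultimately show ?thesis by (simp add: tendsto_cong)
qed

text \<open>Linearity, \<open>adj\<close> and contractivity pass to the limit of compressions;
  multiplicativity does not, since a compression need not be multiplicative. It is checked on the
  spanning elements, where products follow word combinatorics that is the same for
  \<open>S i\<close> and \<open>u * S i\<close>, and then extended in each factor by
  continuity.\<close>

lemma exists_endo:
  assumes u: "unitary u" "u \<in> \<O>"
  shows "\<exists>f\<in>unital_star_endos \<O>. \<forall>i\<in>{1..n}. f (S i) = u * S i"
proof -
  define C where "C x N = adj (averager u N) * x * averager u N" for x N
  define f where "f = (\<lambda>x\<in>\<O>. lim (C x))"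
  \<comment> \<open>The images \<open>u * S i\<close> form a Cuntz family again, which supplies the
    product rules on the target side.\<close>
  interpret T: cuntz n "\<lambda>i. u * S i" by (rule cuntz_unitary_mult[OF u(1)])
  define t where "t = word_isometry (\<lambda>i. u * S i)"
  have t: "t \<mu> = cocycle u (length \<mu>) * s \<mu>" if "\<mu> \<in> words" for \<mu>
    unfolding t_def by (rule cocycle_word[OF that])
  have conv: "C x \<longlonglongrightarrow> f x" if "x \<in> \<O>" for x
  proof -
    have "convergent (\<lambda>N. adj (averager u N) * x * averager u N)"
    proof (rule convergent_compressions[OF averager_norm_le[OF u(1)]])
      show "x \<in> closure (cspan Mon)" using that \<O>_eq by simp
      show "convergent (\<lambda>N. adj (averager u N) * y * averager u N)" if "y \<in> Mon" for y
        using that averager_tendsto[OF u(1)] by (auto simp: Mon_def convergent_def)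
    qed
    then show ?thesis using that by (simp add: f_def C_def[abs_def] convergent_LIMSEQ_iff)
  qed
  have uniq: "f x = y" if "x \<in> \<O>" "C x \<longlonglongrightarrow> y" for x y
    using LIMSEQ_unique conv that by blast
  have mon: "f (s \<alpha> * adj (s \<beta>)) = t \<alpha> * adj (t \<beta>)" if "\<alpha> \<in> words" "\<beta> \<in> words" for \<alpha> \<beta>
    using averager_tendsto[OF u(1) that] that unfolding t[OF that(1)] t[OF that(2)]
    by (intro uniq \<O>D word_in_\<O>) (auto simp: C_def[abs_def])
  have add: "f (x + y) = f x + f y" if "x \<in> \<O>" "y \<in> \<O>" for x y
    using that tendsto_add[OF conv[OF that(1)] conv[OF that(2)]]
    by (intro uniq \<O>D) (auto simp: C_def[abs_def] distrib_left distrib_right)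
  have scale: "f (c *\<^sub>C x) = c *\<^sub>C f x" if "x \<in> \<O>" for c x
    using that tendsto_scaleC[OF conv[OF that]]
    by (intro uniq \<O>D) (auto simp: C_def[abs_def] scaleC_mult_left scaleC_mult_right)
  have fadj: "f (adj x) = adj (f x)" if "x \<in> \<O>" for x
    using that tendsto_adj[OF conv[OF that]]
    by (intro uniq \<O>D) (auto simp: C_def[abs_def] adj_mult adj_adj mult.assoc)
  have zero: "f 0 = 0" using scale[of 0 0] \<O>D(2) by simp
  have diff: "f (x - y) = f x - f y" if "x \<in> \<O>" "y \<in> \<O>" for x y
    using that tendsto_diff[OF conv[OF that(1)] conv[OF that(2)]]
    by (intro uniq \<O>D) (auto simp: C_def[abs_def] left_diff_distrib right_diff_distrib)
  have nle: "norm (f x) \<le> norm x" if "x \<in> \<O>" for x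
  proof (rule LIMSEQ_le_const2[OF tendsto_norm[OF conv[OF that]]])
    have "norm (C x N) \<le> norm x" for N
      unfolding C_def by (rule norm_compress_le[OF averager_norm_le[OF u(1)]])
    then show "\<exists>N. \<forall>k\<ge>N. norm (C x k) \<le> norm x" by blast
  qed
  have cont: "continuous_on \<O> f"
    using nle \<O>D(8) by (intro continuous_on_contraction) (simp add: dist_norm flip: diff)
  have t_in: "t \<mu> \<in> \<O>" if "\<mu> \<in> words" for \<mu>
    unfolding t[OF that] using that u by (intro \<O>D cocycle_in_\<O> word_in_\<O>)
  have f_in: "f x \<in> \<O>" if "x \<in> \<O>" for x
  proof -
    have "x \<in> {x \<in> \<O>. f x \<in> \<O>}" using that
    proof (rule \<O>_induct)
      show "csubspace {x \<in> \<O>. f x \<in> \<O>}"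
        by (auto simp: csubspace_def \<O>D zero add scale)
      have "closed (\<O> \<inter> f -` \<O>)" by (intro continuous_closed_preimage cont \<O>D)
      then show "closed {x \<in> \<O>. f x \<in> \<O>}" by (simp add: vimage_def Collect_conj_eq)
    qed (simp add: mon \<O>D t_in word_in_\<O>)
    then show ?thesis by simp
  qed
  have mon_mult: "f (s \<alpha> * adj (s \<beta>) * (s \<gamma> * adj (s \<delta>))) = f (s \<alpha> * adj (s \<beta>)) * f (s \<gamma> * adj (s \<delta>))"
    if w: "\<alpha> \<in> words" "\<beta> \<in> words" "\<gamma> \<in> words" "\<delta> \<in> words" for \<alpha> \<beta> \<gamma> \<delta>
  proof (cases "length \<beta> \<le> length \<gamma>")
    case True
    have v: "\<alpha> @ drop (length \<beta>) \<gamma> \<in> words" using w by (auto dest: in_set_dropD)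
    show ?thesis
      unfolding mon[OF w(1,2)] mon[OF w(3,4)] Mon_mult_le[OF w(2,3) True]
        T.Mon_mult_le[OF w(2,3) True, folded t_def] using mon[OF v w(4)] zero by simp
  next
    case False
    then have ge: "length \<gamma> \<le> length \<beta>" by simp
    have v: "\<delta> @ drop (length \<gamma>) \<beta> \<in> words" using w by (auto dest: in_set_dropD)
    show ?thesis
      unfolding mon[OF w(1,2)] mon[OF w(3,4)] Mon_mult_ge[OF w(2,3) ge]
        T.Mon_mult_ge[OF w(2,3) ge, folded t_def] using mon[OF w(1) v] zero by simp
  qed
  have cl1: "closed {x \<in> \<O>. f (x * y) = f x * f y}" if "y \<in> \<O>" for y
    by (intro equalizer_closed \<O>D continuous_intros cont continuous_on_compose2[OF cont])
      (use that \<O>D in auto)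
  have cl2: "closed {y \<in> \<O>. f (x * y) = f x * f y}" if "x \<in> \<O>" for x
    by (intro equalizer_closed \<O>D continuous_intros cont continuous_on_compose2[OF cont])
      (use that \<O>D in auto)
  have mult: "f (x * y) = f x * f y" if "x \<in> \<O>" "y \<in> \<O>" for x y
  proof -
    have 1: "f (m * y) = f m * f y" if m: "m = s \<alpha> * adj (s \<beta>)" "\<alpha> \<in> words" "\<beta> \<in> words" for m \<alpha> \<beta>
    proof -
      have m_in: "m \<in> \<O>" using m by (simp add: \<O>D word_in_\<O>)
      have "y \<in> {y \<in> \<O>. f (m * y) = f m * f y}" using \<open>y \<in> \<O>\<close>
      proof (rule \<O>_induct)
        show "csubspace {y \<in> \<O>. f (m * y) = f m * f y}"
          using m_in by (auto simp: csubspace_def \<O>D zero add scale distrib_left scaleC_mult_right)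
        show "closed {y \<in> \<O>. f (m * y) = f m * f y}" by (rule cl2[OF m_in])
      qed (use m in \<open>simp add: mon_mult \<O>D word_in_\<O>\<close>)
      then show ?thesis by simp
    qed
    have "x \<in> {x \<in> \<O>. f (x * y) = f x * f y}" using \<open>x \<in> \<O>\<close>
    proof (rule \<O>_induct)
      show "csubspace {x \<in> \<O>. f (x * y) = f x * f y}"
        using \<open>y \<in> \<O>\<close> by (auto simp: csubspace_def \<O>D zero add scale distrib_right scaleC_mult_left)
      show "closed {x \<in> \<O>. f (x * y) = f x * f y}" by (rule cl1[OF \<open>y \<in> \<O>\<close>])
    qed (use 1 in \<open>auto simp: \<O>D word_in_\<O>\<close>)
    then show ?thesis by simp
  qed
  have "f 1 = 1" using mon[of "[]" "[]"] by (simp add: t)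
  moreover have "f \<in> \<O> \<rightarrow>\<^sub>E \<O>" using f_in by (auto simp: f_def)
  ultimately have "f \<in> unital_star_endos \<O>"
    by (auto simp: unital_star_endos_def add mult scale fadj)
  moreover have "f (S i) = u * S i" if "i \<in> {1..n}" for i
    using mon[of "[i]" "[]"] that by (simp add: t word_Cons)
  ultimately show ?thesis by blast
qed


section \<open>The endomorphisms \<open>lam u\<close>: uniqueness, values on words,
  composition\<close>

abbreviation lam where "lam \<equiv> cuntz_endo n S"
abbreviation \<P> where "\<P> \<equiv> perm_unitaries n S"

lemma star_endo_\<O>: "f \<in> unital_star_endos \<O> \<Longrightarrow> star_endo \<O> f"
  by (simp add: star_endo_def \<O>_subalgebra one_in_\<O>)

lemma lam_unique:
  assumes f: "f \<in> unital_star_endos \<O>" and eq: "\<And>i. i \<in> {1..n} \<Longrightarrow> f (S i) = u * S i"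
  shows "lam u = f"
  unfolding cuntz_endo_def
proof (rule the_equality)
  fix g assume "g \<in> unital_star_endos \<O> \<and> (\<forall>i\<in>{1..n}. g (S i) = u * S i)"
  then show "g = f"
    using f eq one_in_\<O> by (intro unital_star_endos_eqI[of "S ` {1..n}", folded cuntz_algebra_def]) auto
qed (use f eq in blast)

lemma
  assumes u: "unitary u" "u \<in> \<O>"
  shows lam_endo: "lam u \<in> unital_star_endos \<O>"
    and lam_S: "i \<in> {1..n} \<Longrightarrow> lam u (S i) = u * S i"
proof -
  obtain f where f: "f \<in> unital_star_endos \<O>" "\<And>i. i \<in> {1..n} \<Longrightarrow> f (S i) = u * S i"
    using exists_endo[OF u] by blast
  then have "lam u = f" by (rule lam_unique)
  then show "lam u \<in> unital_star_endos \<O>" "i \<in> {1..n} \<Longrightarrow> lam u (S i) = u * S i" using f by auto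
qed

lemma lam_star_endo: "unitary u \<Longrightarrow> u \<in> \<O> \<Longrightarrow> star_endo \<O> (lam u)"
  by (intro star_endo_\<O> lam_endo)

lemmas lamD = unital_star_endosD[OF lam_endo]

lemma lam_word:
  assumes u: "unitary u" "u \<in> \<O>" and "\<mu> \<in> words"
  shows "lam u (s \<mu>) = cocycle u (length \<mu>) * s \<mu>"
proof -
  have "lam u (s \<mu>) = word_isometry (\<lambda>i. u * S i) \<mu>"
    using \<open>\<mu> \<in> words\<close>
  proof (induction \<mu>)
    case (Cons i \<mu>)
    then show ?case
      using lamD(3)[OF u S_in_\<O>[OF Cons.hyps(1)] word_in_\<O>[OF Cons.hyps(2)]] lam_S[OF u Cons.hyps(1)]
      by (simp add: word_isometry_def)
  qed (use lamD(6)[OF u] in \<open>simp add: word_isometry_def\<close>)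
  then show ?thesis using cocycle_word[OF \<open>\<mu> \<in> words\<close>] by simp
qed

lemma lam_in_\<O>: "unitary u \<Longrightarrow> u \<in> \<O> \<Longrightarrow> x \<in> \<O> \<Longrightarrow> lam u x \<in> \<O>"
  by (rule lamD(1))

text \<open>On generators, \<open>lam u (v * S i) = lam u v * (u * S i)\<close>. In particular
  \<open>lam u w = adj u\<close> makes \<open>lam w\<close> a right inverse of
  \<open>lam u\<close>.\<close>

lemma lam_compose:
  assumes u: "unitary u" "u \<in> \<O>" and v: "unitary v" "v \<in> \<O>"
  shows "compose \<O> (lam u) (lam v) = lam (lam u v * u)"
proof (rule lam_unique[symmetric])
  note U = lamD[OF u] and V = lamD[OF v]
  show "compose \<O> (lam u) (lam v) \<in> unital_star_endos \<O>"
    unfolding unital_star_endos_def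
    by (auto simp: compose_def U(1-6) V(1-6) \<O>D one_in_\<O>)
  fix i assume i: "i \<in> {1..n}"
  show "compose \<O> (lam u) (lam v) (S i) = lam u v * u * S i"
    using i u v U(3) S_in_\<O>[OF i] by (simp add: compose_def lam_S[OF u i] lam_S[OF v i] mult.assoc)
qed

lemma lam_1: "lam 1 = (\<lambda>x\<in>\<O>. x)"
  by (rule lam_unique) (auto simp: unital_star_endos_def \<O>D one_in_\<O> S_in_\<O>)

lemma lam_shift:
  assumes u: "unitary u" "u \<in> \<O>" and x: "x \<in> \<O>"
  shows "lam u (\<phi> x) = u * \<phi> (lam u x) * adj u"
proof -
  interpret star_endo \<O> "lam u" by (rule lam_star_endo[OF u])
  have "lam u (\<phi> x) = (\<Sum>i=1..n. lam u (S i * x * adj (S i)))"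
    unfolding canonical_shift_def by (intro f_sum \<O>D S_in_\<O> x)
  also have "\<dots> = (\<Sum>i=1..n. u * (S i * lam u x * adj (S i)) * adj u)"
    using x by (intro sum.cong refl)
      (simp add: fD(3,5) \<O>D S_in_\<O> lam_S[OF u] adj_mult mult.assoc del: atLeastAtMost_iff)
  finally show ?thesis by (simp add: canonical_shift_def sum_distrib_left sum_distrib_right)
qed

subsection \<open>The diagonal\<close>

lemma P_def: "P \<mu> = s \<mu> * adj (s \<mu>)"
  by (simp add: word_proj_def)

lemma P_Nil [simp]: "P [] = 1"
  by (simp add: P_def)

lemma P_adj [simp]: "adj (P \<mu>) = P \<mu>"
  by (simp add: P_def adj_mult adj_adj)

lemma sum_P': "(\<Sum>\<mu>\<in>W k. P \<mu>) = 1"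
  by (simp add: P_def sum_P)

lemma P_orth: "\<mu> \<in> W k \<Longrightarrow> \<nu> \<in> W k \<Longrightarrow> P \<mu> * P \<nu> = (if \<mu> = \<nu> then P \<mu> else 0)"
proof -
  assume *: "\<mu> \<in> W k" "\<nu> \<in> W k"
  have "P \<mu> * P \<nu> = s \<mu> * (adj (s \<mu>) * s \<nu>) * adj (s \<nu>)" by (simp add: P_def mult.assoc)
  then show ?thesis using word_orth[OF *] by (auto simp: P_def)
qed

lemma P_nonzero: "\<mu> \<in> words \<Longrightarrow> P \<mu> \<noteq> 0"
proof
  assume "\<mu> \<in> words" "P \<mu> = 0"
  then have "adj (s \<mu>) * P \<mu> * s \<mu> = 0" by simp
  moreover have "adj (s \<mu>) * P \<mu> * s \<mu> = (adj (s \<mu>) * s \<mu>) * (adj (s \<mu>) * s \<mu>)"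
    by (simp add: P_def mult.assoc)
  ultimately show False using word_isom[OF \<open>\<mu> \<in> words\<close>] by simp
qed

lemma P_append: "\<mu> \<in> W k \<Longrightarrow> P (\<mu> @ \<rho>) = P \<mu> * (\<phi> ^^ k) (P \<rho>)"
proof -
  assume "\<mu> \<in> W k"
  then have "adj (s \<mu>) * (\<phi> ^^ k) (P \<rho>) = P \<rho> * adj (s \<mu>)" by (rule word_adj_shift_pow)
  then show ?thesis by (simp add: P_def word_append adj_mult mult.assoc)
qed

lemma P_Cons: "P (i # \<mu>) = S i * P \<mu> * adj (S i)"
  by (simp add: P_def word_Cons adj_mult mult.assoc)

lemma P_split: "P \<mu> = (\<Sum>\<rho>\<in>W l. P (\<mu> @ \<rho>))"
proof -
  have "(\<Sum>\<rho>\<in>W l. P (\<mu> @ \<rho>)) = s \<mu> * (\<Sum>\<rho>\<in>W l. s \<rho> * adj (s \<rho>)) * adj (s \<mu>)"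
    by (simp add: P_def word_append adj_mult sum_distrib_left sum_distrib_right mult.assoc)
  then show ?thesis by (simp add: sum_P P_def)
qed

lemma shift_pow_P: "(\<phi> ^^ k) (P \<rho>) = (\<Sum>\<mu>\<in>W k. P (\<mu> @ \<rho>))"
  by (simp add: shift_pow P_def word_append adj_mult mult.assoc)

lemma P_idem: "\<mu> \<in> words \<Longrightarrow> P \<mu> * P \<mu> = P \<mu>"
  using P_orth[of \<mu> "length \<mu>" \<mu>] by (simp add: W_iff)

lemma P_mult_le:
  assumes "\<mu> \<in> words" "\<nu> \<in> words" "length \<mu> \<le> length \<nu>"
  shows "P \<mu> * P \<nu> = (if take (length \<mu>) \<nu> = \<mu> then P \<nu> else 0)"
proof -
  have "\<nu> \<in> W (length \<mu> + (length \<nu> - length \<mu>))" using assms by (simp add: W_iff)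
  then obtain \<nu>1 \<nu>2 where *: "\<nu> = \<nu>1 @ \<nu>2" "\<nu>1 \<in> W (length \<mu>)" by (rule W_appendE)
  have "\<mu> \<in> W (length \<mu>)" using assms by (simp add: W_iff)
  then have "P \<mu> * P \<nu> = (if \<mu> = \<nu>1 then P \<nu> else 0)"
    using P_orth[of \<mu> "length \<mu>" \<nu>1] * by (auto simp: P_append simp flip: mult.assoc)
  moreover have "length \<nu>1 = length \<mu>" using * by (simp add: W_iff)
  ultimately show ?thesis using * by auto
qed

lemma P_mult:
  assumes "\<mu> \<in> words" "\<nu> \<in> words"
  shows "P \<mu> * P \<nu> \<in> {0, P \<mu>, P \<nu>}" "P \<mu> * P \<nu> = P \<nu> * P \<mu>"
proof -
  have le: "P \<mu> * P \<nu> \<in> {0, P \<mu>, P \<nu>} \<and> P \<mu> * P \<nu> = P \<nu> * P \<mu>"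
    if "\<mu> \<in> words" "\<nu> \<in> words" "length \<mu> \<le> length \<nu>" for \<mu> \<nu>
  proof -
    have "P \<nu> * P \<mu> = adj (P \<mu> * P \<nu>)" by (simp add: adj_mult)
    then show ?thesis using P_mult_le[OF that] by auto
  qed
  have "P \<mu> * P \<nu> \<in> {0, P \<mu>, P \<nu>} \<and> P \<mu> * P \<nu> = P \<nu> * P \<mu>"
  proof (cases "length \<mu> \<le> length \<nu>")
    case False
    then have *: "P \<nu> * P \<mu> \<in> {0, P \<nu>, P \<mu>} \<and> P \<nu> * P \<mu> = P \<mu> * P \<nu>"
      by (intro le assms) simp
    from * have "P \<mu> * P \<nu> \<in> {0, P \<nu>, P \<mu>}" by metis
    then have "P \<mu> * P \<nu> \<in> {0, P \<mu>, P \<nu>}" unfolding insert_commute[of "P \<nu>" "P \<mu>"] .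
    then show ?thesis using *[THEN conjunct2, symmetric] by (rule conjI)
  qed (rule le[OF assms])
  then show "P \<mu> * P \<nu> \<in> {0, P \<mu>, P \<nu>}" "P \<mu> * P \<nu> = P \<nu> * P \<mu>" by auto
qed

lemma words_eq: "words = (\<Union>k. W k)"
  by (auto simp: cuntz_words_def)

lemma \<D>_eq: "\<D> = closure (cspan (P ` words))"
  unfolding diagonal_def words_eq[symmetric]
proof (rule cstar_generated_eq_closure)
  show "P ` words \<subseteq> cstar_generated (P ` words)" by (intro subsetI cstar_generated_base)
  show "\<And>x. x \<in> P ` words \<Longrightarrow> adj x \<in> P ` words" by auto
  fix x y assume "x \<in> P ` words" "y \<in> P ` words"
  then obtain \<mu> \<nu> where *: "x = P \<mu>" "y = P \<nu>" "\<mu> \<in> words" "\<nu> \<in> words" by blast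
  have "x * y \<in> {0, P \<mu>, P \<nu>}" unfolding *(1,2) by (rule P_mult(1)[OF *(3,4)])
  moreover have "{0, P \<mu>, P \<nu>} \<subseteq> cspan (P ` words)"
    using *(3,4) by (simp add: cspan_0 cspan_base del: in_lists_conv_set)
  ultimately show "x * y \<in> cspan (P ` words)" by (rule subsetD[rotated])
qed blast

lemma \<D>_subalgebra: "cstar_subalgebra \<D>"
  by (simp add: diagonal_def cstar_generated_subalgebra)

lemmas \<D>D = cstar_subalgebraD[OF \<D>_subalgebra]

lemma P_in_\<D>: "\<mu> \<in> words \<Longrightarrow> P \<mu> \<in> \<D>"
  unfolding diagonal_def words_eq[symmetric] by (rule cstar_generated_base) blast

lemma one_in_\<D>: "1 \<in> \<D>"
  using P_in_\<D>[of "[]"] by simp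

lemma \<D>_induct:
  assumes "x \<in> \<D>" "csubspace V" "closed V" "\<And>\<mu>. \<mu> \<in> words \<Longrightarrow> P \<mu> \<in> V"
  shows "x \<in> V"
  using closure_cspan_subset[of "P ` words" V] assms by (auto simp: \<D>_eq)

lemma \<D>_subset: "x \<in> \<D> \<Longrightarrow> x \<in> \<O>"
  by (erule \<D>_induct) (auto simp: P_def \<O>D intro!: \<O>D word_in_\<O>)

lemma \<D>_comm: "x \<in> \<D> \<Longrightarrow> y \<in> \<D> \<Longrightarrow> x * y = y * x"
proof -
  assume x: "x \<in> \<D>" and y: "y \<in> \<D>"
  have 1: "x \<in> {x. x * P \<mu> = P \<mu> * x}" if "\<mu> \<in> words" for \<mu> using x
    by (rule \<D>_induct)
      (auto simp: csubspace_def distrib_left distrib_right scaleC_mult_left scaleC_mult_right P_mult(2)[OF _ that]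
        intro!: closed_Collect_eq continuous_intros)
  have "y \<in> {y. x * y = y * x}" using y
    by (rule \<D>_induct)
      (use 1 in \<open>auto simp: csubspace_def distrib_left distrib_right scaleC_mult_left scaleC_mult_right
        intro!: closed_Collect_eq continuous_intros\<close>)
  then show ?thesis by simp
qed

lemma preimage_csubspace:
  assumes "csubspace V" "\<And>x y. g (x + y) = g x + g y" "\<And>c x. g (c *\<^sub>C x) = c *\<^sub>C g x"
  shows "csubspace {x. g x \<in> V}"
proof -
  have "g 0 = 0" using assms(3)[of 0 0] by simp
  then show ?thesis using csubspaceD[OF assms(1)] assms(2,3) by (simp add: csubspace_def)
qed

lemma preimage_closed:
  assumes "closed V" "continuous_on UNIV g"
  shows "closed {x. g x \<in> V}"
  using continuous_closed_preimage[OF assms(2) closed_UNIV assms(1)] by (simp add: vimage_def)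

lemma \<D>_mapI:
  assumes x: "x \<in> \<D>" and g: "\<And>x y. g (x + y) = g x + g y" "\<And>c x. g (c *\<^sub>C x) = c *\<^sub>C g x"
    "continuous_on UNIV g" "\<And>\<mu>. \<mu> \<in> words \<Longrightarrow> g (P \<mu>) \<in> \<D>"
  shows "g x \<in> \<D>"
proof -
  have "x \<in> {x. g x \<in> \<D>}" using x
    by (rule \<D>_induct) (auto intro!: preimage_csubspace preimage_closed g \<D>D)
  then show ?thesis by simp
qed

lemma word_shift_\<D>: "x \<in> \<D> \<Longrightarrow> \<mu> \<in> words \<Longrightarrow> s \<mu> * x * adj (s \<mu>) \<in> \<D>"
proof (erule \<D>_mapI)
  fix \<nu> assume "\<mu> \<in> words" "\<nu> \<in> words"
  moreover have "s \<mu> * P \<nu> * adj (s \<mu>) = P (\<mu> @ \<nu>)"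
    by (simp add: P_def word_append adj_mult mult.assoc)
  ultimately show "s \<mu> * P \<nu> * adj (s \<mu>) \<in> \<D>" by (auto intro!: P_in_\<D>)
qed (auto simp: distrib_left distrib_right scaleC_mult_left scaleC_mult_right intro!: continuous_intros)

lemma shift_pow_\<D>: "x \<in> \<D> \<Longrightarrow> (\<phi> ^^ k) x \<in> \<D>"
  unfolding shift_pow by (intro csubspace_sum \<D>D word_shift_\<D>) (auto simp: W_iff)

lemma shift_\<D>: "x \<in> \<D> \<Longrightarrow> \<phi> x \<in> \<D>"
  using shift_pow_\<D>[of x 1] by simp

lemma S_shift_\<D>: "x \<in> \<D> \<Longrightarrow> i \<in> {1..n} \<Longrightarrow> S i * x * adj (S i) \<in> \<D>"
  using word_shift_\<D>[of x "[i]"] by (simp add: word_Cons)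

lemma compress_P:
  assumes "i \<in> {1..n}" "j \<in> {1..n}"
  shows "adj (S i) * P (j # \<nu>) * S i = (if i = j then P \<nu> else 0)"
proof -
  have "adj (S i) * P (j # \<nu>) * S i = (adj (S i) * S j) * P \<nu> * (adj (S j) * S i)"
    by (simp add: P_Cons mult.assoc)
  then show ?thesis using S_adj_S[OF assms] S_adj_S[OF assms(2,1)] by simp
qed

lemma compress_\<D>: "x \<in> \<D> \<Longrightarrow> i \<in> {1..n} \<Longrightarrow> adj (S i) * x * S i \<in> \<D>"
proof (erule \<D>_mapI)
  fix \<mu> assume i: "i \<in> {1..n}" and \<mu>: "\<mu> \<in> words"
  show "adj (S i) * P \<mu> * S i \<in> \<D>"
  proof (cases \<mu>)
    case Nil
    then show ?thesis using S_isometry[OF i] one_in_\<D> by simp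
  next
    case (Cons j \<nu>)
    then have "j \<in> {1..n}" "\<nu> \<in> words" using \<mu> by auto
    then show ?thesis using compress_P[OF i] \<D>D(2) P_in_\<D> by (simp add: Cons)
  qed
qed (auto simp: distrib_left distrib_right scaleC_mult_left scaleC_mult_right intro!: continuous_intros)

subsection \<open>Permutative unitaries\<close>

text \<open>A level at which \<open>u\<close> acts on words, without naming the permutation.
  Injectivity comes from \<open>adj u * u = 1\<close> and surjectivity from counting; as a property
  of a level, it passes to every higher level.\<close>

definition permutes_at :: "nat \<Rightarrow> 'a \<Rightarrow> bool" where
  "permutes_at k u \<longleftrightarrow> (\<forall>\<mu>\<in>W k. \<exists>\<nu>\<in>W k. u * s \<mu> = s \<nu>)"

lemma word_inj: "\<mu> \<in> W k \<Longrightarrow> \<nu> \<in> W k \<Longrightarrow> s \<mu> = s \<nu> \<Longrightarrow> \<mu> = \<nu>"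
  using word_orth[of \<mu> k \<nu>] word_orth[of \<mu> k \<mu>] by (metis zero_neq_one)

lemma word_sum_word:
  assumes "\<mu> \<in> W k"
  shows "(\<Sum>\<nu>\<in>W k. s (\<sigma> \<nu>) * adj (s \<nu>)) * s \<mu> = s (\<sigma> \<mu>)"
proof -
  have "(\<Sum>\<nu>\<in>W k. s (\<sigma> \<nu>) * adj (s \<nu>)) * s \<mu> = (\<Sum>\<nu>\<in>W k. s (\<sigma> \<nu>) * (adj (s \<nu>) * s \<mu>))"
    by (simp add: sum_distrib_right mult.assoc)
  also have "\<dots> = (\<Sum>\<nu>\<in>W k. if \<nu> = \<mu> then s (\<sigma> \<nu>) else 0)"
    using assms by (intro sum.cong) (auto simp: word_orth)
  finally show ?thesis using assms by simp
qed

lemma permutes_at_bij: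
  assumes u: "adj u * u = 1" "permutes_at k u"
  obtains \<sigma> where "bij_betw \<sigma> (W k) (W k)" "\<And>\<mu>. \<mu> \<in> W k \<Longrightarrow> u * s \<mu> = s (\<sigma> \<mu>)"
proof -
  obtain \<sigma> where \<sigma>: "\<And>\<mu>. \<mu> \<in> W k \<Longrightarrow> \<sigma> \<mu> \<in> W k \<and> u * s \<mu> = s (\<sigma> \<mu>)"
    using u(2) unfolding permutes_at_def by metis
  have "inj_on \<sigma> (W k)"
  proof (rule inj_onI)
    fix \<mu> \<nu> assume *: "\<mu> \<in> W k" "\<nu> \<in> W k" "\<sigma> \<mu> = \<sigma> \<nu>"
    then have "adj u * (u * s \<mu>) = adj u * (u * s \<nu>)" using \<sigma> by simp
    then have "s \<mu> = s \<nu>" using u(1) by (simp flip: mult.assoc)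
    then show "\<mu> = \<nu>" using * word_inj by blast
  qed
  moreover have "\<sigma> ` W k \<subseteq> W k" using \<sigma> by blast
  ultimately have "bij_betw \<sigma> (W k) (W k)" by (simp add: bij_betw_def endo_inj_surj)
  then show ?thesis using \<sigma> that by blast
qed

lemma \<P>_iff: "u \<in> \<P> \<longleftrightarrow> adj u * u = 1 \<and> (\<exists>k. permutes_at k u)"
proof
  assume "u \<in> \<P>"
  then obtain k \<sigma> where \<sigma>: "bij_betw \<sigma> (W k) (W k)"
    and u: "u = (\<Sum>\<mu>\<in>W k. s (\<sigma> \<mu>) * adj (s \<mu>))" unfolding perm_unitaries_def by blast
  have \<sigma>W: "\<sigma> \<mu> \<in> W k" if "\<mu> \<in> W k" for \<mu> using \<sigma> that by (auto simp: bij_betw_def)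
  have us: "u * s \<mu> = s (\<sigma> \<mu>)" if "\<mu> \<in> W k" for \<mu>
    unfolding u by (rule word_sum_word[OF that])
  have "adj u * u = 1"
  proof (rule eq_by_words)
    fix \<mu> assume \<mu>: "\<mu> \<in> W k"
    have "adj u * s (\<sigma> \<mu>) = (\<Sum>\<nu>\<in>W k. s \<nu> * (adj (s (\<sigma> \<nu>)) * s (\<sigma> \<mu>)))"
      by (simp add: u adj_sum adj_mult adj_adj sum_distrib_right mult.assoc)
    also have "\<dots> = (\<Sum>\<nu>\<in>W k. if \<nu> = \<mu> then s \<nu> else 0)"
      using \<mu> by (intro sum.cong) (auto simp: word_orth[OF \<sigma>W \<sigma>W] inj_on_eq_iff[OF bij_betw_imp_inj_on[OF \<sigma>]])
    finally show "adj u * u * s \<mu> = 1 * s \<mu>" using \<mu> us[OF \<mu>] by (simp add: mult.assoc)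
  qed
  then show "adj u * u = 1 \<and> (\<exists>k. permutes_at k u)" using us \<sigma>W unfolding permutes_at_def by blast
next
  assume "adj u * u = 1 \<and> (\<exists>k. permutes_at k u)"
  then obtain k where u: "adj u * u = 1" "permutes_at k u" by blast
  obtain \<sigma> where \<sigma>: "bij_betw \<sigma> (W k) (W k)" "\<And>\<mu>. \<mu> \<in> W k \<Longrightarrow> u * s \<mu> = s (\<sigma> \<mu>)"
    using permutes_at_bij[OF u] by blast
  have "u = (\<Sum>\<mu>\<in>W k. s (\<sigma> \<mu>) * adj (s \<mu>))"
    by (rule eq_by_words[of k]) (simp only: \<sigma>(2) word_sum_word)
  then show "u \<in> \<P>" unfolding perm_unitaries_def using \<sigma>(1) by blast
qed

lemma permutes_at_mono: "permutes_at k u \<Longrightarrow> k \<le> l \<Longrightarrow> permutes_at l u"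
  unfolding permutes_at_def
proof
  fix \<mu> assume *: "\<forall>\<mu>\<in>W k. \<exists>\<nu>\<in>W k. u * s \<mu> = s \<nu>" "k \<le> l" "\<mu> \<in> W l"
  then obtain \<mu>1 \<mu>2 where \<mu>: "\<mu> = \<mu>1 @ \<mu>2" "\<mu>1 \<in> W k" "\<mu>2 \<in> W (l - k)"
    using W_appendE[of \<mu> k "l - k"] by auto
  obtain \<nu> where "\<nu> \<in> W k" "u * s \<mu>1 = s \<nu>" using * \<mu> by blast
  then have "\<nu> @ \<mu>2 \<in> W l" "u * s \<mu> = s (\<nu> @ \<mu>2)"
    using W_appendI[of \<nu> k \<mu>2 "l - k"] \<mu> * by (auto simp: word_append simp flip: mult.assoc)
  then show "\<exists>\<nu>\<in>W l. u * s \<mu> = s \<nu>" by blast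
qed

lemma permutes_at_surj:
  assumes u: "adj u * u = 1" "permutes_at k u" and \<nu>: "\<nu> \<in> W k"
  obtains \<mu> where "\<mu> \<in> W k" "u * s \<mu> = s \<nu>"
proof -
  obtain \<sigma> where "bij_betw \<sigma> (W k) (W k)" "\<And>\<mu>. \<mu> \<in> W k \<Longrightarrow> u * s \<mu> = s (\<sigma> \<mu>)"
    using permutes_at_bij[OF u] by blast
  then show ?thesis using \<nu> that by (metis bij_betw_imp_surj_on imageE)
qed

lemma \<P>_unitary:
  assumes "u \<in> \<P>"
  shows "unitary u"
proof -
  obtain k where u: "adj u * u = 1" "permutes_at k u" using assms \<P>_iff by blast
  have "u * adj u = 1"
  proof (rule eq_by_words)
    fix \<nu> assume "\<nu> \<in> W k"
    then obtain \<mu> where "\<mu> \<in> W k" "u * s \<mu> = s \<nu>" by (rule permutes_at_surj[OF u])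
    then have "u * adj u * s \<nu> = u * (adj u * u) * s \<mu>" by (simp add: mult.assoc)
    then show "u * adj u * s \<nu> = 1 * s \<nu>" using u \<open>u * s \<mu> = s \<nu>\<close> by simp
  qed
  then show ?thesis using u by (simp add: unitary_def)
qed

lemma \<P>_level: "u \<in> \<P> \<Longrightarrow> \<exists>k. permutes_at k u"
  by (simp add: \<P>_iff)

lemma \<P>I: "unitary u \<Longrightarrow> permutes_at k u \<Longrightarrow> u \<in> \<P>"
  by (auto simp: \<P>_iff unitary_def)

lemma \<P>_in_\<O>: "u \<in> \<P> \<Longrightarrow> u \<in> \<O>"
proof -
  assume "u \<in> \<P>"
  then obtain k \<sigma> where \<sigma>: "bij_betw \<sigma> (W k) (W k)"
    and u: "u = (\<Sum>\<mu>\<in>W k. s (\<sigma> \<mu>) * adj (s \<mu>))" unfolding perm_unitaries_def by blast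
  show ?thesis unfolding u
    by (intro csubspace_sum \<O>D word_in_\<O>) (use bij_betwE[OF \<sigma>] W_words in blast)+
qed

lemma \<P>_1: "1 \<in> \<P>"
  using \<P>I[OF unitary_1, of 0] by (simp add: permutes_at_def)

lemma \<P>_mult:
  assumes "u \<in> \<P>" "v \<in> \<P>"
  shows "u * v \<in> \<P>"
proof -
  obtain k l where "permutes_at k u" "permutes_at l v" using assms \<P>_level by blast
  then have "permutes_at (max k l) u" "permutes_at (max k l) v" by (auto intro: permutes_at_mono)
  then have "permutes_at (max k l) (u * v)"
    unfolding permutes_at_def by (metis mult.assoc)
  then show ?thesis by (rule \<P>I[OF unitary_mult[OF assms[THEN \<P>_unitary]]])
qed

lemma permutes_at_adj:
  assumes u: "adj u * u = 1" "permutes_at k u"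
  shows "permutes_at k (adj u)"
  unfolding permutes_at_def
proof
  fix \<nu> assume "\<nu> \<in> W k"
  then obtain \<mu> where \<mu>: "\<mu> \<in> W k" "u * s \<mu> = s \<nu>" by (rule permutes_at_surj[OF u])
  then have "adj u * s \<nu> = adj u * u * s \<mu>" by (simp add: mult.assoc)
  then show "\<exists>\<mu>\<in>W k. adj u * s \<nu> = s \<mu>" using u \<mu> by auto
qed

lemma \<P>_adj: "u \<in> \<P> \<Longrightarrow> adj u \<in> \<P>"
  using \<P>I[OF unitary_adj[OF \<P>_unitary] permutes_at_adj] \<P>_iff by blast

lemma \<P>_shift:
  assumes "u \<in> \<P>"
  shows "\<phi> u \<in> \<P>"
proof -
  obtain k where k: "permutes_at k u" using assms \<P>_level by blast
  have "permutes_at (Suc k) (\<phi> u)"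
    unfolding permutes_at_def
  proof
    fix \<mu> assume "\<mu> \<in> W (Suc k)"
    then obtain i \<nu> where \<mu>: "\<mu> = i # \<nu>" "i \<in> {1..n}" "\<nu> \<in> W k" by (rule W_SucE)
    obtain \<rho> where "\<rho> \<in> W k" "u * s \<nu> = s \<rho>" using k \<mu> by (auto simp: permutes_at_def)
    have "\<phi> u * s \<mu> = \<phi> u * S i * s \<nu>" by (simp add: \<mu>(1) word_Cons mult.assoc)
    also have "\<dots> = S i * (u * s \<nu>)" unfolding shift_S[OF \<mu>(2)] by (rule mult.assoc)
    finally have "\<phi> u * s \<mu> = s (i # \<rho>)" using \<open>u * s \<nu> = s \<rho>\<close> by (simp add: word_Cons)
    moreover have "i # \<rho> \<in> W (Suc k)" using \<mu> \<open>\<rho> \<in> W k\<close> by (simp add: W_iff)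
    ultimately show "\<exists>\<nu>\<in>W (Suc k). \<phi> u * s \<mu> = s \<nu>" by blast
  qed
  then show ?thesis by (rule \<P>I[OF unitary_shift[OF \<P>_unitary[OF assms]]])
qed

lemma \<P>_cocycle: "u \<in> \<P> \<Longrightarrow> cocycle u k \<in> \<P>"
  by (induction k) (auto intro: \<P>_1 \<P>_mult \<P>_shift)

text \<open>\<open>u\<close> rewrites only the first \<open>k\<close> letters, and
  \<open>(\<phi> ^^ k) x\<close> acts only behind them.\<close>

lemma permutes_at_commute:
  assumes "permutes_at k u"
  shows "u * (\<phi> ^^ k) x = (\<phi> ^^ k) x * u"
proof (rule eq_by_words)
  fix \<mu> assume \<mu>: "\<mu> \<in> W k"
  then obtain \<nu> where \<nu>: "\<nu> \<in> W k" "u * s \<mu> = s \<nu>" using assms by (auto simp: permutes_at_def)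
  have "u * (\<phi> ^^ k) x * s \<mu> = u * s \<mu> * x" using shift_pow_word[OF \<mu>] by (simp add: mult.assoc)
  also have "\<dots> = (\<phi> ^^ k) x * (u * s \<mu>)" using \<nu> shift_pow_word[OF \<nu>(1)] by simp
  finally show "u * (\<phi> ^^ k) x * s \<mu> = (\<phi> ^^ k) x * u * s \<mu>" by (simp add: mult.assoc)
qed

lemma permutes_at_P:
  assumes "permutes_at k u" "\<mu> \<in> W k"
  obtains \<nu> where "\<nu> \<in> W k" "u * s \<mu> = s \<nu>" "u * P \<mu> * adj u = P \<nu>"
proof -
  obtain \<nu> where \<nu>: "\<nu> \<in> W k" "u * s \<mu> = s \<nu>" using assms by (auto simp: permutes_at_def)
  have "u * P \<mu> * adj u = (u * s \<mu>) * adj (u * s \<mu>)" by (simp add: P_def adj_mult mult.assoc)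
  then show ?thesis using \<nu> that by (simp add: P_def)
qed

lemma \<P>_normalizes_\<D>:
  assumes u: "u \<in> \<P>" and x: "x \<in> \<D>"
  shows "u * x * adj u \<in> \<D>"
  using x
proof (rule \<D>_mapI)
  fix \<mu> assume \<mu>: "\<mu> \<in> words"
  obtain k where k: "permutes_at k u" using u \<P>_level by blast
  have "u * P (\<mu> @ \<rho>) * adj u \<in> \<D>" if "\<rho> \<in> W k" for \<rho>
  proof -
    have "permutes_at (length \<mu> + k) u" "\<mu> @ \<rho> \<in> W (length \<mu> + k)"
      using k \<mu> that by (auto simp: W_iff intro: permutes_at_mono)
    then obtain \<nu> where "\<nu> \<in> W (length \<mu> + k)" "u * P (\<mu> @ \<rho>) * adj u = P \<nu>"
      by (rule permutes_at_P)
    then show ?thesis using P_in_\<D> W_words by metis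
  qed
  then have "(\<Sum>\<rho>\<in>W k. u * P (\<mu> @ \<rho>) * adj u) \<in> \<D>" by (intro csubspace_sum[OF \<D>D(7)])
  then show "u * P \<mu> * adj u \<in> \<D>"
    by (subst P_split[of \<mu> k]) (simp add: sum_distrib_left sum_distrib_right)
qed (auto simp: distrib_left distrib_right scaleC_mult_left scaleC_mult_right intro!: continuous_intros)

text \<open>At its level, \<open>u\<close> moves \<open>P \<mu>\<close> to the projection of the
  image word; commuting forces that word to be \<open>\<mu>\<close>. This rigidity is how unitaries
  are later shown to be trivial.\<close>

lemma \<P>_commute_\<D>:
  assumes u: "u \<in> \<P>" and comm: "\<And>\<mu>. \<mu> \<in> words \<Longrightarrow> u * P \<mu> = P \<mu> * u"
  shows "u = 1"
proof -
  obtain k where k: "permutes_at k u" using u \<P>_level by blast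
  show ?thesis
  proof (rule eq_by_words)
    fix \<mu> assume \<mu>: "\<mu> \<in> W k"
    then obtain \<nu> where \<nu>: "\<nu> \<in> W k" "u * s \<mu> = s \<nu>" "u * P \<mu> * adj u = P \<nu>"
      using permutes_at_P[OF k] by blast
    have "u * P \<mu> * adj u = P \<mu>"
      using comm[OF W_words[OF \<mu>]] unitary_simps[OF \<P>_unitary[OF u]] by (simp add: mult.assoc)
    then have "P \<mu> = P \<nu>" using \<nu> by simp
    then have "P \<mu> * P \<nu> \<noteq> 0" using P_nonzero P_idem W_words[OF \<mu>] by metis
    then have "\<mu> = \<nu>" using P_orth[OF \<mu> \<nu>(1)] by (auto split: if_splits)
    then show "u * s \<mu> = 1 * s \<mu>" using \<nu> by simp
  qed
qed

text \<open>The cocycle in \<open>lam_word\<close> depends on the length of the word only, and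
  \<open>v\<close> preserves length \<open>k\<close>; so the same factor appears on both sides of
  every matrix unit \<open>s \<nu> * adj (s \<mu>)\<close>.\<close>

lemma lam_permutative:
  assumes u: "unitary u" "u \<in> \<O>" and v: "permutes_at k v" "v \<in> \<O>"
  shows "lam u v = cocycle u k * v * adj (cocycle u k)"
proof -
  note U = lamD[OF u]
  interpret star_endo \<O> "lam u" by (rule lam_star_endo[OF u])
  have "lam u (v * (s \<mu> * adj (s \<mu>))) = cocycle u k * v * (s \<mu> * adj (s \<mu>)) * adj (cocycle u k)"
    if \<mu>: "\<mu> \<in> W k" for \<mu>
  proof -
    obtain \<nu> where \<nu>: "\<nu> \<in> W k" "v * s \<mu> = s \<nu>" using \<mu> v by (auto simp: permutes_at_def)
    then have "lam u (v * (s \<mu> * adj (s \<mu>))) = lam u (s \<nu> * adj (s \<mu>))" by (simp flip: mult.assoc)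
    also have "\<dots> = cocycle u k * s \<nu> * adj (cocycle u k * s \<mu>)"
      using lam_word[OF u W_words[OF \<mu>]] lam_word[OF u W_words[OF \<nu>(1)]] \<mu> \<nu> U(3,5) word_in_\<O> W_words \<O>D(6)
      by (simp add: W_iff)
    finally show ?thesis unfolding \<nu>(2)[symmetric] by (simp add: adj_mult mult.assoc)
  qed
  then have "(\<Sum>\<mu>\<in>W k. lam u (v * (s \<mu> * adj (s \<mu>))))
      = cocycle u k * v * (\<Sum>\<mu>\<in>W k. s \<mu> * adj (s \<mu>)) * adj (cocycle u k)"
    by (simp add: sum_distrib_left sum_distrib_right)
  moreover have "(\<Sum>\<mu>\<in>W k. lam u (v * (s \<mu> * adj (s \<mu>)))) = lam u (\<Sum>\<mu>\<in>W k. v * (s \<mu> * adj (s \<mu>)))"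
    using v by (intro f_sum[symmetric] \<O>D word_in_\<O> W_words) auto
  ultimately show ?thesis by (simp add: sum_P flip: sum_distrib_left)
qed

lemma lam_\<P>: "u \<in> \<P> \<Longrightarrow> v \<in> \<P> \<Longrightarrow> lam u v \<in> \<P>"
proof -
  assume *: "u \<in> \<P>" "v \<in> \<P>"
  then obtain k where "permutes_at k v" using \<P>_level by blast
  then show ?thesis
    using * by (simp add: lam_permutative \<P>_unitary \<P>_in_\<O> \<P>_mult \<P>_adj \<P>_cocycle)
qed

lemma lam_P:
  assumes u: "unitary u" "u \<in> \<O>" and \<mu>: "\<mu> \<in> words"
  shows "lam u (P \<mu>) = cocycle u (length \<mu>) * P \<mu> * adj (cocycle u (length \<mu>))"
  using lamD(3,5)[OF u] lam_word[OF u \<mu>] word_in_\<O>[OF \<mu>] \<O>D(6)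
  by (simp add: P_def adj_mult mult.assoc)

lemma lam_\<D>:
  assumes u: "u \<in> \<P>" and x: "x \<in> \<D>"
  shows "lam u x \<in> \<D>"
proof -
  interpret star_endo \<O> "lam u" using lam_star_endo \<P>_unitary \<P>_in_\<O> u by blast
  have "x \<in> {x \<in> \<O>. lam u x \<in> \<D>}" using x
  proof (rule \<D>_induct)
    show "csubspace {x \<in> \<O>. lam u x \<in> \<D>}"
      by (auto simp: csubspace_def \<O>D \<D>D f_0 fD(2,4))
    have "closed (\<O> \<inter> lam u -` \<D>)" by (intro continuous_closed_preimage f_continuous \<O>D \<D>D)
    then show "closed {x \<in> \<O>. lam u x \<in> \<D>}" by (simp add: vimage_def Collect_conj_eq)
    show "P \<mu> \<in> {x \<in> \<O>. lam u x \<in> \<D>}" if "\<mu> \<in> words" for \<mu>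
      using that u by (simp add: lam_P \<P>_unitary \<P>_in_\<O> \<P>_normalizes_\<D> \<P>_cocycle P_in_\<D> \<D>_subset)
  qed
  then show ?thesis by simp
qed


section \<open>Endomorphisms of the diagonal implemented by permutative unitaries\<close>

lemma star_endo_\<D>: "f \<in> unital_star_endos \<D> \<Longrightarrow> star_endo \<D> f"
  by (simp add: star_endo_def \<D>_subalgebra one_in_\<D>)

lemma \<D>_endo_eqI:
  assumes "f \<in> unital_star_endos \<D>" "g \<in> unital_star_endos \<D>"
    and "\<And>\<mu>. \<mu> \<in> words \<Longrightarrow> f (P \<mu>) = g (P \<mu>)"
  shows "f = g"
  using unital_star_endos_eqI[of "P ` words" f g] assms one_in_\<D>
  unfolding diagonal_def words_eq[symmetric] by blast

lemma norm_P_le: "\<mu> \<in> words \<Longrightarrow> norm (P \<mu>) \<le> 1"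
  using norm_mult_ineq[of "s \<mu>" "adj (s \<mu>)"] norm_isometry[OF word_isom] by (simp add: P_def)

text \<open>If \<open>\<D>\<close> is viewed as the continuous functions on infinite words, finite
  combinations of the \<open>P \<nu>\<close> are locally constant: on a cylinder at least as long as
  every \<open>\<nu>\<close> they have a single value \<open>c\<close>.\<close>

lemma cspan_P_scalar:
  assumes "a \<in> cspan (P ` words)"
  shows "\<exists>k. \<forall>l\<ge>k. \<forall>\<mu>\<in>W l. \<exists>c. a * P \<mu> = c *\<^sub>C P \<mu>"
  using assms
proof (induction a)
  case cspan_0
  show ?case by (intro exI[of _ 0] allI impI ballI exI[of _ "0::complex"]) simp
next
  case (cspan_step x y d)
  obtain \<nu> where \<nu>: "x = P \<nu>" "\<nu> \<in> words" using cspan_step.hyps by blast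
  obtain k where k: "\<And>l \<mu>. l \<ge> k \<Longrightarrow> \<mu> \<in> W l \<Longrightarrow> \<exists>c. y * P \<mu> = c *\<^sub>C P \<mu>"
    using cspan_step.IH by blast
  have "\<exists>c. (d *\<^sub>C x + y) * P \<mu> = c *\<^sub>C P \<mu>" if l: "l \<ge> max k (length \<nu>)" "\<mu> \<in> W l" for l \<mu>
  proof -
    obtain c where c: "y * P \<mu> = c *\<^sub>C P \<mu>" using k[of l \<mu>] l by auto
    have "length \<nu> \<le> length \<mu>" "\<mu> \<in> words" using l by (simp_all add: W_iff)
    then have "P \<nu> * P \<mu> = (if take (length \<nu>) \<mu> = \<nu> then P \<mu> else 0)" using \<nu> by (intro P_mult_le)
    then have "(d *\<^sub>C x + y) * P \<mu> = (if take (length \<nu>) \<mu> = \<nu> then d + c else c) *\<^sub>C P \<mu>"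
      using c by (simp add: \<nu> distrib_right scaleC_mult_left scaleC_add_left)
    then show ?thesis by blast
  qed
  then show ?case by blast
qed

text \<open>A clopen set of infinite words is a union of cylinders of some fixed length. Approximate
  \<open>p\<close> to within 1/2 by a locally constant \<open>a\<close>; if \<open>p\<close> split
  some \<open>P \<mu>\<close> into two nonzero parts, the value of \<open>a\<close> there would be
  closer than 1/2 to both 1 and 0.\<close>

lemma idempotent_decided:
  assumes p: "p \<in> \<D>" "p * p = p"
  shows "\<exists>k. \<forall>l\<ge>k. \<forall>\<mu>\<in>W l. p * P \<mu> = P \<mu> \<or> p * P \<mu> = 0"
proof -
  obtain a where a: "a \<in> cspan (P ` words)" "norm (p - a) < 1/2"
    using p(1) unfolding \<D>_eq closure_approachable dist_norm
    by (metis half_gt_zero_iff norm_minus_commute zero_less_one)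
  obtain k where k: "\<And>l \<mu>. l \<ge> k \<Longrightarrow> \<mu> \<in> W l \<Longrightarrow> \<exists>c. a * P \<mu> = c *\<^sub>C P \<mu>"
    using cspan_P_scalar[OF a(1)] by blast
  have "p * P \<mu> = P \<mu> \<or> p * P \<mu> = 0" if l: "l \<ge> k" "\<mu> \<in> W l" for l \<mu>
  proof (rule ccontr)
    assume neg: "\<not> (p * P \<mu> = P \<mu> \<or> p * P \<mu> = 0)"
    define e where "e = p * P \<mu>"
    define e' where "e' = P \<mu> - e"
    have nz: "e \<noteq> 0" "e' \<noteq> 0" using neg by (auto simp: e_def e'_def)
    have \<mu>: "\<mu> \<in> words" using l by (simp add: W_iff)
    have comm: "P \<mu> * p = p * P \<mu>" using \<D>_comm[OF P_in_\<D>[OF \<mu>] p(1)] .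
    have Pe: "e * P \<mu> = e" using P_idem[OF \<mu>] by (simp add: e_def mult.assoc)
    have Pe2: "P \<mu> * e = e" using P_idem[OF \<mu>] comm by (simp add: e_def flip: mult.assoc) (simp add: mult.assoc)
    have ee: "e * e = e"
    proof -
      have "e * e = p * (P \<mu> * p) * P \<mu>" by (simp add: e_def mult.assoc)
      also have "\<dots> = (p * p) * (P \<mu> * P \<mu>)" unfolding comm by (simp add: mult.assoc)
      finally show ?thesis using p(2) P_idem[OF \<mu>] by (simp add: e_def)
    qed
    obtain c where c: "a * P \<mu> = c *\<^sub>C P \<mu>" using k l by blast
    define x where "x = (p - a) * P \<mu>"
    have x: "x = e - c *\<^sub>C P \<mu>" by (simp add: x_def e_def left_diff_distrib c)
    have "norm x \<le> norm (p - a) * norm (P \<mu>)" unfolding x_def by (rule norm_mult_ineq)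
    also have "\<dots> \<le> norm (p - a) * 1" using norm_P_le[OF \<mu>] by (intro mult_left_mono) auto
    finally have nx: "norm x < 1/2" using a by simp
    \<comment> \<open>A nonzero \<open>y\<close> with \<open>y * x = d *\<^sub>C y\<close> is a left
      eigenvector, so \<open>cmod d\<close> is bounded by \<open>norm x\<close>.\<close>
    have small: "cmod d < 1/2" if "y * x = d *\<^sub>C y" "y \<noteq> 0" for y d
    proof -
      have "cmod d * norm y \<le> norm y * norm x" using norm_mult_ineq[of y x] that by (simp add: norm_scaleC)
      then have "cmod d \<le> norm x" using \<open>y \<noteq> 0\<close> by simp
      then show ?thesis using nx by simp
    qed
    have "e * x = (1 - c) *\<^sub>C e"
      using ee Pe by (simp add: x right_diff_distrib scaleC_mult_right scaleC_diff_left)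
    then have 1: "cmod (1 - c) < 1/2" using small nz by blast
    have "e' * x = (- c) *\<^sub>C e'"
      using ee Pe Pe2 P_idem[OF \<mu>]
      by (simp add: x e'_def right_diff_distrib left_diff_distrib scaleC_mult_right scaleC_minus_left scaleC_diff_right)
    then have 2: "cmod (- c) < 1/2" using small nz by blast
    have "cmod (1 - c - - c) \<le> cmod (1 - c) + cmod (- c)" by (rule norm_triangle_ineq4)
    then show False using 1 2 by simp
  qed
  then show ?thesis by blast
qed

text \<open>
  The ranges of the \<open>Q \<mu>\<close> correspond to disjoint nonempty subsets of \<open>W L\<close>, indexed by \<open>W L\<close> itself,
  so they are singletons.
\<close>

lemma permutation_of_projections:
  assumes nz: "\<And>\<mu>. \<mu> \<in> W L \<Longrightarrow> Q \<mu> \<noteq> 0"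
    and orth: "\<And>\<mu> \<nu>. \<mu> \<in> W L \<Longrightarrow> \<nu> \<in> W L \<Longrightarrow> \<mu> \<noteq> \<nu> \<Longrightarrow> Q \<mu> * Q \<nu> = 0"
    and dec: "\<And>\<mu> \<nu>. \<mu> \<in> W L \<Longrightarrow> \<nu> \<in> W L \<Longrightarrow> Q \<mu> * P \<nu> = P \<nu> \<or> Q \<mu> * P \<nu> = 0"
  obtains \<sigma> where "bij_betw \<sigma> (W L) (W L)" "\<And>\<mu>. \<mu> \<in> W L \<Longrightarrow> Q \<mu> = P (\<sigma> \<mu>)"
proof -
  define A where "A \<mu> = {\<nu> \<in> W L. Q \<mu> * P \<nu> = P \<nu>}" for \<mu>
  have Qsum: "Q \<mu> = (\<Sum>\<nu>\<in>A \<mu>. P \<nu>)" if \<mu>: "\<mu> \<in> W L" for \<mu>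
  proof -
    have "Q \<mu> = Q \<mu> * (\<Sum>\<nu>\<in>W L. P \<nu>)" by (simp add: sum_P')
    also have "\<dots> = (\<Sum>\<nu>\<in>W L. Q \<mu> * P \<nu>)" by (simp add: sum_distrib_left)
    also have "\<dots> = (\<Sum>\<nu>\<in>A \<mu>. P \<nu>)"
      by (rule sum.mono_neutral_cong_right) (use dec[OF \<mu>] in \<open>auto simp: A_def\<close>)
    finally show ?thesis .
  qed
  have disj: "\<mu> = \<mu>'" if "\<mu> \<in> W L" "\<mu>' \<in> W L" "\<nu> \<in> A \<mu>" "\<nu> \<in> A \<mu>'" for \<mu> \<mu>' \<nu>
  proof (rule ccontr)
    assume "\<mu> \<noteq> \<mu>'"
    then have "Q \<mu> * Q \<mu>' * P \<nu> = 0" using orth that by simp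
    moreover have "Q \<mu> * Q \<mu>' * P \<nu> = P \<nu>" using that by (simp add: A_def mult.assoc)
    ultimately show False using P_nonzero[of \<nu>] that by (auto simp: A_def W_iff)
  qed
  have ne: "A \<mu> \<noteq> {}" if "\<mu> \<in> W L" for \<mu> using nz[OF that] Qsum[OF that] by auto
  define \<sigma> where "\<sigma> \<mu> = (SOME \<nu>. \<nu> \<in> A \<mu>)" for \<mu>
  have \<sigma>: "\<sigma> \<mu> \<in> A \<mu>" if "\<mu> \<in> W L" for \<mu>
    unfolding \<sigma>_def using ne[OF that] by (simp add: some_in_eq)
  have "inj_on \<sigma> (W L)" using \<sigma> disj by (metis inj_onI)
  moreover have "\<sigma> ` W L \<subseteq> W L" using \<sigma> by (auto simp: A_def)
  ultimately have bij: "bij_betw \<sigma> (W L) (W L)" by (simp add: bij_betw_def endo_inj_surj)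
  have "A \<mu> = {\<sigma> \<mu>}" if \<mu>: "\<mu> \<in> W L" for \<mu>
  proof -
    have "\<nu> = \<sigma> \<mu>" if \<nu>: "\<nu> \<in> A \<mu>" for \<nu>
    proof -
      have "\<nu> \<in> \<sigma> ` W L" using \<nu> bij by (auto simp: A_def bij_betw_def)
      then obtain \<mu>' where "\<mu>' \<in> W L" "\<nu> = \<sigma> \<mu>'" by blast
      then show ?thesis using disj[OF \<mu> _ \<nu>] \<sigma> by blast
    qed
    then show ?thesis using \<sigma>[OF \<mu>] by blast
  qed
  then have "Q \<mu> = P (\<sigma> \<mu>)" if "\<mu> \<in> W L" for \<mu> using Qsum[OF that] that by simp
  then show ?thesis using bij that by blast
qed

lemma \<D>_endo_inner:
  assumes \<beta>: "\<beta> \<in> unital_star_endos \<D>" and nz: "\<And>\<mu>. \<mu> \<in> words \<Longrightarrow> \<beta> (P \<mu>) \<noteq> 0"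
    and fix0: "\<And>\<rho>. \<rho> \<in> words \<Longrightarrow> \<beta> ((\<phi> ^^ k) (P \<rho>)) = (\<phi> ^^ k) (P \<rho>)"
  shows "\<exists>u\<in>\<P>. \<forall>y\<in>\<D>. \<beta> y = u * y * adj u"
proof -
  interpret star_endo \<D> \<beta> by (rule star_endo_\<D>[OF \<beta>])
  have "\<exists>k. \<forall>l\<ge>k. \<forall>\<nu>\<in>W l. \<beta> (P \<mu>) * P \<nu> = P \<nu> \<or> \<beta> (P \<mu>) * P \<nu> = 0" if "\<mu> \<in> words" for \<mu>
    using that fD(1) fD(3)[of "P \<mu>" "P \<mu>"] P_idem P_in_\<D> by (intro idempotent_decided) auto
  then obtain g where g: "\<And>\<mu> l \<nu>. \<mu> \<in> words \<Longrightarrow> l \<ge> g \<mu> \<Longrightarrow> \<nu> \<in> W l \<Longrightarrow>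
      \<beta> (P \<mu>) * P \<nu> = P \<nu> \<or> \<beta> (P \<mu>) * P \<nu> = 0" by metis
  \<comment> \<open>By \<open>P_append\<close> and the fixed range, letters beyond the first
    \<open>k\<close> only multiply \<open>\<beta> (P \<mu>1)\<close> by the diagonal projection of
    the tail. So a length that decides \<open>\<beta> (P \<mu>)\<close> for the finitely many
    \<open>\<mu> \<in> W k\<close> and is at least \<open>k\<close> decides all words of that
    length; the sum bounds every \<open>g \<mu>\<close>.\<close>
  define L where "L = k + (\<Sum>\<mu>\<in>W k. g \<mu>)"
  have gL: "g \<mu> \<le> L" if "\<mu> \<in> W k" for \<mu>
    using member_le_sum[of \<mu> "W k" g] that by (simp add: L_def)
  have \<beta>_app: "\<beta> (P (\<mu> @ \<rho>)) = \<beta> (P \<mu>) * (\<phi> ^^ k) (P \<rho>)" if "\<mu> \<in> W k" "\<rho> \<in> words" for \<mu> \<rho>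
    using that fD(3)[OF P_in_\<D>[OF W_words[OF that(1)]] shift_pow_\<D>[OF P_in_\<D>[OF that(2)]]]
    by (simp add: P_append fix0)
  have \<beta>_orth: "\<beta> (P \<mu>) * \<beta> (P \<nu>) = 0" if "\<mu> \<in> W l" "\<nu> \<in> W l" "\<mu> \<noteq> \<nu>" for \<mu> \<nu> l
    using that fD(3)[OF P_in_\<D> P_in_\<D>, of \<mu> \<nu>] P_orth[OF that(1,2)] f_0 W_words by metis
  have dec: "\<beta> (P \<mu>) * P \<nu> = P \<nu> \<or> \<beta> (P \<mu>) * P \<nu> = 0" if "\<mu> \<in> W L" "\<nu> \<in> W L" for \<mu> \<nu>
  proof -
    have "\<mu> \<in> W (k + (L - k))" using that by (simp add: L_def)
    then obtain \<mu>1 \<mu>2 where \<mu>: "\<mu> = \<mu>1 @ \<mu>2" "\<mu>1 \<in> W k" "\<mu>2 \<in> W (L - k)"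
      by (rule W_appendE)
    have "\<nu> \<in> W (k + (L - k))" using that by (simp add: L_def)
    then obtain \<nu>1 \<nu>2 where \<nu>: "\<nu> = \<nu>1 @ \<nu>2" "\<nu>1 \<in> W k" "\<nu>2 \<in> W (L - k)"
      by (rule W_appendE)
    have D: "(\<phi> ^^ k) (P \<mu>2) \<in> \<D>" "\<beta> (P \<mu>1) \<in> \<D>" "P \<nu>1 \<in> \<D>"
      using \<mu> \<nu> fD(1) by (auto intro!: shift_pow_\<D> P_in_\<D> W_words)
    have "\<beta> (P \<mu>) * P \<nu> = (\<phi> ^^ k) (P \<mu>2) * (\<beta> (P \<mu>1) * P \<nu>)"
      using \<beta>_app[OF \<mu>(2) W_words[OF \<mu>(3)]] \<D>_comm[OF D(1,2)] by (simp add: \<mu>(1) flip: mult.assoc)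
    moreover have "(\<phi> ^^ k) (P \<mu>2) * P \<nu> = P \<nu>1 * ((\<phi> ^^ k) (P \<mu>2 * P \<nu>2))"
    proof -
      have "(\<phi> ^^ k) (P \<mu>2) * P \<nu> = (\<phi> ^^ k) (P \<mu>2) * P \<nu>1 * (\<phi> ^^ k) (P \<nu>2)"
        by (simp add: \<nu>(1) P_append[OF \<nu>(2)] mult.assoc)
      also have "\<dots> = P \<nu>1 * ((\<phi> ^^ k) (P \<mu>2 * P \<nu>2))"
        unfolding \<D>_comm[OF D(1,3)] shift_pow_mult by (rule mult.assoc)
      finally show ?thesis .
    qed
    then have "(\<phi> ^^ k) (P \<mu>2) * P \<nu> = P \<nu> \<or> (\<phi> ^^ k) (P \<mu>2) * P \<nu> = 0"
      using P_orth[OF \<mu>(3) \<nu>(3)] by (auto simp: \<nu>(1) P_append[OF \<nu>(2)])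
    moreover have "\<beta> (P \<mu>1) * P \<nu> = P \<nu> \<or> \<beta> (P \<mu>1) * P \<nu> = 0"
      using g[OF W_words[OF \<mu>(2)] gL[OF \<mu>(2)] that(2)] .
    ultimately show ?thesis by auto
  qed
  obtain \<sigma> where \<sigma>: "bij_betw \<sigma> (W L) (W L)" "\<And>\<mu>. \<mu> \<in> W L \<Longrightarrow> \<beta> (P \<mu>) = P (\<sigma> \<mu>)"
    by (rule permutation_of_projections[of L "\<lambda>\<mu>. \<beta> (P \<mu>)"]) (use nz[OF W_words] \<beta>_orth dec in blast)+
  define u where "u = (\<Sum>\<mu>\<in>W L. s (\<sigma> \<mu>) * adj (s \<mu>))"
  have u: "u \<in> \<P>" using \<sigma> unfolding perm_unitaries_def u_def by blast
  have \<sigma>W: "\<sigma> \<mu> \<in> W L" if "\<mu> \<in> W L" for \<mu> using \<sigma>(1) that by (auto simp: bij_betw_def)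
  have us: "u * s \<mu> = s (\<sigma> \<mu>)" if "\<mu> \<in> W L" for \<mu>
    unfolding u_def by (rule word_sum_word[OF that])
  have uL: "permutes_at L u" unfolding permutes_at_def using us \<sigma>W by blast
  have uP: "\<beta> (P \<mu>) = u * P \<mu> * adj u" if "\<mu> \<in> W L" for \<mu>
  proof -
    have "u * P \<mu> * adj u = (u * s \<mu>) * adj (u * s \<mu>)" by (simp add: P_def adj_mult mult.assoc)
    then show ?thesis using us[OF that] \<sigma>(2)[OF that] by (simp add: P_def)
  qed
  \<comment> \<open>Since \<open>L \<ge> k\<close>, the shifts
    \<open>(\<phi> ^^ L) (P \<rho>)\<close> are fixed as well. As \<open>u\<close> commutes with
    them, the formula extends from words of length \<open>L\<close> to longer ones, and then by
    \<open>P_split\<close> to shorter ones.\<close>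
  have fixL: "\<beta> ((\<phi> ^^ L) (P \<rho>)) = (\<phi> ^^ L) (P \<rho>)" if "\<rho> \<in> words" for \<rho>
  proof -
    have w: "\<tau> @ \<rho> \<in> words" if "\<tau> \<in> W l" for \<tau> l using that \<open>\<rho> \<in> words\<close> by (simp add: W_iff)
    have "(\<phi> ^^ L) (P \<rho>) = (\<phi> ^^ k) ((\<phi> ^^ (L - k)) (P \<rho>))"
      by (metis L_def comp_apply funpow_add diff_add_inverse)
    also have "\<dots> = (\<Sum>\<tau>\<in>W (L - k). (\<phi> ^^ k) (P (\<tau> @ \<rho>)))"
      unfolding shift_pow_P[of "L - k"] by (rule shift_pow_sum)
    finally have eq: "(\<phi> ^^ L) (P \<rho>) = (\<Sum>\<tau>\<in>W (L - k). (\<phi> ^^ k) (P (\<tau> @ \<rho>)))" .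
    have "\<beta> (\<Sum>\<tau>\<in>W (L - k). (\<phi> ^^ k) (P (\<tau> @ \<rho>))) = (\<Sum>\<tau>\<in>W (L - k). \<beta> ((\<phi> ^^ k) (P (\<tau> @ \<rho>))))"
      by (intro f_sum shift_pow_\<D> P_in_\<D> w)
    also have "\<dots> = (\<Sum>\<tau>\<in>W (L - k). (\<phi> ^^ k) (P (\<tau> @ \<rho>)))" by (intro sum.cong refl fix0 w)
    finally show ?thesis unfolding eq .
  qed
  have long: "\<beta> (P \<nu>) = u * P \<nu> * adj u" if "\<nu> \<in> words" "L \<le> length \<nu>" for \<nu>
  proof -
    have "\<nu> \<in> W (L + (length \<nu> - L))" using that by (simp add: W_iff)
    then obtain \<nu>1 \<nu>2 where \<nu>: "\<nu> = \<nu>1 @ \<nu>2" "\<nu>1 \<in> W L" "\<nu>2 \<in> W (length \<nu> - L)" by (rule W_appendE)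
    have "\<beta> (P \<nu>) = \<beta> (P \<nu>1) * \<beta> ((\<phi> ^^ L) (P \<nu>2))"
      unfolding \<nu>(1) P_append[OF \<nu>(2)] using \<nu> by (intro fD(3) shift_pow_\<D> P_in_\<D> W_words)
    also have "\<dots> = u * P \<nu>1 * (adj u * (\<phi> ^^ L) (P \<nu>2))"
      using uP[OF \<nu>(2)] fixL[OF W_words[OF \<nu>(3)]] by (simp add: mult.assoc)
    also have "adj u * (\<phi> ^^ L) (P \<nu>2) = (\<phi> ^^ L) (P \<nu>2) * adj u"
      using permutes_at_commute[OF permutes_at_adj[OF _ uL]] \<P>_unitary[OF u] by (simp add: unitary_def)
    finally show ?thesis unfolding \<nu>(1) P_append[OF \<nu>(2)] by (simp add: mult.assoc)
  qed
  have P: "\<beta> (P \<nu>) = u * P \<nu> * adj u" if \<nu>: "\<nu> \<in> words" for \<nu>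
  proof -
    have w: "\<nu> @ \<rho> \<in> words" "L \<le> length (\<nu> @ \<rho>)" if "\<rho> \<in> W L" for \<rho>
      using that \<nu> by (simp_all add: W_iff)
    have "\<beta> (\<Sum>\<rho>\<in>W L. P (\<nu> @ \<rho>)) = (\<Sum>\<rho>\<in>W L. \<beta> (P (\<nu> @ \<rho>)))"
      by (intro f_sum P_in_\<D> w)
    also have "\<dots> = (\<Sum>\<rho>\<in>W L. u * P (\<nu> @ \<rho>) * adj u)" by (intro sum.cong refl long w)
    also have "\<dots> = u * (\<Sum>\<rho>\<in>W L. P (\<nu> @ \<rho>)) * adj u" by (simp add: sum_distrib_left sum_distrib_right)
    finally show ?thesis by (simp flip: P_split)
  qed
  have "\<beta> = Ad_on \<D> u"
    using Ad_endo[OF \<D>_subalgebra one_in_\<D> \<P>_unitary[OF u] \<P>_normalizes_\<D>[OF u]] \<beta> P P_in_\<D>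
    by (intro \<D>_endo_eqI) (simp_all add: Ad_on_def)
  then have "\<beta> y = u * y * adj u" if "y \<in> \<D>" for y using that by (simp add: Ad_on_def)
  then show ?thesis using u by blast
qed


subsection \<open>Gauge automorphisms and the fixed point algebra\<close>

abbreviation gauge where "gauge z \<equiv> lam (z *\<^sub>C 1)"

lemma unit_scalar:
  assumes "cmod z = 1"
  shows "unitary (z *\<^sub>C 1)" "z *\<^sub>C 1 \<in> \<O>"
proof -
  have "cnj z * z = 1" using assms by (metis complex_norm_square mult.commute of_real_1 one_power2)
  then show "unitary (z *\<^sub>C 1)"
    by (simp add: unitary_def adj_scaleC scaleC_mult_left scaleC_mult_right scaleC_scaleC mult.commute)
  show "z *\<^sub>C 1 \<in> \<O>" using one_in_\<O> by (rule \<O>D)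
qed

lemma cocycle_scalar: "cocycle (z *\<^sub>C 1) k = z ^ k *\<^sub>C 1"
  by (induction k) (simp_all add: shift_scaleC scaleC_mult_left scaleC_scaleC)

lemma gauge_mono:
  assumes z: "cmod z = 1" and w: "\<alpha> \<in> words" "\<beta> \<in> words"
  shows "gauge z (s \<alpha> * adj (s \<beta>)) = (z ^ length \<alpha> * cnj z ^ length \<beta>) *\<^sub>C (s \<alpha> * adj (s \<beta>))"
  using lamD(3,5)[OF unit_scalar[OF z]] lam_word[OF unit_scalar[OF z]] w word_in_\<O> \<O>D(6)
  by (simp add: cocycle_scalar scaleC_mult_left scaleC_mult_right scaleC_scaleC adj_scaleC mult.commute)

lemma gauge_P: "cmod z = 1 \<Longrightarrow> \<mu> \<in> words \<Longrightarrow> gauge z (P \<mu>) = P \<mu>"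
proof -
  assume z: "cmod z = 1" and \<mu>: "\<mu> \<in> words"
  have "z * cnj z = 1" using z by (metis complex_norm_square of_real_1 one_power2)
  then have "z ^ length \<mu> * cnj z ^ length \<mu> = 1" by (metis power_mult_distrib power_one)
  then show ?thesis using gauge_mono[OF z \<mu> \<mu>] by (simp add: P_def)
qed

lemma gauge_\<D>:
  assumes z: "cmod z = 1" and x: "x \<in> \<D>"
  shows "gauge z x = x"
proof -
  interpret star_endo \<O> "gauge z" by (rule lam_star_endo[OF unit_scalar[OF z]])
  have "x \<in> {x \<in> \<O>. gauge z x = x}" using x
  proof (rule \<D>_induct)
    show "csubspace {x \<in> \<O>. gauge z x = x}" by (auto simp: csubspace_def \<O>D f_0 fD(2,4))
    show "closed {x \<in> \<O>. gauge z x = x}"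
      by (intro equalizer_closed f_continuous \<O>D continuous_on_id)
  qed (use z in \<open>simp add: gauge_P P_in_\<D> \<D>_subset\<close>)
  then show ?thesis by simp
qed

lemma gauge_\<P>:
  assumes z: "cmod z = 1" and u: "u \<in> \<P>"
  shows "gauge z u = u"
proof -
  obtain k where "permutes_at k u" using u \<P>_level by blast
  then have "gauge z u = cocycle (z *\<^sub>C 1) k * u * adj (cocycle (z *\<^sub>C 1) k)"
    by (intro lam_permutative unit_scalar z \<P>_in_\<O> u)
  moreover have "cocycle (z *\<^sub>C 1) k * u = u * cocycle (z *\<^sub>C 1) k"
    by (simp add: cocycle_scalar scaleC_mult_left scaleC_mult_right)
  ultimately show ?thesis
    using unitary_simps(2)[OF unitary_cocycle[OF unit_scalar(1)[OF z]]] by (simp add: mult.assoc)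
qed

text \<open>\<open>u\<close> is gauge invariant, so both composites send \<open>S i\<close> to
  \<open>z *\<^sub>C (u * S i)\<close>. Hence an injective \<open>lam u\<close> reflects gauge
  invariance.\<close>

lemma gauge_lam:
  assumes z: "cmod z = 1" and u: "u \<in> \<P>" and x: "x \<in> \<O>"
  shows "gauge z (lam u x) = lam u (gauge z x)"
proof -
  note u' = \<P>_unitary[OF u] \<P>_in_\<O>[OF u] and z' = unit_scalar[OF z]
  have "lam u (z *\<^sub>C 1) = z *\<^sub>C 1" using lamD(4)[OF u' one_in_\<O>] lamD(6)[OF u'] by simp
  then have "compose \<O> (lam u) (gauge z) = lam (z *\<^sub>C 1 * u)" using lam_compose[OF u' z'] by simp
  also have "\<dots> = compose \<O> (gauge z) (lam u)"
    using lam_compose[OF z' u'] gauge_\<P>[OF z u] by (simp add: scaleC_mult_left scaleC_mult_right)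
  finally show ?thesis using x by (metis compose_eq)
qed

definition Mon0 :: "'a set" where
  "Mon0 = {s \<alpha> * adj (s \<beta>) | \<alpha> \<beta>. \<alpha> \<in> words \<and> \<beta> \<in> words \<and> length \<alpha> = length \<beta>}"

text \<open>The core of the Cuntz algebra, the UHF algebra of type \<open>n\<close> to the infinity;
  \<open>gauge_fixed\<close> shows that it contains the fixed points of the gauge action.\<close>

definition \<F> :: "'a set" where
  "\<F> = closure (cspan Mon0)"

text \<open>Orthogonality of characters: \<open>w = \<zeta> ^ a * cnj \<zeta> ^ b\<close> is an
  \<open>N\<close>-th root of unity, equal to 1 only for \<open>a = b\<close> as both exponents are
  below \<open>N\<close>; otherwise its geometric sum vanishes.\<close>

lemma root_sum:
  assumes "a < N" "b < N"
  shows "(\<Sum>j<N. (cis (2 * pi / N) ^ j) ^ a * cnj (cis (2 * pi / N) ^ j) ^ b) = (if a = b then of_nat N else 0)"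
proof -
  define \<zeta> where "\<zeta> = cis (2 * pi / N)"
  define w where "w = \<zeta> ^ a * cnj \<zeta> ^ b"
  have unit: "\<zeta> * cnj \<zeta> = 1" by (simp add: \<zeta>_def cis_cnj cis_mult)
  have \<zeta>N: "\<zeta> ^ N = 1" using assms by (simp add: \<zeta>_def DeMoivre)
  have summand: "(\<zeta> ^ j) ^ a * cnj (\<zeta> ^ j) ^ b = w ^ j" for j
    by (simp add: w_def power_mult_distrib mult.commute flip: power_mult)
  have ub: "cnj \<zeta> ^ b * \<zeta> ^ b = 1" using unit by (metis mult.commute power_mult_distrib power_one)
  have "w = 1 \<longleftrightarrow> a = b"
  proof
    assume "w = 1"
    then have "\<zeta> ^ a * (cnj \<zeta> ^ b * \<zeta> ^ b) = \<zeta> ^ b" by (simp add: w_def flip: mult.assoc)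
    then have "\<zeta> ^ a = \<zeta> ^ b" by (simp add: ub)
    then have "cis (2 * pi * real a / real N) = cis (2 * pi * real b / real N)"
      by (simp add: \<zeta>_def DeMoivre mult.commute)
    then show "a = b" using bij_betw_roots_unity[of N] assms by (auto simp: bij_betw_def inj_on_def)
  qed (use unit in \<open>simp add: w_def flip: power_mult_distrib\<close>)
  moreover have "w ^ N = 1"
  proof -
    have "cnj \<zeta> ^ N = 1" using \<zeta>N by (metis complex_cnj_one complex_cnj_power)
    then have "(\<zeta> ^ N) ^ a * (cnj \<zeta> ^ N) ^ b = 1" using \<zeta>N by simp
    then show ?thesis by (simp add: w_def power_mult_distrib mult.commute flip: power_mult)
  qed
  ultimately show ?thesis unfolding \<zeta>_def[symmetric] summand by (cases "w = 1") (auto simp: geometric_sum)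
qed

text \<open>The gauge action is averaged over the \<open>N\<close>-th roots of unity instead of the
  circle. For \<open>N\<close> above the word lengths this kills monomials with words of unequal
  lengths, so a finite combination near \<open>x\<close> is averaged into the span of
  \<open>Mon0\<close>; the average is contractive and fixes \<open>x\<close>, so the distance does
  not grow.\<close>

lemma gauge_fixed:
  assumes x: "x \<in> \<O>" and fixed: "\<And>z. cmod z = 1 \<Longrightarrow> gauge z x = x"
  shows "x \<in> \<F>"
proof -
  define A where "A N y = (1 / of_nat N) *\<^sub>C (\<Sum>j<N. gauge (cis (2 * pi / N) ^ j) y)" for N :: nat and y
  have z: "cmod (cis (2 * pi / N) ^ j) = 1" for N j :: nat by (simp add: norm_power)
  note G = lamD[OF unit_scalar[OF z]]
  have Mon_\<O>: "cspan Mon \<subseteq> \<O>" using \<O>_eq closure_subset by blast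
  have A_span: "\<exists>N0. \<forall>N\<ge>N0. A N p \<in> cspan Mon0" if "p \<in> cspan Mon" for p
    using that
  proof (induction p)
    case cspan_0
    have "gauge (cis (2 * pi / N) ^ j) 0 = 0" for N j :: nat
      using G(4)[OF \<O>D(2), of _ _ 0] by simp
    then show ?case by (simp add: A_def cspan.cspan_0)
  next
    case (cspan_step m y c)
    obtain \<alpha> \<beta> where m: "m = s \<alpha> * adj (s \<beta>)" "\<alpha> \<in> words" "\<beta> \<in> words"
      using cspan_step.hyps(1) unfolding Mon_def by blast
    obtain N1 where N1: "\<And>N. N \<ge> N1 \<Longrightarrow> A N y \<in> cspan Mon0" using cspan_step.IH by blast
    have m_in: "m \<in> \<O>" and y_in: "y \<in> \<O>" using cspan_step.hyps cspan_base Mon_\<O> by blast+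
    have "A N (c *\<^sub>C m + y) \<in> cspan Mon0" if N: "N \<ge> Suc (length \<alpha> + length \<beta> + N1)" for N
    proof -
      have "gauge (cis (2 * pi / N) ^ j) (c *\<^sub>C m + y)
          = c *\<^sub>C gauge (cis (2 * pi / N) ^ j) m + gauge (cis (2 * pi / N) ^ j) y" for j
        unfolding G(2)[OF \<O>D(5)[OF m_in] y_in] G(4)[OF m_in] by (rule refl)
      then have "A N (c *\<^sub>C m + y) = c *\<^sub>C A N m + A N y"
        by (simp add: A_def sum.distrib scaleC_add_right scaleC_scaleC flip: scaleC_sum_right)
      moreover have "A N m = (if length \<alpha> = length \<beta> then m else 0)"
      proof -
        have "(\<Sum>j<N. gauge (cis (2 * pi / N) ^ j) m)
            = (\<Sum>j<N. (cis (2 * pi / N) ^ j) ^ length \<alpha> * cnj (cis (2 * pi / N) ^ j) ^ length \<beta>) *\<^sub>C m"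
          unfolding scaleC_sum_left by (intro sum.cong refl) (simp only: m(1) gauge_mono[OF z m(2,3)])
        also have "\<dots> = (if length \<alpha> = length \<beta> then of_nat N else 0) *\<^sub>C m"
          using N by (subst root_sum) auto
        finally show ?thesis using N by (simp add: A_def scaleC_scaleC)
      qed
      moreover have "m \<in> Mon0" if "length \<alpha> = length \<beta>" using m that by (auto simp: Mon0_def)
      ultimately show ?thesis
        using N1[of N] N cspan.cspan_step[of m Mon0 "A N y" c] by auto
    qed
    then show ?case by blast
  qed
  have "\<exists>y\<in>cspan Mon0. dist y x < e" if e: "e > 0" for e
  proof -
    obtain p where p: "p \<in> cspan Mon" "dist p x < e"
      using x e unfolding \<O>_eq closure_approachable by blast
    obtain N0 where N0: "\<And>N. N \<ge> N0 \<Longrightarrow> A N p \<in> cspan Mon0" using A_span[OF p(1)] by blast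
    define N where "N = Suc N0"
    have p_in: "p \<in> \<O>" using p Mon_\<O> by blast
    have "(\<Sum>j<N. gauge (cis (2 * pi / N) ^ j) x) = of_nat N *\<^sub>C x"
      using fixed[OF z] by (simp flip: scaleC_sum_left)
        (metis of_real_of_nat_eq scaleC_of_real scaleR_conv_of_real)
    then have Ax: "A N x = x" by (simp add: A_def scaleC_scaleC N_def del: of_nat_Suc)
    have "A N p - A N x = (1 / of_nat N) *\<^sub>C (\<Sum>j<N. gauge (cis (2 * pi / N) ^ j) (p - x))"
      using star_endo.f_diff[OF lam_star_endo[OF unit_scalar[OF z]] p_in x]
      by (simp add: A_def sum_subtractf flip: scaleC_diff_right)
    also have "norm \<dots> \<le> (1 / real N) * (\<Sum>j<N. norm (p - x))"
      unfolding norm_scaleC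
    proof (rule mult_mono)
      show "norm (\<Sum>j<N. gauge (cis (2 * pi / N) ^ j) (p - x)) \<le> (\<Sum>j<N. norm (p - x))"
        by (rule sum_norm_le) (rule star_endo.f_norm_le[OF lam_star_endo[OF unit_scalar[OF z]] \<O>D(8)[OF p_in x]])
    qed (simp_all add: norm_divide)
    also have "\<dots> = norm (p - x)" by (simp add: N_def)
    finally have "dist (A N p) x < e" using p(2) by (simp add: Ax dist_norm)
    then show ?thesis using N0[of N] by (auto simp: N_def)
  qed
  then show ?thesis by (simp add: \<F>_def closure_approachable)
qed

text \<open>A matrix unit of level \<open>k\<close> acts on the first \<open>k\<close> letters only,
  so it commutes with \<open>(\<phi> ^^ l) y\<close> for \<open>l \<ge> k\<close>. This exact
  commutation of approximants controls conjugation by \<open>w\<close> in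
  \<open>inverse_permutative\<close>.\<close>

lemma cspan_Mon0_commute:
  assumes "q \<in> cspan Mon0"
  shows "\<exists>k. \<forall>l\<ge>k. \<forall>y. q * (\<phi> ^^ l) y = (\<phi> ^^ l) y * q"
  using assms
proof (induction q)
  case (cspan_step m q c)
  obtain \<alpha> \<beta> where m: "m = s \<alpha> * adj (s \<beta>)" "\<alpha> \<in> words" "\<beta> \<in> words" "length \<alpha> = length \<beta>"
    using cspan_step.hyps(1) unfolding Mon0_def by blast
  obtain k where k: "\<And>l y. l \<ge> k \<Longrightarrow> q * (\<phi> ^^ l) y = (\<phi> ^^ l) y * q" using cspan_step.IH by blast
  have "m * (\<phi> ^^ l) y = (\<phi> ^^ l) y * m" if "l \<ge> length \<alpha>" for l y
  proof -
    define y' where "y' = (\<phi> ^^ (l - length \<alpha>)) y"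
    have y: "(\<phi> ^^ l) y = (\<phi> ^^ length \<alpha>) y'"
      unfolding y'_def using that by (metis comp_apply funpow_add le_add_diff_inverse)
    have w: "\<alpha> \<in> W (length \<alpha>)" "\<beta> \<in> W (length \<alpha>)" using m by (simp_all add: W_iff)
    have "m * (\<phi> ^^ l) y = s \<alpha> * (adj (s \<beta>) * (\<phi> ^^ length \<alpha>) y')" by (simp add: m(1) y mult.assoc)
    also have "\<dots> = s \<alpha> * y' * adj (s \<beta>)" unfolding word_adj_shift_pow[OF w(2)] by (simp add: mult.assoc)
    also have "\<dots> = (\<phi> ^^ length \<alpha>) y' * m"
      unfolding shift_pow_word[OF w(1), symmetric] by (simp add: m(1) mult.assoc)
    finally show ?thesis by (simp add: y)
  qed
  then have "(c *\<^sub>C m + q) * (\<phi> ^^ l) y = (\<phi> ^^ l) y * (c *\<^sub>C m + q)" if "l \<ge> max k (length \<alpha>)" for l y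
    using that k[of l y] by (simp add: distrib_left distrib_right scaleC_mult_left scaleC_mult_right)
  then show ?case by blast
qed auto

text \<open>These compressions are the diagonal matrix entries of \<open>q\<close> at a level at
  which all its monomials are matrices.\<close>

lemma cspan_Mon0_scalar:
  assumes "q \<in> cspan Mon0"
  shows "\<exists>k. \<forall>l\<ge>k. \<forall>\<mu>\<in>W l. \<exists>c. adj (s \<mu>) * q * s \<mu> = c *\<^sub>C 1"
  using assms
proof (induction q)
  case cspan_0
  show ?case by (intro exI[of _ 0] allI impI ballI exI[of _ "0::complex"]) simp
next
  case (cspan_step m q d)
  obtain \<alpha> \<beta> where m: "m = s \<alpha> * adj (s \<beta>)" "\<alpha> \<in> words" "\<beta> \<in> words" "length \<alpha> = length \<beta>"
    using cspan_step.hyps(1) unfolding Mon0_def by blast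
  obtain k where k: "\<And>l \<mu>. l \<ge> k \<Longrightarrow> \<mu> \<in> W l \<Longrightarrow> \<exists>c. adj (s \<mu>) * q * s \<mu> = c *\<^sub>C 1"
    using cspan_step.IH by blast
  have "\<exists>c. adj (s \<mu>) * (d *\<^sub>C m + q) * s \<mu> = c *\<^sub>C 1"
    if l: "l \<ge> max k (length \<alpha>)" "\<mu> \<in> W l" for l \<mu>
  proof -
    obtain c where c: "adj (s \<mu>) * q * s \<mu> = c *\<^sub>C 1" using k[of l \<mu>] l by auto
    have "\<mu> \<in> W (length \<alpha> + (l - length \<alpha>))" using l by simp
    then obtain \<mu>1 \<mu>2 where \<mu>: "\<mu> = \<mu>1 @ \<mu>2" "\<mu>1 \<in> W (length \<alpha>)" "\<mu>2 \<in> W (l - length \<alpha>)" by (rule W_appendE)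
    have w: "\<alpha> \<in> W (length \<alpha>)" "\<beta> \<in> W (length \<alpha>)" using m by (simp_all add: W_iff)
    have "adj (s \<mu>) * m * s \<mu> = adj (s \<mu>2) * ((adj (s \<mu>1) * s \<alpha>) * (adj (s \<beta>) * s \<mu>1)) * s \<mu>2"
      by (simp add: \<mu>(1) m(1) word_append adj_mult mult.assoc)
    then have "adj (s \<mu>) * m * s \<mu> = (if \<mu>1 = \<alpha> \<and> \<beta> = \<mu>1 then 1 else 0) *\<^sub>C 1"
      using word_orth[OF \<mu>(2) w(1)] word_orth[OF w(2) \<mu>(2)] word_isom[OF W_words[OF \<mu>(3)]] by simp
    then have "adj (s \<mu>) * (d *\<^sub>C m + q) * s \<mu> = (d * (if \<mu>1 = \<alpha> \<and> \<beta> = \<mu>1 then 1 else 0) + c) *\<^sub>C 1"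
      by (simp add: distrib_left distrib_right scaleC_mult_left scaleC_mult_right c scaleC_add_left)
    then show ?thesis by blast
  qed
  then show ?case by blast
qed

text \<open>The diagonal is maximal abelian in the core. An \<open>x\<close> commuting with all
  \<open>P \<mu>\<close> equals its pinching, the sum of the \<open>P \<mu> * x * P \<mu>\<close> of
  one length. The same pinching sends a nearby \<open>q\<close> from the span to a diagonal element
  with entries \<open>c \<mu>\<close>, and by \<open>block_norm_le\<close> it does not increase the
  distance.\<close>

lemma \<F>_commutant_\<D>:
  assumes x: "x \<in> \<F>" and comm: "\<And>\<mu>. \<mu> \<in> words \<Longrightarrow> x * P \<mu> = P \<mu> * x"
  shows "x \<in> \<D>"
proof -
  have "\<exists>y\<in>\<D>. dist y x \<le> e" if e: "e > 0" for e
  proof -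
    obtain q where q: "q \<in> cspan Mon0" "dist q x < e"
      using x e unfolding \<F>_def closure_approachable by blast
    obtain k where "\<And>\<mu>. \<mu> \<in> W k \<Longrightarrow> \<exists>c. adj (s \<mu>) * q * s \<mu> = c *\<^sub>C 1"
      using cspan_Mon0_scalar[OF q(1)] by blast
    then obtain c where c: "\<And>\<mu>. \<mu> \<in> W k \<Longrightarrow> adj (s \<mu>) * q * s \<mu> = c \<mu> *\<^sub>C 1" by metis
    define y where "y = (\<Sum>\<mu>\<in>W k. c \<mu> *\<^sub>C P \<mu>)"
    have "x = x * (\<Sum>\<mu>\<in>W k. P \<mu>)" by (simp add: sum_P')
    also have "\<dots> = (\<Sum>\<mu>\<in>W k. s \<mu> * (adj (s \<mu>) * x * s \<mu>) * adj (s \<mu>))"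
      unfolding sum_distrib_left
    proof (rule sum.cong)
      fix \<mu> assume "\<mu> \<in> W k"
      then have \<mu>: "\<mu> \<in> words" by (rule W_words)
      have "P \<mu> * x * P \<mu> = x * (P \<mu> * P \<mu>)" unfolding comm[OF \<mu>, symmetric] by (rule mult.assoc)
      then show "x * P \<mu> = s \<mu> * (adj (s \<mu>) * x * s \<mu>) * adj (s \<mu>)"
        unfolding P_idem[OF \<mu>] by (simp add: P_def mult.assoc)
    qed simp
    finally have xs: "x = (\<Sum>\<mu>\<in>W k. s \<mu> * (adj (s \<mu>) * x * s \<mu>) * adj (s \<mu>))" .
    have ys: "y = (\<Sum>\<mu>\<in>W k. s \<mu> * (adj (s \<mu>) * q * s \<mu>) * adj (s \<mu>))"
      unfolding y_def using c by (intro sum.cong) (auto simp: scaleC_mult_left scaleC_mult_right P_def)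
    have "y - x = (\<Sum>\<mu>\<in>W k. s \<mu> * (adj (s \<mu>) * (q - x) * s \<mu>) * adj (s \<mu>))"
      by (subst xs, subst ys) (simp add: sum_subtractf right_diff_distrib left_diff_distrib)
    also have "norm \<dots> \<le> norm (q - x)"
    proof (rule block_norm_le)
      fix \<mu> assume "\<mu> \<in> W k"
      then have "norm (s \<mu>) = 1" using norm_isometry word_isom W_words by blast
      then show "norm (adj (s \<mu>) * (q - x) * s \<mu>) \<le> norm (q - x)" by (intro norm_compress_le) simp
    qed
    finally have "dist y x \<le> e" using q(2) by (simp add: dist_norm)
    moreover have "y \<in> \<D>" unfolding y_def
      by (rule csubspace_sum[OF \<D>D(7)], rule \<D>D(5), rule P_in_\<D>, erule W_words)
    ultimately show ?thesis by blast
  qed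
  then have "x \<in> closure \<D>" by (simp add: closure_approachable_le)
  then show ?thesis using \<D>D(1) by simp
qed

subsection \<open>Inverses of permutative automorphisms\<close>

text \<open>For commuting idempotents, \<open>r = f - e\<close> satisfies
  \<open>r * r * r = r\<close>, so a nonzero \<open>r\<close> has norm at least 1.\<close>

lemma idempotents_close:
  fixes e f :: 'a
  assumes "e * e = e" "f * f = f" "e * f = f * e" "norm (f - e) < 1"
  shows "f = e"
proof (rule ccontr)
  assume "f \<noteq> e"
  define r where "r = f - e"
  have ef: "e * (f * x) = f * (e * x)" "e * (e * x) = e * x" "f * (f * x) = f * x" for x
    using assms by (simp_all flip: mult.assoc)
  have "r * r * r = r"
    by (simp add: r_def algebra_simps ef assms(1-3))
  then have "norm r \<le> norm r * norm r * norm r"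
    by (metis norm_mult_ineq mult_right_mono norm_ge_zero order_trans)
  moreover have "norm r > 0" "norm r < 1" using \<open>f \<noteq> e\<close> assms(4) by (auto simp: r_def)
  moreover have "norm r * norm r < 1" using \<open>norm r > 0\<close> \<open>norm r < 1\<close> mult_strict_mono[of "norm r" 1 "norm r" 1] by simp
  ultimately show False using mult_strict_right_mono[of "norm r * norm r" 1 "norm r"] by simp
qed

lemma shift_pow_P_norm: "\<rho> \<in> words \<Longrightarrow> norm ((\<phi> ^^ k) (P \<rho>)) \<le> 1"
  unfolding shift_pow using norm_P_le by (intro block_norm_le)

lemma inverse_permutative:
  assumes u: "u \<in> \<P>" and aut: "lam u \<in> star_auts \<O>"
  obtains w where "w \<in> \<P>" "lam u w = adj u"
proof -
  note u' = \<P>_unitary[OF u] \<P>_in_\<O>[OF u]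
  note U = lamD[OF u']
  have bij: "bij_betw (lam u) \<O> \<O>" using aut by (simp add: star_auts_def)
  have inj: "x = y" if "lam u x = lam u y" "x \<in> \<O>" "y \<in> \<O>" for x y
    using that bij by (auto simp: bij_betw_def inj_on_def)
  have surj: "\<exists>x\<in>\<O>. lam u x = y" if "y \<in> \<O>" for y
    using that bij by (auto simp: bij_betw_def) (metis imageE)
  obtain w where w: "w \<in> \<O>" "lam u w = adj u" using surj[OF \<O>D(6)[OF u'(2)]] by blast
  have "unitary w"
  proof -
    have "lam u (adj w * w) = lam u 1" "lam u (w * adj w) = lam u 1"
      using w U(3,5,6) \<O>D(6) unitary_simps[OF u'(1)] by (simp_all add: adj_adj)
    then show ?thesis unfolding unitary_def using inj w one_in_\<O> \<O>D(4,6) by blast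
  qed
  note wu = this
  have gauge_inv: "gauge z x = x" if "x \<in> \<O>" "cmod z = 1" "gauge z (lam u x) = lam u x" for x z
    using that gauge_lam[OF _ u] lam_in_\<O>[OF unit_scalar] inj by metis
  \<comment> \<open>\<open>lam u\<close> maps \<open>\<D>\<close> onto itself. A preimage
    \<open>x\<close> of \<open>y\<close> is gauge invariant, and it commutes with every
    \<open>P \<mu>\<close> because \<open>y\<close> commutes with \<open>lam u (P \<mu>)\<close>
    inside the commutative \<open>\<D>\<close>; so it lies in \<open>\<D>\<close> by
    maximality.\<close>
  have pre\<D>: "\<exists>x\<in>\<D>. lam u x = y" if y: "y \<in> \<D>" for y
  proof -
    obtain x where x: "x \<in> \<O>" "lam u x = y" using surj \<D>_subset[OF y] by blast
    have "x \<in> \<F>" using gauge_fixed[OF x(1)] gauge_inv[OF x(1)] gauge_\<D>[OF _ y] x(2) by simp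
    moreover have "x * P \<mu> = P \<mu> * x" if \<mu>: "\<mu> \<in> words" for \<mu>
    proof (rule inj)
      have P: "P \<mu> \<in> \<O>" "lam u (P \<mu>) \<in> \<D>" by (intro \<D>_subset P_in_\<D> \<mu>) (intro lam_\<D>[OF u] P_in_\<D> \<mu>)
      show "lam u (x * P \<mu>) = lam u (P \<mu> * x)" using \<D>_comm[OF y P(2)] x P U(3) by simp
      show "x * P \<mu> \<in> \<O>" "P \<mu> * x \<in> \<O>" using x P by (auto intro: \<O>D)
    qed
    ultimately have "x \<in> \<D>" by (rule \<F>_commutant_\<D>)
    then show ?thesis using x by blast
  qed
  \<comment> \<open>\<open>lam u\<close> turns conjugation by \<open>w\<close> into conjugation by
    \<open>adj u\<close>, which is permutative.\<close>
  have norm\<D>: "w * y * adj w \<in> \<D>" if y: "y \<in> \<D>" for y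
  proof -
    have y': "y \<in> \<O>" by (rule \<D>_subset[OF y])
    have "lam u (w * y * adj w) = adj u * lam u y * adj (adj u)"
      using w y' U(3,5) \<O>D(4,6) by simp
    also have "\<dots> \<in> \<D>" by (intro \<P>_normalizes_\<D> \<P>_adj u lam_\<D> y)
    finally obtain x where "x \<in> \<D>" "lam u x = lam u (w * y * adj w)" using pre\<D> by blast
    moreover have "w * y * adj w \<in> \<O>" by (intro \<O>D w y')
    ultimately show ?thesis using inj \<D>_subset by metis
  qed
  have wF: "w \<in> \<F>"
    using gauge_fixed[OF w(1)] gauge_inv[OF w(1)] gauge_\<P>[OF _ \<P>_adj[OF u]] w(2) by simp
  \<comment> \<open>The bound 1/2 serves \<open>fix0\<close>: replacing \<open>w\<close> by
    \<open>q\<close> costs less than 1/2 on each side of \<open>(\<phi> ^^ k) (P \<rho>)\<close>,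
    less than 1 in total, as \<open>idempotents_close\<close> requires.\<close>
  then obtain q where q: "q \<in> cspan Mon0" "dist q w < 1/2"
    unfolding \<F>_def closure_approachable by (meson half_gt_zero_iff zero_less_one)
  obtain k where k: "\<And>y. q * (\<phi> ^^ k) y = (\<phi> ^^ k) y * q" using cspan_Mon0_commute[OF q(1)] by blast
  have fix0: "w * (\<phi> ^^ k) (P \<rho>) * adj w = (\<phi> ^^ k) (P \<rho>)" if \<rho>: "\<rho> \<in> words" for \<rho>
  proof (rule idempotents_close)
    define e where "e = (\<phi> ^^ k) (P \<rho>)"
    have eD: "e \<in> \<D>" unfolding e_def by (intro shift_pow_\<D> P_in_\<D> \<rho>)
    show ee: "(\<phi> ^^ k) (P \<rho>) * (\<phi> ^^ k) (P \<rho>) = (\<phi> ^^ k) (P \<rho>)"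
      by (simp add: P_idem[OF \<rho>] flip: shift_pow_mult)
    then show "w * (\<phi> ^^ k) (P \<rho>) * adj w * (w * (\<phi> ^^ k) (P \<rho>) * adj w) = w * (\<phi> ^^ k) (P \<rho>) * adj w"
      unfolding e_def[symmetric] by (simp add: mult.assoc unitary_simps[OF wu]) (simp flip: mult.assoc)
    show "(\<phi> ^^ k) (P \<rho>) * (w * (\<phi> ^^ k) (P \<rho>) * adj w) = w * (\<phi> ^^ k) (P \<rho>) * adj w * (\<phi> ^^ k) (P \<rho>)"
      unfolding e_def[symmetric] by (rule \<D>_comm[OF eD norm\<D>[OF eD]])
    have ne: "norm e \<le> 1" unfolding e_def by (rule shift_pow_P_norm[OF \<rho>])
    have "w * e * adj w - e = ((w - q) * e - e * (w - q)) * adj w"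
      using k[of "P \<rho>"] unfolding e_def[symmetric]
      by (simp add: left_diff_distrib right_diff_distrib mult.assoc unitary_simps[OF wu])
    then have "norm (w * e * adj w - e) \<le> norm ((w - q) * e - e * (w - q)) * norm (adj w)"
      by (metis norm_mult_ineq)
    also have "norm (adj w) = 1" using norm_isometry wu by (auto simp: unitary_def)
    also have "norm ((w - q) * e - e * (w - q)) \<le> norm ((w - q) * e) + norm (e * (w - q))"
      by (rule norm_triangle_ineq4)
    also have "\<dots> \<le> norm (w - q) * norm e + norm e * norm (w - q)"
      by (intro add_mono norm_mult_ineq)
    also have "\<dots> \<le> norm (w - q) * 1 + 1 * norm (w - q)"
      using ne by (intro add_mono mult_left_mono mult_right_mono) auto
    also have "\<dots> < 1" using q(2) by (simp add: dist_norm norm_minus_commute)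
    finally show "norm (w * (\<phi> ^^ k) (P \<rho>) * adj w - (\<phi> ^^ k) (P \<rho>)) < 1" by (simp add: e_def)
  qed
  have "\<exists>v\<in>\<P>. \<forall>y\<in>\<D>. Ad_on \<D> w y = v * y * adj v"
  proof (rule \<D>_endo_inner[of _ k])
    show "Ad_on \<D> w \<in> unital_star_endos \<D>"
      by (intro Ad_endo \<D>_subalgebra one_in_\<D> wu norm\<D>)
    show "Ad_on \<D> w (P \<mu>) \<noteq> 0" if "\<mu> \<in> words" for \<mu>
    proof
      assume "Ad_on \<D> w (P \<mu>) = 0"
      then have "adj w * (w * P \<mu> * adj w) * w = 0" using P_in_\<D>[OF that] by (simp add: Ad_on_def)
      then show False using P_nonzero[OF that] by (simp add: mult.assoc unitary_simps[OF wu])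
    qed
    show "Ad_on \<D> w ((\<phi> ^^ k) (P \<rho>)) = (\<phi> ^^ k) (P \<rho>)" if "\<rho> \<in> words" for \<rho>
      using fix0[OF that] that by (simp add: Ad_on_def shift_pow_\<D> P_in_\<D>)
  qed
  then obtain v where v: "v \<in> \<P>" "\<And>y. y \<in> \<D> \<Longrightarrow> w * y * adj w = v * y * adj v"
    by (auto simp: Ad_on_def)
  note vu = \<P>_unitary[OF v(1)] and av = \<P>_adj[OF v(1)]
  \<comment> \<open>\<open>v\<close> and \<open>w\<close> induce the same map on
    \<open>\<D>\<close>, so \<open>d\<close> commutes with \<open>\<D>\<close> and, being gauge
    invariant, lies in \<open>\<D>\<close>. Its image \<open>lam u (adj v) * adj u\<close> is then
    at once diagonal and permutative, hence 1.\<close>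
  define d where "d = adj v * w"
  have d_in: "d \<in> \<O>" unfolding d_def by (intro \<O>D(4) \<P>_in_\<O> av w)
  have dd: "adj d * d = 1" by (simp add: d_def adj_mult adj_adj mult.assoc unitary_simps[OF vu] unitary_simps[OF wu])
  have "d \<in> \<F>"
  proof (rule gauge_fixed[OF d_in])
    fix z assume z: "cmod z = 1"
    have "gauge z w = w" using gauge_inv[OF w(1) z] gauge_\<P>[OF z \<P>_adj[OF u]] w(2) by simp
    then show "gauge z d = d"
      using gauge_\<P>[OF z av] lamD(3)[OF unit_scalar[OF z] \<P>_in_\<O>[OF av] w(1)] by (simp add: d_def)
  qed
  moreover have "d * P \<mu> = P \<mu> * d" if \<mu>: "\<mu> \<in> words" for \<mu>
  proof -
    have "adj v * (w * P \<mu> * adj w) * w = adj v * (v * P \<mu> * adj v) * w"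
      using v(2)[OF P_in_\<D>[OF \<mu>]] by simp
    then show ?thesis by (simp add: d_def mult.assoc unitary_simps[OF vu] unitary_simps[OF wu])
  qed
  ultimately have "d \<in> \<D>" by (rule \<F>_commutant_\<D>)
  then have lD: "lam u d \<in> \<D>" by (rule lam_\<D>[OF u])
  have "lam u d = lam u (adj v) * adj u"
    unfolding d_def using U(3)[OF \<P>_in_\<O>[OF av] w(1)] w(2) by simp
  then have "lam u d \<in> \<P>" using \<P>_mult[OF lam_\<P>[OF u av] \<P>_adj[OF u]] by simp
  then have "lam u d = 1" using \<P>_commute_\<D> \<D>_comm[OF lD P_in_\<D>] by blast
  then have "d = 1" using inj[of d 1] U(6) d_in one_in_\<O> by simp
  then have "v * (adj v * w) = v" by (simp add: d_def)
  then have "w = v" by (simp add: unitary_simps[OF vu])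
  then show ?thesis using that v(1) w(2) by blast
qed


text \<open>The algebraic form of \<open>lam u\<close> and \<open>lam w\<close> being mutually
  inverse; its symmetry lets each result on \<open>u\<close> be applied to \<open>w\<close>.\<close>

definition inverse_pair :: "'a \<Rightarrow> 'a \<Rightarrow> bool" where
  "inverse_pair u w \<longleftrightarrow> u \<in> \<P> \<and> w \<in> \<P> \<and> lam u w = adj u \<and> lam w u = adj w"

lemma inverse_pair_sym: "inverse_pair u w \<Longrightarrow> inverse_pair w u"
  by (simp add: inverse_pair_def)

lemma lam_lam:
  assumes u: "u \<in> \<P>" and w: "w \<in> \<P>" and uw: "lam u w = adj u" and x: "x \<in> \<O>"
  shows "lam u (lam w x) = x"
proof -
  have "compose \<O> (lam u) (lam w) = lam (lam u w * u)"
    by (intro lam_compose \<P>_unitary \<P>_in_\<O> u w)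
  also have "\<dots> = (\<lambda>x\<in>\<O>. x)"
    using unitary_simps(1)[OF \<P>_unitary[OF u]] uw lam_1 by simp
  finally have "compose \<O> (lam u) (lam w) x = (\<lambda>x\<in>\<O>. x) x" by simp
  then show ?thesis using x by (simp add: compose_eq)
qed

lemma inverse_pair_lam: "inverse_pair u w \<Longrightarrow> x \<in> \<O> \<Longrightarrow> lam u (lam w x) = x"
  by (simp add: inverse_pair_def lam_lam)

lemma aut_iff_inverse_pair:
  assumes u: "u \<in> \<P>"
  shows "lam u \<in> star_auts \<O> \<longleftrightarrow> (\<exists>w. inverse_pair u w)"
proof
  assume aut: "lam u \<in> star_auts \<O>"
  obtain w where w: "w \<in> \<P>" "lam u w = adj u" using inverse_permutative[OF u aut] by blast
  have wu: "lam w u \<in> \<O>" "adj w \<in> \<O>" using lam_\<P>[OF w(1) u] \<P>_adj[OF w(1)] \<P>_in_\<O> by auto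
  \<comment> \<open>Both sides are \<open>u\<close>, so injectivity of \<open>lam u\<close> yields
    the second half of the pair.\<close>
  have "lam u (lam w u) = lam u (adj w)"
    using lam_lam[OF u w \<P>_in_\<O>[OF u]] w lamD(5)[OF \<P>_unitary[OF u] \<P>_in_\<O>[OF u] \<P>_in_\<O>[OF w(1)]]
    by (simp add: adj_adj)
  then have "lam w u = adj w" using aut wu by (auto simp: star_auts_def bij_betw_def inj_on_def)
  then show "\<exists>w. inverse_pair u w" using u w by (auto simp: inverse_pair_def)
next
  assume "\<exists>w. inverse_pair u w"
  then obtain w where w: "inverse_pair u w" by blast
  then have P: "w \<in> \<P>" by (simp add: inverse_pair_def)
  have "bij_betw (lam u) \<O> \<O>"
    by (rule bij_betwI[of _ _ _ "lam w"])
      (use inverse_pair_lam[OF w] inverse_pair_lam[OF inverse_pair_sym[OF w]] lam_in_\<O>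
        \<P>_unitary \<P>_in_\<O> u P in auto)
  then show "lam u \<in> star_auts \<O>"
    using lam_endo[OF \<P>_unitary[OF u] \<P>_in_\<O>[OF u]] by (simp add: star_auts_def)
qed

lemma perm_auts_eq: "perm_auts n S = {lam u | u. \<exists>w. inverse_pair u w}"
  unfolding perm_auts_def using aut_iff_inverse_pair by (auto simp: inverse_pair_def)

lemma diagonal_level_\<D>: "x \<in> diagonal_level n S k \<Longrightarrow> x \<in> \<D>"
proof -
  assume "x \<in> diagonal_level n S k"
  then obtain c where "x = (\<Sum>\<mu>\<in>W k. c \<mu> *\<^sub>C P \<mu>)" unfolding diagonal_level_def by blast
  then show ?thesis
    by (simp only:) (rule csubspace_sum[OF \<D>D(7)], rule \<D>D(5), rule P_in_\<D>, erule W_words)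
qed

lemma P_in_level: "i \<in> {1..n} \<Longrightarrow> P [i] \<in> diagonal_level n S 1"
proof -
  assume i: "i \<in> {1..n}"
  then have "[i] \<in> W 1" by (simp add: W_iff)
  then have "(\<Sum>\<mu>\<in>W 1. (if \<mu> = [i] then 1 else 0) *\<^sub>C P \<mu>) = P [i]"
    by (simp add: if_distrib[of "\<lambda>c. c *\<^sub>C _"] cong: if_cong)
  then show ?thesis unfolding diagonal_level_def by (intro CollectI exI conjI TrueI) (rule sym)
qed

subsection \<open>Restriction to the diagonal\<close>

text \<open>
  The shift \<open>\<phi>\<close> and \<open>\<lambda>\<^sub>u\<close> commute up to \<open>Ad u\<close>. As \<open>u\<^sup>* = \<lambda>\<^sub>u(w)\<close>, that correction is trivial
  on elements commuting with \<open>w\<close>, and \<open>w\<close> commutes with the range of a high power of \<open>\<phi>\<close>.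
\<close>

lemma lam_shift_commute:
  assumes uw: "inverse_pair u w" and m: "permutes_at m w" "m \<le> Suc k" and x: "x \<in> \<O>"
  shows "lam u ((\<phi> ^^ Suc k) x) = \<phi> (lam u ((\<phi> ^^ k) x))"
proof -
  have u: "u \<in> \<P>" and w: "w \<in> \<P>" and luw: "lam u w = adj u" using uw by (simp_all add: inverse_pair_def)
  note u' = \<P>_unitary[OF u] \<P>_in_\<O>[OF u]
  define y where "y = (\<phi> ^^ k) x"
  have y: "y \<in> \<O>" unfolding y_def by (rule shift_pow_\<O>[OF x])
  have "w * \<phi> y = \<phi> y * w"
    using permutes_at_commute[OF permutes_at_mono[OF m], of x] by (simp add: y_def)
  then have "adj u * lam u (\<phi> y) = lam u (\<phi> y) * adj u"
    using lamD(3)[OF u' \<P>_in_\<O>[OF w] shift_\<O>[OF y]] lamD(3)[OF u' shift_\<O>[OF y] \<P>_in_\<O>[OF w]] luw by simp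
  then have "adj u * (u * \<phi> (lam u y) * adj u) = lam u (\<phi> y) * adj u"
    using lam_shift[OF u' y] by simp
  then have "adj u * (u * \<phi> (lam u y) * adj u) * u = lam u (\<phi> y) * adj u * u" by simp
  then have "\<phi> (lam u y) = lam u (\<phi> y)" by (simp add: mult.assoc unitary_simps[OF u'(1)])
  then show ?thesis by (simp add: y_def)
qed

lemma property_P_lam:
  assumes uw: "inverse_pair u w"
  shows "property_P n S (restrict (lam u) \<D>)"
proof -
  obtain m where m: "permutes_at m w" using uw \<P>_level by (auto simp: inverse_pair_def)
  have step: "lam u ((\<phi> ^^ (m + j)) x) = (\<phi> ^^ j) (lam u ((\<phi> ^^ m) x))" if "x \<in> \<O>" for j x
    by (induction j) (use lam_shift_commute[OF uw m _ that] in auto)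
  show ?thesis unfolding property_P_def
  proof (intro exI[of _ m] allI impI ballI)
    fix k x assume k: "m \<le> k" and x: "x \<in> diagonal_level n S 1"
    then have "x \<in> \<D>" using diagonal_level_\<D> by blast
    then show "restrict (lam u) \<D> ((\<phi> ^^ k) x) = (\<phi> ^^ (k - m)) (restrict (lam u) \<D> ((\<phi> ^^ m) x))"
      using step[of x "k - m"] k by (simp add: shift_pow_\<D> \<D>_subset)
  qed
qed

lemma restrict_lam_endo:
  assumes u: "u \<in> \<P>"
  shows "restrict (lam u) \<D> \<in> unital_star_endos \<D>"
  using lamD[OF \<P>_unitary[OF u] \<P>_in_\<O>[OF u]] lam_\<D>[OF u] \<D>D one_in_\<D> \<D>_subset
  unfolding unital_star_endos_def by auto

lemma restrict_lam_bij:
  assumes uw: "inverse_pair u w"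
  shows "bij_betw (restrict (lam u) \<D>) \<D> \<D>"
    and "restrict (inv_into \<D> (restrict (lam u) \<D>)) \<D> = restrict (lam w) \<D>"
proof -
  have u: "u \<in> \<P>" and w: "w \<in> \<P>" using uw by (simp_all add: inverse_pair_def)
  have uw': "lam u (lam w x) = x" "lam w (lam u x) = x" if "x \<in> \<D>" for x
    using inverse_pair_lam[OF uw] inverse_pair_lam[OF inverse_pair_sym[OF uw]] \<D>_subset[OF that] by auto
  show bij: "bij_betw (restrict (lam u) \<D>) \<D> \<D>"
    by (rule bij_betwI[of _ _ _ "lam w"]) (use uw' lam_\<D> u w in auto)
  show "restrict (inv_into \<D> (restrict (lam u) \<D>)) \<D> = restrict (lam w) \<D>"
  proof (rule restrict_ext)
    fix x assume x: "x \<in> \<D>"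
    show "inv_into \<D> (restrict (lam u) \<D>) x = lam w x"
    proof (rule inv_into_f_eq)
      show "inj_on (restrict (lam u) \<D>) \<D>" using bij by (rule bij_betw_imp_inj_on)
    qed (use x uw' lam_\<D>[OF w] in auto)
  qed
qed

lemma restrict_lam_in:
  assumes uw: "inverse_pair u w"
  shows "restrict (lam u) \<D> \<in> diag_auts_P n S"
  using restrict_lam_bij[OF uw] property_P_lam[OF uw] property_P_lam[OF inverse_pair_sym[OF uw]]
    restrict_lam_endo uw by (simp add: diag_auts_P_def star_auts_def inverse_pair_def)

text \<open>\<open>adj v * u\<close> commutes with each \<open>P [i]\<close>, by comparing values
  there, and with \<open>\<phi> y\<close> for diagonal \<open>y\<close>, because
  \<open>y = lam u (lam w y)\<close> and \<open>lam_shift\<close> can be compared on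
  \<open>lam w y\<close>. Products of these elements give all \<open>P \<mu>\<close>, so
  \<open>\<P>_commute_\<D>\<close> applies.\<close>

lemma restrict_lam_inj:
  assumes uw: "inverse_pair u w" and v: "v \<in> \<P>"
    and eq: "\<And>x. x \<in> \<D> \<Longrightarrow> lam u x = lam v x"
  shows "u = v"
proof -
  have u: "u \<in> \<P>" and w: "w \<in> \<P>" using uw by (simp_all add: inverse_pair_def)
  note u' = \<P>_unitary[OF u] \<P>_in_\<O>[OF u] and v' = \<P>_unitary[OF v] \<P>_in_\<O>[OF v]
  have comm: "adj v * u * x = x * (adj v * u)" if "u * x * adj u = v * x * adj v" for x
  proof -
    have "adj v * (u * x * adj u) * u = adj v * (v * x * adj v) * u" using that by simp
    then show ?thesis by (simp add: mult.assoc unitary_simps[OF u'(1)] unitary_simps[OF v'(1)])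
  qed
  have shift: "adj v * u * \<phi> y = \<phi> y * (adj v * u)" if y: "y \<in> \<D>" for y
  proof (rule comm)
    have wy: "lam w y \<in> \<D>" by (rule lam_\<D>[OF w y])
    have "lam u (lam w y) = y" by (rule inverse_pair_lam[OF uw \<D>_subset[OF y]])
    then show "u * \<phi> y * adj u = v * \<phi> y * adj v"
      using lam_shift[OF u' \<D>_subset[OF wy]] lam_shift[OF v' \<D>_subset[OF wy]]
        eq[OF wy] eq[OF shift_\<D>[OF wy]] by simp
  qed
  have single: "adj v * u * P [i] = P [i] * (adj v * u)" if i: "i \<in> {1..n}" for i
  proof (rule comm)
    have w: "[i] \<in> words" using i by simp
    then show "u * P [i] * adj u = v * P [i] * adj v"
      using lam_P[OF u' w] lam_P[OF v' w] eq[OF P_in_\<D>[OF w]] by simp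
  qed
  have "adj v * u = 1"
  proof (rule \<P>_commute_\<D>)
    show "adj v * u \<in> \<P>" by (intro \<P>_mult \<P>_adj u v)
    fix \<mu> assume \<mu>: "\<mu> \<in> words"
    show "adj v * u * P \<mu> = P \<mu> * (adj v * u)"
    proof (cases \<mu>)
      case (Cons i \<nu>)
      then have i: "i \<in> {1..n}" and \<nu>: "\<nu> \<in> words" using \<mu> by auto
      have "P \<mu> = P [i] * \<phi> (P \<nu>)"
        using P_append[of "[i]" 1 \<nu>] i by (simp add: Cons W_iff)
      then show ?thesis using single[OF i] shift[OF P_in_\<D>[OF \<nu>]] by (metis mult.assoc)
    qed simp
  qed
  then have "v * (adj v * u) = v" by simp
  then show ?thesis by (simp add: unitary_simps[OF v'(1)])
qed

text \<open>Property (P) only speaks of level 1. The factorisation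
  \<open>P (i # \<rho>) = P [i] * \<phi> (P \<rho>)\<close> trades a letter for one more shift, so
  an induction with \<open>k\<close> arbitrary reaches all words from the same \<open>m\<close>, and
  continuity the whole diagonal.\<close>

lemma property_P_step:
  assumes \<alpha>: "\<alpha> \<in> unital_star_endos \<D>" and P: "property_P n S \<alpha>"
  shows "\<exists>m. \<forall>k\<ge>m. \<forall>z\<in>\<D>. \<alpha> ((\<phi> ^^ Suc k) z) = \<phi> (\<alpha> ((\<phi> ^^ k) z))"
proof -
  interpret star_endo \<D> \<alpha> by (rule star_endo_\<D>[OF \<alpha>])
  obtain m where m: "\<And>k x. k \<ge> m \<Longrightarrow> x \<in> diagonal_level n S 1 \<Longrightarrow>
      \<alpha> ((\<phi> ^^ k) x) = (\<phi> ^^ (k - m)) (\<alpha> ((\<phi> ^^ m) x))"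
    using P unfolding property_P_def by blast
  have lvl: "\<alpha> ((\<phi> ^^ Suc k) x) = \<phi> (\<alpha> ((\<phi> ^^ k) x))" if "k \<ge> m" "x \<in> diagonal_level n S 1" for k x
    using m[of "Suc k" x] m[of k x] that by (simp add: Suc_diff_le)
  have word: "\<alpha> ((\<phi> ^^ Suc k) (P \<rho>)) = \<phi> (\<alpha> ((\<phi> ^^ k) (P \<rho>)))" if "k \<ge> m" "\<rho> \<in> words" for k \<rho>
    using that(2,1)
  proof (induction \<rho> arbitrary: k)
    case Nil
    show ?case using fD(6) by (simp add: shift_pow_1[of "Suc k", simplified])
  next
    case (Cons i \<rho>)
    have i: "[i] \<in> words" using Cons.hyps by simp
    have eq: "(\<phi> ^^ k) (P (i # \<rho>)) = (\<phi> ^^ k) (P [i]) * (\<phi> ^^ Suc k) (P \<rho>)" for k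
      using P_append[of "[i]" 1 \<rho>] Cons.hyps by (simp add: W_iff shift_pow_mult funpow_swap1)
    have mult: "\<alpha> ((\<phi> ^^ k) (P (i # \<rho>))) = \<alpha> ((\<phi> ^^ k) (P [i])) * \<alpha> ((\<phi> ^^ Suc k) (P \<rho>))" for k
      unfolding eq by (intro fD(3) shift_pow_\<D> P_in_\<D> i Cons.hyps)
    have "\<alpha> ((\<phi> ^^ Suc k) (P (i # \<rho>))) = \<phi> (\<alpha> ((\<phi> ^^ k) (P [i]))) * \<phi> (\<alpha> ((\<phi> ^^ Suc k) (P \<rho>)))"
      unfolding mult
      using lvl[OF Cons.prems P_in_level[OF Cons.hyps(1)]] Cons.IH[of "Suc k"] Cons.prems by simp
    also have "\<dots> = \<phi> (\<alpha> ((\<phi> ^^ k) (P (i # \<rho>))))" unfolding mult by (rule shift_mult[symmetric])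
    finally show ?case .
  qed
  have "\<alpha> ((\<phi> ^^ Suc k) z) = \<phi> (\<alpha> ((\<phi> ^^ k) z))" if k: "k \<ge> m" and z: "z \<in> \<D>" for k z
  proof -
    have "z \<in> {z \<in> \<D>. \<alpha> ((\<phi> ^^ Suc k) z) = (\<phi> ^^ 1) (\<alpha> ((\<phi> ^^ k) z))}" using z
    proof (rule \<D>_induct)
      show "csubspace {z \<in> \<D>. \<alpha> ((\<phi> ^^ Suc k) z) = (\<phi> ^^ 1) (\<alpha> ((\<phi> ^^ k) z))}"
        unfolding csubspace_def mem_Collect_eq
        by (auto simp only: \<D>D shift_pow_add shift_pow_scaleC shift_pow_0 f_0 fD(2,4) shift_pow_\<D>)
      show "closed {z \<in> \<D>. \<alpha> ((\<phi> ^^ Suc k) z) = (\<phi> ^^ 1) (\<alpha> ((\<phi> ^^ k) z))}"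
        by (intro equalizer_closed \<D>D continuous_on_shift_pow continuous_on_compose2[OF f_continuous]
            continuous_on_id) (auto simp del: funpow.simps intro: shift_pow_\<D>)
    qed (use word[OF k] P_in_\<D> in simp)
    then show ?thesis by simp
  qed
  then show ?thesis by blast
qed

text \<open>If \<open>lam u\<close> agrees with \<open>\<alpha>\<close>, then \<open>u * (S i *
  \<alpha> x * adj (S i)) * adj u = \<alpha> (S i * x * adj (S i))\<close>. Substituting
  \<open>\<gamma> y\<close> for \<open>x\<close> prescribes conjugation by \<open>u\<close> on each
  first-letter block, and \<open>\<beta>\<close> is this prescription on all of
  \<open>\<D>\<close>.\<close>

lemma diag_endo_extends:
  assumes \<alpha>: "\<alpha> \<in> unital_star_endos \<D>" and \<gamma>: "\<gamma> \<in> unital_star_endos \<D>"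
    and \<alpha>\<gamma>: "\<And>x. x \<in> \<D> \<Longrightarrow> \<alpha> (\<gamma> x) = x" and \<gamma>\<alpha>: "\<And>x. x \<in> \<D> \<Longrightarrow> \<gamma> (\<alpha> x) = x"
    and P: "property_P n S \<alpha>" "property_P n S \<gamma>"
  obtains u where "u \<in> \<P>" "\<And>x. x \<in> \<D> \<Longrightarrow> lam u x = \<alpha> x"
proof -
  interpret \<alpha>: star_endo \<D> \<alpha> by (rule star_endo_\<D>[OF \<alpha>])
  interpret \<gamma>: star_endo \<D> \<gamma> by (rule star_endo_\<D>[OF \<gamma>])
  obtain m1 where m1: "\<And>k z. k \<ge> m1 \<Longrightarrow> z \<in> \<D> \<Longrightarrow> \<alpha> ((\<phi> ^^ Suc k) z) = \<phi> (\<alpha> ((\<phi> ^^ k) z))"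
    using property_P_step[OF \<alpha> P(1)] by blast
  obtain m2 where m2: "\<And>k z. k \<ge> m2 \<Longrightarrow> z \<in> \<D> \<Longrightarrow> \<gamma> ((\<phi> ^^ Suc k) z) = \<phi> (\<gamma> ((\<phi> ^^ k) z))"
    using property_P_step[OF \<gamma> P(2)] by blast
  define m where "m = max m1 m2"
  have \<gamma>m: "\<gamma> ((\<phi> ^^ (m + j)) z) = (\<phi> ^^ j) (\<gamma> ((\<phi> ^^ m) z))" if "z \<in> \<D>" for j z
    by (induction j) (use m2 that in \<open>auto simp: m_def\<close>)
  define c where "c \<mu> y = adj (s \<mu>) * y * s \<mu>" for \<mu> and y :: 'a
  \<comment> \<open>A sum over \<open>W 1\<close> rather than over letters, so that
    \<open>block_mult\<close> and \<open>shift_pow_word\<close> apply.\<close>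
  define \<theta> where "\<theta> y = (\<Sum>\<mu>\<in>W 1. s \<mu> * \<gamma> (c \<mu> y) * adj (s \<mu>))" for y
  have c_in: "c \<mu> y \<in> \<D>" if "\<mu> \<in> W 1" "y \<in> \<D>" for \<mu> y
    using that compress_\<D> by (auto simp: W_1 c_def word_Cons simp del: atLeastAtMost_iff)
  have \<theta>_in: "\<theta> y \<in> \<D>" if "y \<in> \<D>" for y
    unfolding \<theta>_def by (intro csubspace_sum[OF \<D>D(7)] word_shift_\<D> \<gamma>.fD(1) c_in that W_words)
  have c_mult: "c \<mu> (x * y) = c \<mu> x * c \<mu> y" if "\<mu> \<in> W 1" "x \<in> \<D>" "y \<in> \<D>" for \<mu> x y
  proof -
    have w: "\<mu> \<in> words" using that W_words by blast
    have "c \<mu> x * c \<mu> y = adj (s \<mu>) * (x * P \<mu>) * y * s \<mu>" by (simp add: c_def P_def mult.assoc)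
    also have "\<dots> = adj (s \<mu>) * s \<mu> * adj (s \<mu>) * x * y * s \<mu>"
      unfolding \<D>_comm[OF that(2) P_in_\<D>[OF w]] by (simp add: P_def mult.assoc)
    finally show ?thesis using word_isom[OF w] by (simp add: c_def mult.assoc)
  qed
  define \<beta> where "\<beta> = (\<lambda>y\<in>\<D>. \<alpha> (\<theta> y))"
  have \<theta>_add: "\<theta> (x + y) = \<theta> x + \<theta> y" if "x \<in> \<D>" "y \<in> \<D>" for x y
  proof -
    have "\<gamma> (c \<mu> (x + y)) = \<gamma> (c \<mu> x) + \<gamma> (c \<mu> y)" if "\<mu> \<in> W 1" for \<mu>
      using \<gamma>.fD(2)[OF c_in c_in, OF that \<open>x \<in> \<D>\<close> that \<open>y \<in> \<D>\<close>] by (simp add: c_def distrib_left distrib_right)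
    then show ?thesis by (simp add: \<theta>_def distrib_left distrib_right sum.distrib)
  qed
  have \<theta>_mult: "\<theta> (x * y) = \<theta> x * \<theta> y" if "x \<in> \<D>" "y \<in> \<D>" for x y
  proof -
    have "\<gamma> (c \<mu> (x * y)) = \<gamma> (c \<mu> x) * \<gamma> (c \<mu> y)" if "\<mu> \<in> W 1" for \<mu>
      using \<gamma>.fD(3)[OF c_in c_in, OF that \<open>x \<in> \<D>\<close> that \<open>y \<in> \<D>\<close>] c_mult[OF that \<open>x \<in> \<D>\<close> \<open>y \<in> \<D>\<close>] by simp
    then show ?thesis unfolding \<theta>_def block_mult by (intro sum.cong) auto
  qed
  have \<theta>_scale: "\<theta> (d *\<^sub>C x) = d *\<^sub>C \<theta> x" if "x \<in> \<D>" for d x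
  proof -
    have "\<gamma> (c \<mu> (d *\<^sub>C x)) = d *\<^sub>C \<gamma> (c \<mu> x)" if "\<mu> \<in> W 1" for \<mu>
      using \<gamma>.fD(4)[OF c_in, OF that \<open>x \<in> \<D>\<close>] by (simp add: c_def scaleC_mult_left scaleC_mult_right)
    then show ?thesis by (simp add: \<theta>_def scaleC_mult_left scaleC_mult_right scaleC_sum_right)
  qed
  have \<theta>_adj: "\<theta> (adj x) = adj (\<theta> x)" if "x \<in> \<D>" for x
  proof -
    have "\<gamma> (c \<mu> (adj x)) = adj (\<gamma> (c \<mu> x))" if "\<mu> \<in> W 1" for \<mu>
      using \<gamma>.fD(5)[OF c_in, OF that \<open>x \<in> \<D>\<close>] by (simp add: c_def adj_mult adj_adj mult.assoc)
    then show ?thesis by (simp add: \<theta>_def adj_sum adj_mult adj_adj mult.assoc)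
  qed
  have \<theta>_1: "\<theta> 1 = 1"
  proof -
    have "c \<mu> 1 = 1" if "\<mu> \<in> W 1" for \<mu> using word_isom[OF W_words[OF that]] by (simp add: c_def)
    then show ?thesis using sum_P[of 1] by (simp add: \<theta>_def \<gamma>.fD(6))
  qed
  have \<theta>_shift: "\<theta> (\<phi> y) = \<phi> (\<gamma> y)" for y
  proof -
    have "c \<mu> (\<phi> y) = y" if "\<mu> \<in> W 1" for \<mu>
      using shift_pow_word[OF that, of y] word_isom2[OF W_words[OF that], of y] by (simp add: c_def mult.assoc)
    then show ?thesis using shift_pow[of 1 "\<gamma> y"] by (simp add: \<theta>_def)
  qed
  have \<theta>_block: "\<theta> (S i * x * adj (S i)) = S i * \<gamma> x * adj (S i)" if i: "i \<in> {1..n}" for i x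
  proof -
    have "\<theta> (S i * x * adj (S i)) = (\<Sum>j=1..n. S j * \<gamma> (adj (S j) * (S i * x * adj (S i)) * S j) * adj (S j))"
      by (simp add: \<theta>_def c_def sum_W_1 word_Cons)
    also have "\<dots> = (\<Sum>j=1..n. if j = i then S j * \<gamma> x * adj (S j) else 0)"
    proof (rule sum.cong)
      fix j assume j: "j \<in> {1..n}"
      have "adj (S j) * (S i * x * adj (S i)) * S j = (adj (S j) * S i) * x * (adj (S i) * S j)"
        by (simp add: mult.assoc)
      then show "S j * \<gamma> (adj (S j) * (S i * x * adj (S i)) * S j) * adj (S j)
          = (if j = i then S j * \<gamma> x * adj (S j) else 0)"
        unfolding S_adj_S[OF i j] S_adj_S[OF j i] using \<gamma>.f_0 by auto
    qed simp
    finally show ?thesis using i by simp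
  qed
  have \<beta>_endo: "\<beta> \<in> unital_star_endos \<D>"
    unfolding unital_star_endos_def \<beta>_def
    by (auto simp: \<D>D one_in_\<D> \<theta>_in \<alpha>.fD(1-6) \<theta>_add \<theta>_mult \<theta>_scale \<theta>_adj \<theta>_1)
  have \<beta>_nz: "\<beta> (P \<mu>) \<noteq> 0" if \<mu>: "\<mu> \<in> words" for \<mu>
  proof (cases \<mu>)
    case Nil
    then show ?thesis by (simp add: \<beta>_def one_in_\<D> \<theta>_1 \<alpha>.fD(6))
  next
    case (Cons i \<nu>)
    then have i: "i \<in> {1..n}" and \<nu>: "\<nu> \<in> words" using \<mu> by auto
    have D: "S i * \<gamma> (P \<nu>) * adj (S i) \<in> \<D>" by (intro S_shift_\<D> \<gamma>.fD(1) P_in_\<D> \<nu> i)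
    show ?thesis
    proof
      assume "\<beta> (P \<mu>) = 0"
      then have "\<alpha> (S i * \<gamma> (P \<nu>) * adj (S i)) = 0"
        using P_in_\<D>[OF \<mu>] \<theta>_block[OF i, of "P \<nu>"] by (simp add: \<beta>_def Cons P_Cons)
      then have "S i * \<gamma> (P \<nu>) * adj (S i) = 0" using \<gamma>\<alpha>[OF D] \<gamma>.f_0 by simp
      then have "adj (S i) * (S i * \<gamma> (P \<nu>) * adj (S i)) * S i = 0" by simp
      moreover have "adj (S i) * (S i * \<gamma> (P \<nu>) * adj (S i)) * S i = (adj (S i) * S i) * \<gamma> (P \<nu>) * (adj (S i) * S i)"
        by (simp add: mult.assoc)
      ultimately have "\<gamma> (P \<nu>) = 0" using S_isometry[OF i] by simp
      then have "P \<nu> = 0" using \<alpha>\<gamma>[OF P_in_\<D>[OF \<nu>]] \<alpha>.f_0 by simp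
      then show False using P_nonzero[OF \<nu>] by simp
    qed
  qed
  \<comment> \<open>Since \<open>\<theta>\<close> turns \<open>\<phi> z\<close> into
    \<open>\<phi> (\<gamma> z)\<close>, \<open>\<beta>\<close> fixes \<open>\<phi> z\<close> once
    \<open>\<alpha>\<close> commutes with the outer shift on \<open>\<gamma> z\<close>. For this
    \<open>\<gamma> z\<close> must be in the range of \<open>\<phi> ^^ m\<close>: one
    \<open>m\<close> is spent on the shift law of \<open>\<gamma>\<close>, a second on that of
    \<open>\<alpha>\<close>, and the \<open>Suc\<close> is the outer shift.\<close>
  have \<beta>_fix: "\<beta> ((\<phi> ^^ Suc (m + m)) (P \<rho>)) = (\<phi> ^^ Suc (m + m)) (P \<rho>)" if \<rho>: "\<rho> \<in> words" for \<rho>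
  proof -
    define z where "z = (\<phi> ^^ (m + m)) (P \<rho>)"
    define z' where "z' = \<gamma> ((\<phi> ^^ m) (P \<rho>))"
    have zD: "z \<in> \<D>" "z' \<in> \<D>" "\<phi> z \<in> \<D>"
      unfolding z_def z'_def by (intro shift_\<D> \<gamma>.fD(1) shift_pow_\<D> P_in_\<D> \<rho>)+
    have gz: "\<gamma> z = (\<phi> ^^ m) z'" unfolding z_def z'_def by (rule \<gamma>m[OF P_in_\<D>[OF \<rho>]])
    have "\<beta> (\<phi> z) = \<alpha> ((\<phi> ^^ Suc m) z')" using zD by (simp add: \<beta>_def \<theta>_shift gz)
    also have "\<dots> = \<phi> (\<alpha> (\<gamma> z))" unfolding gz by (rule m1) (use zD in \<open>auto simp: m_def\<close>)
    also have "\<dots> = \<phi> z" using \<alpha>\<gamma>[OF zD(1)] by simp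
    finally show ?thesis by (simp add: z_def)
  qed
  obtain u where u: "u \<in> \<P>" "\<And>y. y \<in> \<D> \<Longrightarrow> \<beta> y = u * y * adj u"
    using \<D>_endo_inner[OF \<beta>_endo \<beta>_nz \<beta>_fix] by blast
  note u' = \<P>_unitary[OF u(1)] \<P>_in_\<O>[OF u(1)]
  interpret L: star_endo \<O> "lam u" by (rule lam_star_endo[OF u'])
  have word: "lam u (P \<mu>) = \<alpha> (P \<mu>)" if "\<mu> \<in> words" for \<mu>
    using that
  proof (induction \<mu>)
    case Nil
    show ?case by (simp add: L.fD(6) \<alpha>.fD(6))
  next
    case (Cons i \<mu>)
    note i = Cons.hyps(1) and \<mu> = Cons.hyps(2)
    have D: "S i * \<alpha> (P \<mu>) * adj (S i) \<in> \<D>" by (intro S_shift_\<D> \<alpha>.fD(1) P_in_\<D> \<mu> i)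
    have "lam u (P (i # \<mu>)) = lam u (S i) * lam u (P \<mu>) * adj (lam u (S i))"
      unfolding P_Cons using S_in_\<O>[OF i] \<D>_subset[OF P_in_\<D>[OF \<mu>]]
      by (simp only: L.fD(3) L.fD(5) \<O>D(4) \<O>D(6))
    also have "\<dots> = u * (S i * \<alpha> (P \<mu>) * adj (S i)) * adj u"
      unfolding lam_S[OF u' i] Cons.IH by (simp add: adj_mult mult.assoc)
    also have "\<dots> = \<alpha> (\<theta> (S i * \<alpha> (P \<mu>) * adj (S i)))"
      using u(2)[OF D] D by (simp add: \<beta>_def)
    also have "\<dots> = \<alpha> (P (i # \<mu>))"
      unfolding \<theta>_block[OF i] P_Cons using \<gamma>\<alpha>[OF P_in_\<D>[OF \<mu>]] by simp
    finally show ?case .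
  qed
  then have "restrict (lam u) \<D> = \<alpha>"
    using P_in_\<D> by (intro \<D>_endo_eqI restrict_lam_endo u(1) \<alpha>) simp
  then have "lam u x = \<alpha> x" if "x \<in> \<D>" for x using that by (metis restrict_apply')
  then show ?thesis using that u(1) by blast
qed

lemma diag_auts_extend:
  assumes \<alpha>: "\<alpha> \<in> diag_auts_P n S"
  shows "\<exists>u w. inverse_pair u w \<and> \<alpha> = restrict (lam u) \<D>"
proof -
  define \<gamma> where "\<gamma> = restrict (inv_into \<D> \<alpha>) \<D>"
  have \<alpha>e: "\<alpha> \<in> unital_star_endos \<D>" and bij: "bij_betw \<alpha> \<D> \<D>"
    and P: "property_P n S \<alpha>" "property_P n S \<gamma>"
    using \<alpha> by (simp_all add: diag_auts_P_def star_auts_def \<gamma>_def)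
  interpret \<alpha>: star_endo \<D> \<alpha> by (rule star_endo_\<D>[OF \<alpha>e])
  have \<alpha>\<gamma>: "\<alpha> (\<gamma> x) = x" "\<gamma> x \<in> \<D>" if "x \<in> \<D>" for x
    using that bij by (auto simp: \<gamma>_def bij_betw_def f_inv_into_f inv_into_into)
  have \<gamma>\<alpha>: "\<gamma> (\<alpha> x) = x" if "x \<in> \<D>" for x
    using that bij \<alpha>.fD(1) by (simp add: \<gamma>_def bij_betw_def inv_into_f_f)
  have \<gamma>I: "\<gamma> y = x" if "x \<in> \<D>" "\<alpha> x = y" for x y using \<gamma>\<alpha> that by blast
  have "\<gamma> \<in> unital_star_endos \<D>"
    unfolding unital_star_endos_def
  proof (intro CollectI conjI ballI allI)
    show "\<gamma> \<in> \<D> \<rightarrow>\<^sub>E \<D>" using \<alpha>\<gamma>(2) by (auto simp: \<gamma>_def)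
  qed (intro \<gamma>I; simp add: \<D>D \<alpha>\<gamma> \<alpha>.fD(2-6) one_in_\<D>)+
  note \<gamma>e = this
  obtain u where u: "u \<in> \<P>" "\<And>x. x \<in> \<D> \<Longrightarrow> lam u x = \<alpha> x"
    using diag_endo_extends[OF \<alpha>e \<gamma>e \<alpha>\<gamma>(1) \<gamma>\<alpha> P] by blast
  obtain w where w: "w \<in> \<P>" "\<And>x. x \<in> \<D> \<Longrightarrow> lam w x = \<gamma> x"
    using diag_endo_extends[OF \<gamma>e \<alpha>e \<gamma>\<alpha> \<alpha>\<gamma>(1) P(2,1)] by blast
  have one: "inverse_pair 1 1" using lamD(6)[OF unitary_1 one_in_\<O>] \<P>_1 by (simp add: inverse_pair_def)
  \<comment> \<open>\<open>lam a\<close> after \<open>lam b\<close> is the identity on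
    \<open>\<D>\<close>, and so is \<open>lam 1\<close>; \<open>restrict_lam_inj\<close> turns this
    into \<open>lam a b * a = 1\<close>, which gives the inverse relation on all of
    \<open>\<O>\<close>.\<close>
  have inv: "lam a b = adj a" if ab: "a \<in> \<P>" "b \<in> \<P>" "\<And>x. x \<in> \<D> \<Longrightarrow> lam a (lam b x) = x" for a b
  proof -
    note a' = \<P>_unitary[OF ab(1)] \<P>_in_\<O>[OF ab(1)] and b' = \<P>_unitary[OF ab(2)] \<P>_in_\<O>[OF ab(2)]
    have "lam 1 x = lam (lam a b * a) x" if "x \<in> \<D>" for x
      using ab(3)[OF that] \<D>_subset[OF that] by (simp add: lam_1 compose_eq flip: lam_compose[OF a' b'])
    then have "1 = lam a b * a"
      by (intro restrict_lam_inj[OF one] \<P>_mult lam_\<P> ab)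
    then have "adj a = lam a b * (a * adj a)" by (metis mult.assoc mult_1_left)
    then show ?thesis by (simp add: unitary_simps[OF a'(1)])
  qed
  have "inverse_pair u w"
    unfolding inverse_pair_def using u w inv[of u w] inv[of w u] \<alpha>\<gamma> \<gamma>\<alpha> \<alpha>.fD(1) by simp
  moreover have "\<alpha> = restrict (lam u) \<D>"
    using u(2) \<alpha>.fD(8) by (intro extensionalityI[of _ \<D>]) auto
  ultimately show ?thesis by blast
qed

end

text \<open>Cosets are sets, so the induced map is the direct image under \<open>h\<close>; it
  respects set products because \<open>h\<close> is a homomorphism.\<close>

lemma iso_quotients:
  assumes G: "group G" and H: "group H" and N: "N \<lhd> G" and h: "h \<in> iso G H"
  shows "\<exists>\<Phi>\<in>iso (G Mod N) (H Mod h ` N). \<forall>a\<in>carrier G. \<Phi> (N #>\<^bsub>G\<^esub> a) = h ` N #>\<^bsub>H\<^esub> h a"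
proof -
  interpret G: group G by fact
  interpret N: normal N G by fact
  have hom: "h \<in> hom G H" and bij: "bij_betw h (carrier G) (carrier H)" using h by (auto simp: iso_def)
  have M: "h ` N \<lhd> H" by (rule iso_normal_subgroup[OF h G H N])
  have mult: "h (x \<otimes>\<^bsub>G\<^esub> y) = h x \<otimes>\<^bsub>H\<^esub> h y" if "x \<in> carrier G" "y \<in> carrier G" for x y
    by (rule hom_mult[OF hom that])
  have coset: "h ` (N #>\<^bsub>G\<^esub> a) = h ` N #>\<^bsub>H\<^esub> h a" if "a \<in> carrier G" for a
    using mult N.subset that by (force simp: r_coset_def)
  have sub: "X \<subseteq> carrier G" if "X \<in> carrier (G Mod N)" for X
    using that N.subset by (auto simp: carrier_FactGroup dest: G.r_coset_subset_G[THEN subsetD])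
  have "(`) h \<in> hom (G Mod N) (H Mod h ` N)"
  proof (rule homI)
    fix X Y assume X: "X \<in> carrier (G Mod N)" and Y: "Y \<in> carrier (G Mod N)"
    show "h ` X \<in> carrier (H Mod h ` N)"
      using X hom_in_carrier[OF hom] by (auto simp: carrier_FactGroup coset)
    have "h (x \<otimes>\<^bsub>G\<^esub> y) = h x \<otimes>\<^bsub>H\<^esub> h y" if "x \<in> X" "y \<in> Y" for x y
      using mult sub[OF X] sub[OF Y] that by blast
    then show "h ` (X \<otimes>\<^bsub>G Mod N\<^esub> Y) = h ` X \<otimes>\<^bsub>H Mod h ` N\<^esub> h ` Y"
      by (simp add: set_mult_def image_UN cong: SUP_cong)
  qed
  moreover have "bij_betw ((`) h) (carrier (G Mod N)) (carrier (H Mod h ` N))"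
  proof (rule bij_betw_imageI)
    show "inj_on ((`) h) (carrier (G Mod N))"
    proof (rule inj_onI)
      fix X Y assume "X \<in> carrier (G Mod N)" "Y \<in> carrier (G Mod N)" "h ` X = h ` Y"
      then show "X = Y" using inj_on_image_eq_iff[OF bij_betw_imp_inj_on[OF bij] sub sub] by simp
    qed
    have "carrier (H Mod h ` N) = (\<lambda>a. h ` N #>\<^bsub>H\<^esub> h a) ` carrier G"
      unfolding carrier_FactGroup bij_betw_imp_surj_on[OF bij, symmetric] image_image by (rule refl)
    also have "\<dots> = (`) h ` carrier (G Mod N)"
      unfolding carrier_FactGroup image_image by (intro image_cong refl coset[symmetric])
    finally show "(`) h ` carrier (G Mod N) = carrier (H Mod h ` N)" by simp
  qed
  ultimately have "(`) h \<in> iso (G Mod N) (H Mod h ` N)" by (simp add: iso_def)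
  then show ?thesis using coset by blast
qed

context cuntz
begin

section \<open>The two groups, their inner subgroups and the restriction between them\<close>

lemma perm_aut_group_simps:
  "carrier (perm_aut_group n S) = perm_auts n S"
  "mult (perm_aut_group n S) = compose \<O>"
  "one (perm_aut_group n S) = (\<lambda>x\<in>\<O>. x)"
  by (simp_all add: perm_aut_group_def comp_group_def)

lemma diag_aut_group_simps:
  "carrier (diag_aut_group n S) = diag_auts_P n S"
  "mult (diag_aut_group n S) = compose \<D>"
  "one (diag_aut_group n S) = (\<lambda>x\<in>\<D>. x)"
  by (simp_all add: diag_aut_group_def comp_group_def)

lemma perm_autsE:
  assumes "f \<in> perm_auts n S"
  obtains u w where "inverse_pair u w" "f = lam u"
  using assms by (auto simp: perm_auts_eq)

lemma inverse_pairD: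
  assumes "inverse_pair u w"
  shows "u \<in> \<P>" "w \<in> \<P>" "lam u w = adj u" "lam w u = adj w"
  using assms by (simp_all add: inverse_pair_def)

lemma perm_auts_star: "f \<in> perm_auts n S \<Longrightarrow> f \<in> star_auts \<O>"
  by (auto simp: perm_auts_def)

lemma perm_auts_PiE: "f \<in> perm_auts n S \<Longrightarrow> f \<in> \<O> \<rightarrow>\<^sub>E \<O>"
  using perm_auts_star by (auto simp: star_auts_def unital_star_endos_def)

lemma compose_lam_pair:
  assumes "inverse_pair u w"
  shows "compose \<O> (lam u) (lam w) = (\<lambda>x\<in>\<O>. x)"
  using inverse_pair_lam[OF assms] by (auto simp: compose_def)

lemma perm_auts_compose:
  assumes "f \<in> perm_auts n S" "g \<in> perm_auts n S"
  shows "compose \<O> f g \<in> perm_auts n S"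
proof -
  obtain u u' where u: "inverse_pair u u'" "f = lam u" using assms(1) by (rule perm_autsE)
  obtain v v' where v: "inverse_pair v v'" "g = lam v" using assms(2) by (rule perm_autsE)
  have P: "u \<in> \<P>" "v \<in> \<P>" using u v inverse_pairD by auto
  have eq: "compose \<O> f g = lam (lam u v * u)"
    unfolding u(2) v(2) by (intro lam_compose \<P>_unitary \<P>_in_\<O> P)
  have uv: "lam u v * u \<in> \<P>" by (intro \<P>_mult lam_\<P> P)
  have "bij_betw (compose \<O> f g) \<O> \<O>"
    using perm_auts_star assms by (intro bij_betw_compose) (auto simp: star_auts_def)
  then have "lam (lam u v * u) \<in> star_auts \<O>"
    unfolding star_auts_def eq using lam_endo[OF \<P>_unitary[OF uv] \<P>_in_\<O>[OF uv]] by simp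
  then show ?thesis using uv unfolding eq perm_auts_def by blast
qed

lemma group_perm_auts: "group (perm_aut_group n S)"
proof (rule groupI; unfold perm_aut_group_simps)
  have "lam 1 \<in> star_auts \<O>"
    using lam_endo[OF unitary_1 one_in_\<O>] by (simp add: lam_1 star_auts_def bij_betw_def inj_on_def)
  then show "(\<lambda>x\<in>\<O>. x) \<in> perm_auts n S" 
    using \<P>_1 lam_1 unfolding perm_auts_def by (intro CollectI exI[of _ 1]) simp
  show "compose \<O> f g \<in> perm_auts n S" if "f \<in> perm_auts n S" "g \<in> perm_auts n S" for f g
    using that by (rule perm_auts_compose)
  show "compose \<O> (compose \<O> f g) h = compose \<O> f (compose \<O> g h)"
    if "f \<in> perm_auts n S" "g \<in> perm_auts n S" "h \<in> perm_auts n S" for f g h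
    using that perm_auts_PiE by (intro compose_assoc[symmetric]) blast
  show "compose \<O> (\<lambda>x\<in>\<O>. x) f = f" if "f \<in> perm_auts n S" for f
    using perm_auts_PiE[OF that] by (intro Id_compose) (auto simp: PiE_def)
  show "\<exists>g\<in>perm_auts n S. compose \<O> g f = (\<lambda>x\<in>\<O>. x)" if "f \<in> perm_auts n S" for f
  proof -
    obtain u w where u: "inverse_pair u w" "f = lam u" using \<open>f \<in> perm_auts n S\<close> by (rule perm_autsE)
    then have "lam w \<in> perm_auts n S" using inverse_pair_sym by (auto simp: perm_auts_eq)
    then show ?thesis using compose_lam_pair[OF inverse_pair_sym[OF u(1)]] u(2) by blast
  qed
qed

lemma perm_auts_inv:
  assumes "inverse_pair u w"
  shows "inv\<^bsub>perm_aut_group n S\<^esub> (lam u) = lam w"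
proof (rule group.inv_equality[OF group_perm_auts]; unfold perm_aut_group_simps)
  show "compose \<O> (lam w) (lam u) = (\<lambda>x\<in>\<O>. x)"
    by (rule compose_lam_pair[OF inverse_pair_sym[OF assms]])
qed (use assms inverse_pair_sym in \<open>auto simp: perm_auts_eq\<close>)

lemma Ad_compose:
  assumes "v \<in> \<P>" "v' \<in> \<P>"
  shows "compose \<O> (Ad_on \<O> v) (Ad_on \<O> v') = Ad_on \<O> (v * v')"
  using assms \<P>_in_\<O> \<O>D(4,6) by (auto simp: compose_def Ad_on_def adj_mult mult.assoc fun_eq_iff)

lemma Ad_adj_compose:
  assumes v: "v \<in> \<P>"
  shows "compose \<O> (Ad_on \<O> (adj v)) (Ad_on \<O> v) = (\<lambda>x\<in>\<O>. x)"
  using Ad_compose[OF \<P>_adj[OF v] v] unitary_simps[OF \<P>_unitary[OF v]] by (simp add: Ad_on_def)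

text \<open>\<open>v * S i * adj v = v * \<phi> (adj v) * S i\<close>, so conjugation by
  \<open>v\<close> is \<open>lam\<close> of the permutative unitary
  \<open>v * \<phi> (adj v)\<close>.\<close>

lemma Ad_perm_aut:
  assumes v: "v \<in> \<P>"
  shows "Ad_on \<O> v \<in> perm_auts n S"
proof -
  note v' = \<P>_unitary[OF v] \<P>_in_\<O>[OF v]
  have endo: "Ad_on \<O> v \<in> unital_star_endos \<O>"
    by (intro Ad_endo \<O>_subalgebra one_in_\<O> v' \<O>D)
  have eq: "lam (v * \<phi> (adj v)) = Ad_on \<O> v"
  proof (rule lam_unique[OF endo])
    fix i assume i: "i \<in> {1..n}"
    show "Ad_on \<O> v (S i) = v * \<phi> (adj v) * S i"
      using S_in_\<O>[OF i] shift_S[OF i, of "adj v"] by (simp add: Ad_on_def mult.assoc)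
  qed
  moreover have "v * \<phi> (adj v) \<in> \<P>" by (intro \<P>_mult \<P>_shift \<P>_adj v)
  moreover have "bij_betw (Ad_on \<O> v) \<O> \<O>"
    by (rule bij_betwI[of _ _ _ "Ad_on \<O> (adj v)"])
      (use v' \<O>D(4,6) in \<open>auto simp: Ad_on_def adj_adj mult.assoc unitary_simps[OF v'(1)]\<close>)
  ultimately show ?thesis
    unfolding perm_auts_def star_auts_def using endo eq
    by (intro CollectI exI[of _ "v * \<phi> (adj v)"]) simp
qed

lemma inner_normal: "inner_perm_auts n S \<lhd> perm_aut_group n S"
proof -
  interpret G: group "perm_aut_group n S" by (rule group_perm_auts)
  note simps = perm_aut_group_simps
  have "subgroup (inner_perm_auts n S) (perm_aut_group n S)"
  proof (rule G.subgroupI)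
    show "inner_perm_auts n S \<subseteq> carrier (perm_aut_group n S)"
      using Ad_perm_aut by (auto simp: inner_perm_auts_def simps)
    show "inner_perm_auts n S \<noteq> {}" using \<P>_1 by (auto simp: inner_perm_auts_def)
  next
    fix a assume "a \<in> inner_perm_auts n S"
    then obtain v where v: "v \<in> \<P>" "a = Ad_on \<O> v" by (auto simp: inner_perm_auts_def)
    have "inv\<^bsub>perm_aut_group n S\<^esub> a = Ad_on \<O> (adj v)"
      by (rule G.inv_equality) (simp_all add: simps v Ad_adj_compose Ad_perm_aut \<P>_adj)
    then show "inv\<^bsub>perm_aut_group n S\<^esub> a \<in> inner_perm_auts n S"
      using \<P>_adj[OF v(1)] by (simp add: inner_perm_auts_def)
  next
    fix a b assume "a \<in> inner_perm_auts n S" "b \<in> inner_perm_auts n S"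
    then show "a \<otimes>\<^bsub>perm_aut_group n S\<^esub> b \<in> inner_perm_auts n S"
      using \<P>_mult by (auto simp: inner_perm_auts_def simps Ad_compose)
  qed
  moreover have "f \<otimes>\<^bsub>perm_aut_group n S\<^esub> a \<otimes>\<^bsub>perm_aut_group n S\<^esub> inv\<^bsub>perm_aut_group n S\<^esub> f \<in> inner_perm_auts n S"
    if f: "f \<in> carrier (perm_aut_group n S)" and a: "a \<in> inner_perm_auts n S" for f a
  proof -
    obtain u w where u: "inverse_pair u w" "f = lam u"
      using f by (auto simp: simps elim: perm_autsE)
    note P = inverse_pairD[OF u(1)]
    note u' = \<P>_unitary[OF P(1)] \<P>_in_\<O>[OF P(1)] and w' = \<P>_unitary[OF P(2)] \<P>_in_\<O>[OF P(2)]
    obtain v where v: "v \<in> \<P>" "a = Ad_on \<O> v" using a by (auto simp: inner_perm_auts_def)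
    note v' = \<P>_in_\<O>[OF v(1)]
    \<comment> \<open>Conjugating \<open>Ad v\<close> by \<open>lam u\<close> gives
      \<open>Ad (lam u v)\<close>, and \<open>lam u v\<close> is again permutative.\<close>
    have "lam u (v * lam w x * adj v) = lam u v * x * adj (lam u v)" if x: "x \<in> \<O>" for x
      using lamD(3,5)[OF u'] lam_in_\<O>[OF w' x] v' \<O>D(4,6) inverse_pair_lam[OF u(1) x] by simp
    then have "compose \<O> (compose \<O> (lam u) (Ad_on \<O> v)) (lam w) = Ad_on \<O> (lam u v)"
      using lam_in_\<O>[OF w'] by (auto simp: compose_def Ad_on_def fun_eq_iff)
    then show ?thesis
      using lam_\<P>[OF P(1) v(1)] by (simp add: simps u v perm_auts_inv[OF u(1)] inner_perm_auts_def)
  qed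
  ultimately show ?thesis using G.normal_inv_iff by blast
qed

abbreviation restr where "restr \<equiv> (\<lambda>\<alpha>. restrict \<alpha> \<D>)"

lemma restr_hom: "restr \<in> hom (perm_aut_group n S) (diag_aut_group n S)"
proof (rule homI; unfold perm_aut_group_simps diag_aut_group_simps)
  show "restr f \<in> diag_auts_P n S" if "f \<in> perm_auts n S" for f
    using that restrict_lam_in by (auto elim: perm_autsE)
  fix f g assume "g \<in> perm_auts n S"
  then obtain v v' where v: "inverse_pair v v'" "g = lam v" by (rule perm_autsE)
  then have "g x \<in> \<D>" if "x \<in> \<D>" for x using lam_\<D> inverse_pairD(1) that by blast
  then show "restr (compose \<O> f g) = compose \<D> (restr f) (restr g)"
    using \<D>_subset by (auto simp: compose_def fun_eq_iff)
qed

lemma restr_iso: "restr \<in> iso (perm_aut_group n S) (diag_aut_group n S)"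
proof -
  have "inj_on restr (perm_auts n S)"
  proof (rule inj_onI)
    fix f g assume fg: "f \<in> perm_auts n S" "g \<in> perm_auts n S" "restr f = restr g"
    obtain u u' where u: "inverse_pair u u'" "f = lam u" using fg(1) by (rule perm_autsE)
    obtain v v' where v: "inverse_pair v v'" "g = lam v" using fg(2) by (rule perm_autsE)
    have "lam u x = lam v x" if "x \<in> \<D>" for x using fg(3) that by (metis u(2) v(2) restrict_apply')
    then have "u = v" by (rule restrict_lam_inj[OF u(1) inverse_pairD(1)[OF v(1)]])
    then show "f = g" using u v by simp
  qed
  moreover have "restr ` perm_auts n S = diag_auts_P n S"
  proof
    show "restr ` perm_auts n S \<subseteq> diag_auts_P n S" using restrict_lam_in by (auto elim: perm_autsE)
    show "diag_auts_P n S \<subseteq> restr ` perm_auts n S"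
      using diag_auts_extend by (fastforce simp: perm_auts_eq)
  qed
  ultimately show ?thesis
    using restr_hom by (simp add: iso_def bij_betw_def perm_aut_group_simps diag_aut_group_simps)
qed

text \<open>The group laws are transported along \<open>restr_iso\<close>: every element of
  \<open>diag_auts_P n S\<close> is a restriction of some \<open>lam u\<close>, so closure of
  property (P) under composition follows from that of the permutative automorphisms.\<close>

lemma group_diag_auts: "group (diag_aut_group n S)"
proof -
  have "restr \<one>\<^bsub>perm_aut_group n S\<^esub> = \<one>\<^bsub>diag_aut_group n S\<^esub>"
    using \<D>_subset by (auto simp: perm_aut_group_simps diag_aut_group_simps fun_eq_iff)
  then show ?thesis using group.iso_imp_img_group[OF group_perm_auts restr_iso] by simp
qed

lemma restr_inner: "restr ` inner_perm_auts n S = inner_diag_auts n S"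
proof -
  have "restr (Ad_on \<O> v) = Ad_on \<D> v" for v
    using \<D>_subset by (auto simp: Ad_on_def fun_eq_iff)
  then show ?thesis by (simp add: inner_perm_auts_def inner_diag_auts_def image_image)
qed

end

theorem corollary4p1:
  fixes S :: "nat \<Rightarrow> 'a::cstar_algebra" and n :: nat
  assumes "n \<ge> 2" and "cuntz_family n S"
  shows "inner_perm_auts n S \<lhd> perm_aut_group n S
    \<and> inner_diag_auts n S \<lhd> diag_aut_group n S
    \<and> (\<lambda>\<alpha>. restrict \<alpha> (diagonal n S)) \<in> hom (perm_aut_group n S) (diag_aut_group n S)
    \<and> (\<exists>\<Phi> \<in> iso (perm_aut_group n S Mod inner_perm_auts n S)
                 (diag_aut_group n S Mod inner_diag_auts n S).
         \<forall>\<alpha> \<in> carrier (perm_aut_group n S).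
           \<Phi> (inner_perm_auts n S #>\<^bsub>perm_aut_group n S\<^esub> \<alpha>) =
           inner_diag_auts n S #>\<^bsub>diag_aut_group n S\<^esub> restrict \<alpha> (diagonal n S))"
proof -
  interpret cuntz n S by unfold_locales fact+
  show ?thesis
    using inner_normal restr_hom
      iso_normal_subgroup[OF restr_iso group_perm_auts group_diag_auts inner_normal]
      iso_quotients[OF group_perm_auts group_diag_auts inner_normal restr_iso]
    unfolding restr_inner by blast
qed

end
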